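(* Let $d\ge 2$, $\nu=\tfrac d2-1$, and $\rho>0$. Then \[ \mathbf{C}_d(\rho):=\sup_{0\neq f\in L^2(\mathbb S^{d-1})} \frac{\displaystyle \frac1\rho\int_{B_\rho} \lvert \widehat{f\sigma}(x)\rvert^2\, \frac{\mathrm{d} x}{(2\pi)^d}}{\lVert f\rVert_{L^2(\mathbb S^{d-1})}^2} \] is attained (it is a maximum), and \[ \mathbf{C}_d(\rho)=\begin{cases} \Lambda_{0,d}(\rho), & (J_\nu J_{\nu+1})(\rho)\ge 0,\\ \Lambda_{1,d}(\rho), & (J_\nu J_{\nu+1})(\rho)\le 0.\end{cases} \] Moreover, a function $0\neq f\in L^2(\mathbb S^{d-1})$ attains the maximum if and only if $f\in\mathcal M_d(\rho)\setminus\{0\}$, where $\mathcal M_d(\rho)$ equals (i) $\mathcal H_0$ if $(J_\nu J_{\nu+1})(\rho)>0$; (ii) $\mathcal H_1$ if $(J_\nu J_{\nu+1})(\rho)<0$; (iii) $\mathcal H_0\oplus\mathcal H_1$ if $J_\nu(\rho)=0$; (iv) $\mathcal H_0\oplus\mathcal H_1\oplus\mathcal H_2$ if $J_{\nu+1}(\rho)=0$.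
   Context: $\mathbb S^{d-1}\subset\mathbb R^d$ is the unit sphere with its standard surface measure $\sigma$; $B_\rho\subset\mathbb R^d$ is the open ball of radius $\rho$ centred at the origin. For $f\in L^2(\mathbb S^{d-1})$, $\widehat{f\sigma}(\xi)=\int_{\mathbb S^{d-1}} f(\omega)e^{-i\omega\cdot\xi}\,\mathrm{d}\sigma(\omega)$ for $\xi\in\mathbb R^d$. $J_\alpha$ denotes the Bessel function of the first kind of order $\alpha$ (with $J_{-1}=-J_1$), and $(J_\alpha J_\beta)(\rho)=J_\alpha(\rho)J_\beta(\rho)$. For $k\in\mathbb N_{\ge0}$, $\Lambda_{k,d}(\rho):=\frac\rho2 J_{\nu+k}^2(\rho)-\frac\rho2 J_{\nu+k-1}(\rho)J_{\nu+k+1}(\rho)$. $\mathcal H_k\subset L^2(\mathbb S^{d-1})$ denotes the space of spherical harmonics of degree $k$ (restrictions to $\mathbb S^{d-1}$ of complex-valued homogeneous harmonic polynomials of degree $k$ on $\mathbb R^d$, together with $0$); in particular $\mathcal H_0$ is the space of constants. *)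

theory Defs
  imports "HOL-Analysis.Analysis"
begin

text \<open>Bessel function of the first kind, via its power series (for x > 0).
  Using the reciprocal Gamma function, this gives J_{-1} = - J_1 automatically.\<close>
definition bessel_J :: "real \<Rightarrow> real \<Rightarrow> real" where
  "bessel_J a x = (\<Sum>m. (-1) ^ m * rGamma (real m + a + 1) / fact m * (x / 2) powr (2 * real m + a))"

definition Lambda :: "nat \<Rightarrow> real \<Rightarrow> real \<Rightarrow> real" where
  "Lambda k \<nu> \<rho> = \<rho> / 2 * (bessel_J (\<nu> + real k) \<rho>)\<^sup>2
      - \<rho> / 2 * bessel_J (\<nu> + real k - 1) \<rho> * bessel_J (\<nu> + real k + 1) \<rho>"

text \<open>Surface measure on the unit sphere: d times the Lebesgue measure of the cone
  (pushforward of Lebesgue measure on the punctured unit ball under x / |x|).\<close>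
definition sphere_measure :: "(real ^ 'n) measure" where
  "sphere_measure = scale_measure (of_nat CARD('n))
     (distr (restrict_space lborel (ball 0 1 - {0})) (restrict_space borel (sphere 0 1))
        (\<lambda>x. x /\<^sub>R norm x))"

definition L2_sphere :: "(real ^ 'n \<Rightarrow> complex) set" where
  "L2_sphere = {f. f \<in> borel_measurable sphere_measure \<and>
                   integrable sphere_measure (\<lambda>\<omega>. (cmod (f \<omega>))\<^sup>2)}"

definition L2_norm_sq :: "(real ^ 'n \<Rightarrow> complex) \<Rightarrow> real" where
  "L2_norm_sq f = (\<integral>\<omega>. (cmod (f \<omega>))\<^sup>2 \<partial>sphere_measure)"

definition extension_op :: "(real ^ 'n \<Rightarrow> complex) \<Rightarrow> real ^ 'n \<Rightarrow> complex" where
  "extension_op f \<xi> = (\<integral>\<omega>. f \<omega> * exp (- \<i> * complex_of_real (\<omega> \<bullet> \<xi>)) \<partial>sphere_measure)"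

definition ball_ratio :: "real \<Rightarrow> (real ^ 'n \<Rightarrow> complex) \<Rightarrow> real" where
  "ball_ratio \<rho> f =
     (1 / \<rho> * (LINT x : ball 0 \<rho> | lborel. (cmod (extension_op f x))\<^sup>2 / (2 * pi) ^ CARD('n)))
     / L2_norm_sq f"

definition C_opt :: "'n::finite itself \<Rightarrow> real \<Rightarrow> real" where
  "C_opt _ \<rho> = Sup {ball_ratio \<rho> (f :: real ^ 'n \<Rightarrow> complex) | f.
                      f \<in> L2_sphere \<and> \<not> (AE \<omega> in sphere_measure. f \<omega> = 0)}"

definition monomial_fun :: "('n \<Rightarrow> nat) \<Rightarrow> real ^ 'n \<Rightarrow> real" where
  "monomial_fun \<alpha> x = (\<Prod>i\<in>UNIV. (x $ i) ^ (\<alpha> i))"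

definition homogeneous_poly :: "nat \<Rightarrow> (real ^ 'n \<Rightarrow> complex) \<Rightarrow> bool" where
  "homogeneous_poly k P \<longleftrightarrow> (\<exists>A c. finite A \<and> (\<forall>\<alpha>\<in>A. (\<Sum>i\<in>UNIV. \<alpha> i) = k) \<and>
       P = (\<lambda>x. \<Sum>\<alpha>\<in>A. c \<alpha> * complex_of_real (monomial_fun \<alpha> x)))"

definition laplacian :: "(real ^ 'n \<Rightarrow> complex) \<Rightarrow> real ^ 'n \<Rightarrow> complex" where
  "laplacian P x = (\<Sum>i\<in>UNIV.
      vector_derivative (\<lambda>s. vector_derivative (\<lambda>t. P (x + t *\<^sub>R axis i 1)) (at s)) (at 0))"

definition harmonic :: "(real ^ 'n \<Rightarrow> complex) \<Rightarrow> bool" where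
  "harmonic P \<longleftrightarrow> (\<forall>x. laplacian P x = 0)"

definition sph_harm :: "nat \<Rightarrow> (real ^ 'n \<Rightarrow> complex) set" where
  "sph_harm k = {g. \<exists>P. homogeneous_poly k P \<and> harmonic P \<and> (\<forall>\<omega>\<in>sphere 0 1. g \<omega> = P \<omega>)}"

definition sph_harm_sum :: "nat set \<Rightarrow> (real ^ 'n \<Rightarrow> complex) set" where
  "sph_harm_sum K = {(\<lambda>x. \<Sum>k\<in>K. g k x) | g. \<forall>k\<in>K. g k \<in> sph_harm k}"

definition in_L2_class :: "(real ^ 'n \<Rightarrow> complex) \<Rightarrow> (real ^ 'n \<Rightarrow> complex) set \<Rightarrow> bool" where
  "in_L2_class f M \<longleftrightarrow> (\<exists>g\<in>M. AE \<omega> in sphere_measure. f \<omega> = g \<omega>)"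

end

theory Submission
  imports Defs "HOL-Probability.Probability"
begin

text \<open>
  On \<^term>\<open>sph_harm k\<close> the quadratic form acts as multiplication by \<open>\<Lambda>\<^sub>k\<close>: if \<open>Y\<close> is the restriction of a harmonic
  homogeneous polynomial \<open>P\<close> of degree \<open>k\<close>, then expanding the exponential and using
  \<open>\<integral> P(\<omega>) (\<omega> \<bullet> \<xi>)\<^sup>n d\<sigma>(\<omega>) = c |\<xi>|\<^bsup>n-k\<^esup> P(\<xi>)\<close> gives a multiple of \<open>|\<xi>|\<^bsup>-\<nu>\<^esup> J\<^bsub>\<nu>+k\<^esub>(|\<xi>|) P(\<xi>/|\<xi>|)\<close>, whose
  square integrates to \<open>\<Lambda>\<^sub>k\<close> by a Lommel integral. The moments on the sphere come from polar
  coordinates and Gaussian integration by parts.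

  The recurrences give \<open>\<Lambda>\<^sub>k - \<Lambda>\<^bsub>k+1\<^esub> = J\<^bsub>\<nu>+k\<^esub> J\<^bsub>\<nu>+k+1\<^esub>\<close> and \<open>\<Lambda>\<^sub>k - \<Lambda>\<^bsub>k+2\<^esub> = 2(\<nu>+k+1)/\<rho> J\<^bsub>\<nu>+k+1\<^esub>\<^sup>2 \<ge> 0\<close>,
  and \<open>\<Lambda>\<^sub>k > 0\<close> excludes common zeros of consecutive Bessel functions. So the maximal value is
  \<open>max \<Lambda>\<^sub>0 \<Lambda>\<^sub>1\<close>, it is attained for \<open>k\<close> in a set \<open>K \<subseteq> {0, 1, 2}\<close>, and the other \<open>\<Lambda>\<^sub>k\<close> stay below it
  by a uniform gap. Sums of spherical harmonics are dense, so the gap forces maximizers into the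
  closure of \<open>\<Oplus>\<^bsub>k\<in>K\<^esub> H\<^sub>k\<close>; this space is closed because it has an explicit reproducing kernel.
\<close>

section \<open>Homogeneous and harmonic polynomials\<close>

text \<open>Two obstacles shape the proof. The first is calculus on the sphere:
  \<open>sphere_measure\<close> is defined through cones, which suits no integration by parts. A
  Gaussian integral over the whole space replaces it. There integration by parts is an identity
  between one-dimensional moments, and for a homogeneous polynomial of degree k the Gaussian
  integral is the spherical integral times a positive number that depends only on k and the
  dimension. The second is that f is never expanded into an infinite series of harmonics. All
  spectral statements concern finite sums p; what passes to the limit is the single inequality delta
  dist^2 \<le> C |p|^2 - Q(p), with Q the quadratic form and dist the L2 distance of p to a sum of
  harmonics with degrees in K. The gap delta is uniform because the values \<open>Lambda k\<close>
  do not increase within each parity class, so that one even and one odd degree decide. And since K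
  has no degree above 2, its kernels can be written by hand, from constant, linear and trace-free
  quadratic polynomials.\<close>

definition partial :: "'n \<Rightarrow> (real^'n \<Rightarrow> complex) \<Rightarrow> real^'n \<Rightarrow> complex" where
  "partial i P x = vector_derivative (\<lambda>t. P (x + t *\<^sub>R axis i 1)) (at 0)"

inductive hom_poly :: "nat \<Rightarrow> (real^'n \<Rightarrow> complex) \<Rightarrow> bool" where
  hom_poly_const: "hom_poly 0 (\<lambda>x. c)"
| hom_poly_zero: "hom_poly k (\<lambda>x. 0)"
| hom_poly_add: "hom_poly k P \<Longrightarrow> hom_poly k Q \<Longrightarrow> hom_poly k (\<lambda>x. P x + Q x)"
| hom_poly_coord: "hom_poly k P \<Longrightarrow> hom_poly (Suc k) (\<lambda>x. complex_of_real (x $ i) * P x)"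

lemma coord_line:
  "((\<lambda>t. complex_of_real ((x + t *\<^sub>R axis i 1) $ j)) has_vector_derivative (if i = j then 1 else 0)) (at 0)"
  by (auto simp: axis_def intro!: derivative_eq_intros)

lemma hom_poly_differentiable:
  fixes P :: "real^'n \<Rightarrow> complex"
  assumes "hom_poly k P" shows "(\<lambda>t. P (x + t *\<^sub>R axis i 1)) differentiable at 0"
  using assms
proof induction
  case (hom_poly_coord k P j)
  have "(\<lambda>t. complex_of_real ((x + t *\<^sub>R axis i 1) $ j)) differentiable at 0"
    using coord_line[of x i j] by (auto simp: differentiable_def has_vector_derivative_def)
  from differentiable_mult[OF this hom_poly_coord.IH] show ?case .
qed auto

lemma hom_poly_partial_works:
  fixes P :: "real^'n \<Rightarrow> complex"
  assumes "hom_poly k P" shows "((\<lambda>t. P (x + t *\<^sub>R axis i 1)) has_vector_derivative partial i P x) (at 0)"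
  using hom_poly_differentiable[OF assms, of x i] unfolding partial_def by (simp add: vector_derivative_works)

lemma partial_eqI: "((\<lambda>t. P (x + t *\<^sub>R axis i 1)) has_vector_derivative D) (at 0) \<Longrightarrow> partial i P x = D"
  unfolding partial_def by (rule vector_derivative_at)

lemma partial_const [simp]: "partial i (\<lambda>x. c) = (\<lambda>x. 0)"
  by (auto simp: fun_eq_iff intro!: partial_eqI)

lemma partial_add: "hom_poly k P \<Longrightarrow> hom_poly l Q \<Longrightarrow> partial i (\<lambda>x. P x + Q x) = (\<lambda>x. partial i P x + partial i Q x)"
  by (auto simp: fun_eq_iff intro!: partial_eqI has_vector_derivative_add hom_poly_partial_works)

lemma partial_mult: "hom_poly k P \<Longrightarrow> hom_poly l Q \<Longrightarrow> partial i (\<lambda>x. P x * Q x) = (\<lambda>x. P x * partial i Q x + partial i P x * Q x)"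
  apply (rule ext, rule partial_eqI)
  apply (rule has_vector_derivative_eq_rhs, rule has_vector_derivative_mult, (rule hom_poly_partial_works, assumption)+)
  by simp

lemma partial_coord: "hom_poly k P \<Longrightarrow> partial i (\<lambda>x. complex_of_real (x $ j) * P x)
    = (\<lambda>x. (if i = j then P x else 0) + complex_of_real (x $ j) * partial i P x)"
  apply (rule ext, rule partial_eqI)
  apply (rule has_vector_derivative_eq_rhs, rule has_vector_derivative_mult, rule coord_line, rule hom_poly_partial_works, assumption)
  by simp

lemma partial_cmult: "hom_poly k P \<Longrightarrow> partial i (\<lambda>x. c * P x) = (\<lambda>x. c * partial i P x)"
  using partial_mult[OF hom_poly_const[of c], of k P i] by simp

lemma hom_poly_cmult:
  fixes P :: "real^'n \<Rightarrow> complex"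
  assumes "hom_poly k P" shows "hom_poly k (\<lambda>x. c * P x)"
  using assms
proof induction
  case (hom_poly_add k P Q) then show ?case by (simp add: distrib_left hom_poly.hom_poly_add)
next
  case (hom_poly_coord k P i)
  from hom_poly.hom_poly_coord[OF hom_poly_coord.IH, of i] show ?case by (simp add: mult.left_commute)
qed (auto intro: hom_poly.intros)

lemma hom_poly_sum: "(\<And>a. a \<in> A \<Longrightarrow> hom_poly k (P a)) \<Longrightarrow> hom_poly k (\<lambda>x. \<Sum>a\<in>A. P a x)"
  by (induction A rule: infinite_finite_induct) (auto intro: hom_poly.intros)

lemma partial_sum: "(\<And>a. a \<in> A \<Longrightarrow> hom_poly k (P a)) \<Longrightarrow> partial i (\<lambda>x. \<Sum>a\<in>A. P a x) = (\<lambda>x. \<Sum>a\<in>A. partial i (P a) x)"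
proof (induction A rule: infinite_finite_induct)
  case (insert a A)
  then have "hom_poly k (P a)" "hom_poly k (\<lambda>x. \<Sum>a\<in>A. P a x)" by (auto intro: hom_poly_sum)
  from partial_add[OF this] show ?case using insert by simp
qed auto

text \<open>The vanishing in degree 0 has to be carried along in the induction: differentiating a
  coordinate times P, with P of degree 0, produces that coordinate times a derivative of P, which
  would have degree 1 instead of 0 if the derivative were not zero.\<close>

lemma hom_poly_partial_aux:
  fixes P :: "real^'n \<Rightarrow> complex"
  assumes "hom_poly k P" shows "(k = 0 \<longrightarrow> partial i P = (\<lambda>x. 0)) \<and> hom_poly (k - 1) (partial i P)"
  using assms
proof induction
  case (hom_poly_add k P Q)
  then show ?case by (auto simp: partial_add intro: hom_poly.intros)
next
  case (hom_poly_coord k P j)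
  show ?case
  proof (cases k)
    case 0
    then show ?thesis using hom_poly_coord by (cases "i = j") (auto simp: partial_coord[OF hom_poly_coord.hyps] intro: hom_poly.intros)
  next
    case (Suc m)
    then have "hom_poly k (\<lambda>x. complex_of_real (x $ j) * partial i P x)" using hom_poly_coord by (auto intro: hom_poly.hom_poly_coord)
    then show ?thesis using hom_poly_coord.hyps by (cases "i = j") (auto simp: partial_coord[OF hom_poly_coord.hyps] intro!: hom_poly.hom_poly_add hom_poly_zero)
  qed
qed (auto intro: hom_poly.intros)

lemma hom_poly_partial: "hom_poly k P \<Longrightarrow> hom_poly (k - 1) (partial i P)" and partial_hp0: "hom_poly 0 P \<Longrightarrow> partial i P = (\<lambda>x. 0)"
  using hom_poly_partial_aux by blast+

lemma hom_poly_mult: "hom_poly k P \<Longrightarrow> hom_poly l Q \<Longrightarrow> hom_poly (k + l) (\<lambda>x. P x * Q x)"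
proof (induction rule: hom_poly.induct)
  case (hom_poly_coord k P i)
  from hom_poly.hom_poly_coord[OF hom_poly_coord.IH[OF hom_poly_coord.prems], of i] show ?case by (simp add: mult.assoc)
qed (auto simp: distrib_right intro: hom_poly.intros hom_poly_cmult)

lemma hom_poly_x: "hom_poly 1 (\<lambda>x. complex_of_real (x $ i))"
  using hom_poly_coord[OF hom_poly_const[of 1], of i] by simp

lemma hom_poly_power: "hom_poly k P \<Longrightarrow> hom_poly (n * k) (\<lambda>x. P x ^ n)"
  by (induction n) (auto intro: hom_poly_const hom_poly_mult)

lemma hom_poly_cnj: "hom_poly k P \<Longrightarrow> hom_poly k (\<lambda>x. cnj (P x))"
  by (induction rule: hom_poly.induct) (auto intro: hom_poly.intros)

lemma hom_poly_continuous: "hom_poly k P \<Longrightarrow> continuous_on S P"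
  by (induction rule: hom_poly.induct) (auto intro!: continuous_intros)

lemma hom_poly_scaleR: "hom_poly k P \<Longrightarrow> P (r *\<^sub>R x) = of_real r ^ k * P x"
  by (induction rule: hom_poly.induct) (simp_all add: distrib_left mult.assoc mult.left_commute)

lemma hom_poly_Euler:
  fixes P :: "real^'n \<Rightarrow> complex"
  shows "hom_poly k P \<Longrightarrow> (\<Sum>i\<in>UNIV. complex_of_real (x $ i) * partial i P x) = of_nat k * P x"
proof (induction rule: hom_poly.induct)
  case (hom_poly_add k P Q)
  then show ?case by (simp add: partial_add distrib_left sum.distrib)
next
  case (hom_poly_coord k P j)
  have "(\<Sum>i\<in>UNIV. complex_of_real (x $ i) * partial i (\<lambda>x. complex_of_real (x $ j) * P x) x)
    = (\<Sum>i\<in>UNIV. (if i = j then complex_of_real (x $ j) * P x else 0))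
      + complex_of_real (x $ j) * (\<Sum>i\<in>UNIV. complex_of_real (x $ i) * partial i P x)"
    unfolding sum_distrib_left sum.distrib[symmetric] partial_coord[OF hom_poly_coord.hyps]
    by (rule sum.cong) (auto simp: algebra_simps)
  also have "\<dots> = of_nat (Suc k) * (complex_of_real (x $ j) * P x)"
    unfolding hom_poly_coord.IH by (simp add: distrib_right mult.left_commute)
  finally show ?case .
qed auto

lemma partial_commute:
  fixes P :: "real^'n \<Rightarrow> complex"
  shows "hom_poly k P \<Longrightarrow> partial i (partial j P) = partial j (partial i P)"
proof (induction rule: hom_poly.induct)
  case (hom_poly_add k P Q)
  then show ?case by (simp add: partial_add[OF hom_poly_add.hyps] partial_add[OF hom_poly_partial hom_poly_partial])
next
  case (hom_poly_coord k P l)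
  have h: "hom_poly k (\<lambda>x. if b then P x else 0)" for b
    using hom_poly_coord.hyps by (cases b) (auto intro: hom_poly_zero)
  have p: "partial i (\<lambda>x. if b then P x else 0) = (\<lambda>x. if b then partial i P x else 0)" for b i
    by (cases b) auto
  have 1: "hom_poly (Suc (k-1)) (\<lambda>x. complex_of_real (x $ l) * partial j P x)" for j
    by (rule hom_poly.hom_poly_coord[OF hom_poly_partial[OF hom_poly_coord.hyps]])
  show ?case
    by (simp add: partial_coord[OF hom_poly_coord.hyps] partial_add[OF h 1] p partial_coord[OF hom_poly_partial[OF hom_poly_coord.hyps]] hom_poly_coord.IH fun_eq_iff)
qed auto

section \<open>The Laplacian on homogeneous polynomials\<close>

definition lap :: "(real^'n \<Rightarrow> complex) \<Rightarrow> real^'n \<Rightarrow> complex" where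
  "lap P x = (\<Sum>i\<in>UNIV. partial i (partial i P) x)"

text \<open>The inner derivative in \<open>laplacian\<close> is taken at an arbitrary parameter s,
  the one in \<open>partial\<close> at 0. Both sides choose a vector by the same predicate, so the
  equation is valid even where g has no derivative.\<close>

lemma vector_derivative_shift:
  "vector_derivative g (at s) = vector_derivative (\<lambda>t. g (s + t)) (at 0)"
proof -
  have "(g has_vector_derivative D) (at s) \<longleftrightarrow> ((\<lambda>t. g (s + t)) has_vector_derivative D) (at 0)" for D
  proof
    assume "(g has_vector_derivative D) (at s)"
    then have "(g has_vector_derivative D) (at (s + 0))" by simp
    moreover have "((\<lambda>t. s + t) has_vector_derivative 1) (at 0)" by (auto intro!: derivative_eq_intros)
    ultimately have "((g \<circ> (\<lambda>t. s + t)) has_vector_derivative 1 *\<^sub>R D) (at 0)" by (intro vector_diff_chain_at)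
    then show "((\<lambda>t. g (s + t)) has_vector_derivative D) (at 0)" by (simp add: o_def)
  next
    assume "((\<lambda>t. g (s + t)) has_vector_derivative D) (at 0)"
    then have "((\<lambda>t. g (s + t)) has_vector_derivative D) (at (s - s))" by simp
    moreover have "((\<lambda>t. t - s) has_vector_derivative 1) (at s)" by (auto intro!: derivative_eq_intros)
    ultimately have "((\<lambda>t. g (s + t)) \<circ> (\<lambda>t. t - s) has_vector_derivative 1 *\<^sub>R D) (at s)" by (intro vector_diff_chain_at)
    then show "(g has_vector_derivative D) (at s)" by (simp add: o_def)
  qed
  then show ?thesis by (simp add: vector_derivative_def)
qed

lemma laplacian_eq_lap: "laplacian P = lap P"
proof (rule ext)
  fix x
  have "vector_derivative (\<lambda>t. P (x + t *\<^sub>R axis i 1)) (at s) = partial i P (x + s *\<^sub>R axis i 1)" for i s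
    unfolding partial_def by (subst vector_derivative_shift) (simp add: algebra_simps)
  then show "laplacian P x = lap P x"
    unfolding laplacian_def lap_def by (simp add: partial_def[of _ "partial _ P"])
qed

lemma monomial_Suc: "monomial_fun (\<alpha>(i := Suc (\<alpha> i))) x = x $ i * monomial_fun \<alpha> x"
proof -
  have "monomial_fun (\<alpha>(i := Suc (\<alpha> i))) x = (\<Prod>j\<in>UNIV. (if j = i then x $ i else 1) * (x $ j) ^ \<alpha> j)"
    unfolding monomial_fun_def by (rule prod.cong) auto
  then show ?thesis by (simp add: prod.distrib monomial_fun_def)
qed

lemma sum_upd_Suc: "(\<Sum>j\<in>(UNIV::'n::finite set). (\<alpha>(i := Suc (\<alpha> i))) j) = Suc (\<Sum>j\<in>UNIV. \<alpha> j)"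
proof -
  have "(\<Sum>j\<in>UNIV. (\<alpha>(i := Suc (\<alpha> i))) j) = (\<Sum>j\<in>UNIV. \<alpha> j + (if j = i then 1 else 0))"
    by (rule sum.cong) auto
  then show ?thesis by (simp add: sum.distrib)
qed

lemma hom_poly_monomial: "(\<Sum>j\<in>(UNIV::'n::finite set). \<alpha> j) = k \<Longrightarrow> hom_poly k (\<lambda>x. complex_of_real (monomial_fun \<alpha> x))"
proof (induction k arbitrary: \<alpha>)
  case 0
  then have "monomial_fun \<alpha> x = 1" for x by (simp add: monomial_fun_def)
  then show ?case by (simp add: hom_poly_const)
next
  case (Suc k)
  then obtain i where i: "\<alpha> i \<noteq> 0" by (metis sum.neutral nat.distinct(1))
  define \<beta> where "\<beta> = \<alpha>(i := \<alpha> i - 1)"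
  have \<alpha>: "\<alpha> = \<beta>(i := Suc (\<beta> i))" using i by (auto simp: \<beta>_def)
  have "sum \<beta> UNIV = k" using Suc.prems by (subst (asm) \<alpha>) (simp add: sum_upd_Suc del: fun_upd_apply)
  from hom_poly_coord[OF Suc.IH[OF this], of i] show ?case
    by (subst \<alpha>) (simp add: monomial_Suc)
qed

lemma homogeneous_polyI_hom_poly: "hom_poly k P \<Longrightarrow> homogeneous_poly k P"
proof (induction rule: hom_poly.induct)
  case (hom_poly_const c)
  show ?case unfolding homogeneous_poly_def
    by (rule exI[of _ "{\<lambda>_. 0}"], rule exI[of _ "\<lambda>_. c"]) (auto simp: monomial_fun_def)
next
  case (hom_poly_zero k)
  show ?case unfolding homogeneous_poly_def
    by (rule exI[of _ "{}"]) auto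
next
  case (hom_poly_add k P Q)
  then obtain A c B e where A: "finite A" "\<forall>\<alpha>\<in>A. (\<Sum>i\<in>UNIV. \<alpha> i) = k" "P = (\<lambda>x. \<Sum>\<alpha>\<in>A. c \<alpha> * complex_of_real (monomial_fun \<alpha> x))"
   and B: "finite B" "\<forall>\<alpha>\<in>B. (\<Sum>i\<in>UNIV. \<alpha> i) = k" "Q = (\<lambda>x. \<Sum>\<alpha>\<in>B. e \<alpha> * complex_of_real (monomial_fun \<alpha> x))"
    unfolding homogeneous_poly_def by blast
  have "P x + Q x = (\<Sum>\<alpha>\<in>A\<union>B. ((if \<alpha> \<in> A then c \<alpha> else 0) + (if \<alpha> \<in> B then e \<alpha> else 0)) * complex_of_real (monomial_fun \<alpha> x))" for x
    unfolding distrib_right sum.distrib A(3) B(3)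
    using A(1) B(1)
    by (intro arg_cong2[where f = "(+)"] sum.mono_neutral_cong_left) auto
  then show ?case unfolding homogeneous_poly_def using A B
    by (intro exI[of _ "A \<union> B"] exI[of _ "\<lambda>\<alpha>. (if \<alpha> \<in> A then c \<alpha> else 0) + (if \<alpha> \<in> B then e \<alpha> else 0)"]) auto
next
  case (hom_poly_coord k P i)
  then obtain A c where A: "finite A" "\<forall>\<alpha>\<in>A. (\<Sum>i\<in>UNIV. \<alpha> i) = k" "P = (\<lambda>x. \<Sum>\<alpha>\<in>A. c \<alpha> * complex_of_real (monomial_fun \<alpha> x))"
    unfolding homogeneous_poly_def by blast
  let ?g = "\<lambda>\<alpha>. \<alpha>(i := Suc (\<alpha> i))" let ?h = "\<lambda>\<alpha>. \<alpha>(i := \<alpha> i - 1)"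
  have inj: "inj_on ?g A" by (rule inj_on_inverseI[of _ ?h]) auto
  have hg: "?h (?g \<alpha>) = \<alpha>" for \<alpha> by auto
  have "complex_of_real (x $ i) * P x = (\<Sum>\<beta>\<in>?g ` A. c (?h \<beta>) * complex_of_real (monomial_fun \<beta> x))" for x
    unfolding A(3) sum_distrib_left sum.reindex[OF inj] o_def hg monomial_Suc of_real_mult
    by (intro sum.cong refl mult.left_commute)
  then have "(\<lambda>x. complex_of_real (x $ i) * P x) = (\<lambda>x. \<Sum>\<beta>\<in>?g ` A. c (?h \<beta>) * complex_of_real (monomial_fun \<beta> x))"
    by (rule ext)
  moreover have "\<forall>\<beta>\<in>?g ` A. (\<Sum>j\<in>UNIV. \<beta> j) = Suc k" using A(2) by (simp add: sum_upd_Suc del: fun_upd_apply)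
  ultimately show ?case unfolding homogeneous_poly_def using A(1)
    by (intro exI[of _ "?g ` A"] exI[of _ "\<lambda>\<beta>. c (?h \<beta>)"] conjI finite_imageI)
qed

lemma homogeneous_poly_iff_hom_poly: "homogeneous_poly k P \<longleftrightarrow> hom_poly k P"
  by (auto simp: homogeneous_polyI_hom_poly) (auto simp: homogeneous_poly_def intro!: hom_poly_sum hom_poly_cmult hom_poly_monomial)

definition harm :: "nat \<Rightarrow> (real^'n \<Rightarrow> complex) \<Rightarrow> bool" where
  "harm k P \<longleftrightarrow> hom_poly k P \<and> lap P = (\<lambda>x. 0)"

lemma harm_hom_poly: "harm k P \<Longrightarrow> hom_poly k P" by (simp add: harm_def)

lemma lap_add: "hom_poly k P \<Longrightarrow> hom_poly l Q \<Longrightarrow> lap (\<lambda>x. P x + Q x) = (\<lambda>x. lap P x + lap Q x)"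
  by (simp add: lap_def fun_eq_iff partial_add partial_add[OF hom_poly_partial hom_poly_partial] sum.distrib)

lemma lap_cmult: "hom_poly k P \<Longrightarrow> lap (\<lambda>x. c * P x) = (\<lambda>x. c * lap P x)"
  by (simp add: lap_def fun_eq_iff partial_cmult partial_cmult[OF hom_poly_partial] sum_distrib_left)

lemma lap_zero [simp]: "lap (\<lambda>x. 0) = (\<lambda>x. 0)"
  by (simp add: lap_def fun_eq_iff)

lemma lap_sum: "(\<And>a. a \<in> A \<Longrightarrow> hom_poly k (P a)) \<Longrightarrow> lap (\<lambda>x. \<Sum>a\<in>A. P a x) = (\<lambda>x. \<Sum>a\<in>A. lap (P a) x)"
proof (induction A rule: infinite_finite_induct)
  case (insert a A)
  then have "hom_poly k (P a)" "hom_poly k (\<lambda>x. \<Sum>a\<in>A. P a x)" by (auto intro: hom_poly_sum)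
  from lap_add[OF this] show ?case using insert by simp
qed auto

lemma hom_poly_lap: "hom_poly k P \<Longrightarrow> hom_poly (k - 2) (lap P)"
  unfolding lap_def using hom_poly_partial[OF hom_poly_partial[of k P]] by (auto intro!: hom_poly_sum simp: numeral_2_eq_2)

lemma lap_hp1: assumes "hom_poly k P" "k < 2" shows "lap P = (\<lambda>x. 0)"
proof -
  have "k - 1 = 0" using assms by simp
  then have "partial i (partial i P) = (\<lambda>x. 0)" for i using partial_hp0 hom_poly_partial[OF assms(1)] by metis
  then show ?thesis by (simp add: lap_def fun_eq_iff)
qed

section \<open>Splitting off powers of the squared norm\<close>

definition sqnorm :: "real^'n \<Rightarrow> complex" where "sqnorm x = (\<Sum>i\<in>UNIV. complex_of_real (x $ i) * complex_of_real (x $ i))"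

lemma sqnorm_norm: "sqnorm x = of_real ((norm x)\<^sup>2)"
  unfolding sqnorm_def norm_vec_def L2_set_def by (simp add: sum_nonneg power2_eq_square)

lemma hom_poly_sqnorm: "hom_poly 2 sqnorm"
  unfolding sqnorm_def[abs_def] by (rule hom_poly_sum) (rule hom_poly_mult[OF hom_poly_x hom_poly_x, unfolded one_add_one])

lemma partial_x: "partial i (\<lambda>x. complex_of_real (x $ j)) = (\<lambda>x. if i = j then 1 else 0)"
  using partial_coord[OF hom_poly_const[of 1], of i j] by simp

lemma hom_poly_xx: "hom_poly 2 (\<lambda>x. complex_of_real (x $ j) * complex_of_real (x $ i))"
  by (rule hom_poly_mult[OF hom_poly_x hom_poly_x, unfolded one_add_one])

lemma partial_sqnorm: "partial i sqnorm = (\<lambda>x. 2 * complex_of_real (x $ i))"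
proof -
  have "partial i sqnorm = (\<lambda>x. \<Sum>j\<in>UNIV. partial i (\<lambda>x. complex_of_real (x $ j) * complex_of_real (x $ j)) x)"
    unfolding sqnorm_def[abs_def] by (rule partial_sum) (rule hom_poly_xx)
  also have "\<dots> = (\<lambda>x. \<Sum>j\<in>UNIV. if i = j then 2 * complex_of_real (x $ i) else 0)"
    by (intro ext sum.cong) (auto simp: partial_mult[OF hom_poly_x hom_poly_x] partial_x)
  finally show ?thesis by simp
qed

text \<open>Twice the scalar product of the gradients of |x|^2 and P is 4 x . grad P = 4 k P by
  Euler's identity, and the Laplacian of |x|^2 is twice the dimension.\<close>

lemma lap_sqnorm_mult:
  fixes P :: "real^'n \<Rightarrow> complex"
  assumes P: "hom_poly k P"
  shows "lap (\<lambda>x. sqnorm x * P x) = (\<lambda>x. sqnorm x * lap P x + of_nat (2 * CARD('n) + 4 * k) * P x)"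
proof (rule ext)
  fix x :: "real^'n"
  \<comment> \<open>Counting degrees would give 2 + (k - 1), which is wrong for k = 0; there the
    derivative is zero and fits any degree.\<close>
  have h1: "hom_poly (k+1) (\<lambda>x. sqnorm x * partial i P x)" for i
  proof (cases k)
    case 0
    then show ?thesis using P partial_hp0[of P i] by (simp add: hom_poly_zero)
  next
    case (Suc n) then show ?thesis using hom_poly_mult[OF hom_poly_sqnorm hom_poly_partial[OF P]] by simp
  qed
  have h2: "hom_poly (Suc k) (\<lambda>x. 2 * complex_of_real (x $ i) * P x)" for i
    using hom_poly_cmult[OF hom_poly_coord[OF P], of 2 i] by (simp add: mult.assoc)
  have eq: "partial i (\<lambda>x. 2 * complex_of_real (x $ i) * P x) = (\<lambda>x. 2 * P x + 2 * complex_of_real (x $ i) * partial i P x)" for i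
    using partial_cmult[OF hom_poly_coord[OF P, of i], of i 2] by (simp add: mult.assoc partial_coord[OF P] distrib_left)
  have "partial i (partial i (\<lambda>x. sqnorm x * P x)) x = sqnorm x * partial i (partial i P) x + (4 * (complex_of_real (x $ i) * partial i P x) + 2 * P x)" for i
  proof -
    have "partial i (\<lambda>x. sqnorm x * P x) = (\<lambda>x. sqnorm x * partial i P x + 2 * complex_of_real (x $ i) * P x)"
      by (simp add: partial_mult[OF hom_poly_sqnorm P] partial_sqnorm)
    then show ?thesis
      by (simp add: partial_add[OF h1 h2] partial_mult[OF hom_poly_sqnorm hom_poly_partial[OF P]] eq partial_sqnorm)
  qed
  then have "lap (\<lambda>x. sqnorm x * P x) x = sqnorm x * lap P x + (4 * (\<Sum>i\<in>UNIV. complex_of_real (x $ i) * partial i P x) + of_nat CARD('n) * (2 * P x))"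
    by (simp add: lap_def sum.distrib sum_distrib_left)
  then show "lap (\<lambda>x. sqnorm x * P x) x = sqnorm x * lap P x + of_nat (2 * CARD('n) + 4 * k) * P x"
    unfolding hom_poly_Euler[OF P] by (simp add: algebra_simps)
qed

text \<open>The constant is the sum of 2 n + 4 (k + 2 i) over i from 0 to j, where n is the
  dimension. Its positivity is what counts: it lets the Laplacian be inverted on such
  products.\<close>

lemma lap_sqnorm_power_harm:
  fixes H :: "real^'n \<Rightarrow> complex"
  assumes H: "harm k H"
  shows "\<exists>c::nat. c > 0 \<and> lap (\<lambda>x. sqnorm x ^ Suc j * H x) = (\<lambda>x. of_nat c * (sqnorm x ^ j * H x))"
proof (induction j)
  case 0
  then show ?case using lap_sqnorm_mult[OF harm_hom_poly[OF H]] H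
    by (intro exI[of _ "2 * CARD('n) + 4 * k"]) (auto simp: harm_def)
next
  case (Suc j)
  then obtain c :: nat where c: "c > 0" "lap (\<lambda>x. sqnorm x ^ Suc j * H x) = (\<lambda>x. of_nat c * (sqnorm x ^ j * H x))" by auto
  have h: "hom_poly (Suc j * 2 + k) (\<lambda>x. sqnorm x ^ Suc j * H x)" by (intro hom_poly_mult hom_poly_power hom_poly_sqnorm harm_hom_poly H)
  have e: "(\<lambda>x. sqnorm x ^ Suc (Suc j) * H x) = (\<lambda>x. sqnorm x * (sqnorm x ^ Suc j * H x))" by (simp only: power_Suc mult.assoc)
  have "lap (\<lambda>x. sqnorm x ^ Suc (Suc j) * H x) = (\<lambda>x. of_nat (c + (2 * CARD('n) + 4 * (Suc j * 2 + k))) * (sqnorm x ^ Suc j * H x))"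
    unfolding e lap_sqnorm_mult[OF h] c(2) of_nat_add[of c] distrib_right[of "of_nat c"] by (simp only: power_Suc mult.assoc mult.left_commute)
  moreover have "c + (2 * CARD('n) + 4 * (Suc j * 2 + k)) > 0" using c(1) by simp
  ultimately show ?case by (intro exI[of _ "c + (2 * CARD('n) + 4 * (Suc j * 2 + k))"] conjI)
qed

text \<open>
  By induction \<open>\<Delta>Q\<close> is a sum of terms \<open>|x|\<^bsup>2j\<^esup> H\<^sub>j\<close>. As \<open>\<Delta>(|x|\<^bsup>2j+2\<^esup> H\<^sub>j)\<close> is a positive multiple of
  \<open>|x|\<^bsup>2j\<^esup> H\<^sub>j\<close>, a combination of the \<open>|x|\<^bsup>2j+2\<^esup> H\<^sub>j\<close> makes \<open>Q\<close> harmonic.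
\<close>

lemma hom_poly_decomposition:
  fixes Q :: "real^'n \<Rightarrow> complex"
  assumes "hom_poly m Q"
  shows "\<exists>H. (\<forall>j. 2 * j \<le> m \<longrightarrow> harm (m - 2 * j) (H j)) \<and> Q = (\<lambda>x. \<Sum>j\<in>{j. 2 * j \<le> m}. sqnorm x ^ j * H j x)"
  using assms
proof (induction m arbitrary: Q rule: less_induct)
  case (less m)
  show ?case
  proof (cases "m < 2")
    case True
    have J: "{j. 2 * j \<le> m} = {0}" using True by auto
    have "harm m Q" using less.prems lap_hp1[OF less.prems True] by (simp add: harm_def)
    then have h: "harm (m - 2 * j) Q" if "2 * j \<le> m" for j using that True by (cases j) simp_all
    have "Q = (\<lambda>x. \<Sum>j\<in>{j. 2 * j \<le> m}. sqnorm x ^ j * Q x)" unfolding J by simp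
    with h show ?thesis by (intro exI[of _ "\<lambda>j. Q"] conjI allI impI)
  next
    case False
    then have "m - 2 < m" by simp
    from less.IH[OF this hom_poly_lap[OF less.prems]] obtain H where
      HH: "(\<forall>j. 2 * j \<le> m - 2 \<longrightarrow> harm (m - 2 - 2 * j) (H j)) \<and>
        lap Q = (\<lambda>x. \<Sum>j\<in>{j. 2 * j \<le> m - 2}. sqnorm x ^ j * H j x)" ..
    then have H: "\<And>j. 2 * j \<le> m - 2 \<Longrightarrow> harm (m - 2 - 2 * j) (H j)" by simp
    from HH have lQ: "lap Q = (\<lambda>x. \<Sum>j\<in>{j. 2 * j \<le> m - 2}. sqnorm x ^ j * H j x)" by (rule conjunct2)
    define J where "J = {j. 2 * j \<le> m - 2}"
    have "\<forall>j\<in>J. \<exists>c::nat. c > 0 \<and> lap (\<lambda>x. sqnorm x ^ Suc j * H j x) = (\<lambda>x. of_nat c * (sqnorm x ^ j * H j x))"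
    proof
      fix j assume "j \<in> J"
      then have "harm (m - 2 - 2 * j) (H j)" by (intro H) (simp add: J_def)
      then show "\<exists>c::nat. c > 0 \<and> lap (\<lambda>x. sqnorm x ^ Suc j * H j x) = (\<lambda>x. of_nat c * (sqnorm x ^ j * H j x))"
        by (rule lap_sqnorm_power_harm)
    qed
    then obtain c :: "nat \<Rightarrow> nat" where c: "\<And>j. j \<in> J \<Longrightarrow> c j > 0"
      "\<And>j. j \<in> J \<Longrightarrow> lap (\<lambda>x. sqnorm x ^ Suc j * H j x) = (\<lambda>x. of_nat (c j) * (sqnorm x ^ j * H j x))"
      by metis
    have hJ: "hom_poly m (\<lambda>x. sqnorm x ^ Suc j * H j x)" if "j \<in> J" for j
    proof -
      have "hom_poly (Suc j * 2 + (m - 2 - 2 * j)) (\<lambda>x. sqnorm x ^ Suc j * H j x)"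
        using that by (intro hom_poly_mult hom_poly_power hom_poly_sqnorm harm_hom_poly H) (auto simp: J_def)
      moreover have "Suc j * 2 + (m - 2 - 2 * j) = m" using that False by (auto simp: J_def)
      ultimately show ?thesis by (simp only:)
    qed
    define S where "S = (\<lambda>x. \<Sum>j\<in>J. - inverse (of_nat (c j)) * (sqnorm x ^ Suc j * H j x))"
    have hS: "hom_poly m S" unfolding S_def by (rule hom_poly_sum, rule hom_poly_cmult, rule hJ)
    have "lap S = (\<lambda>x. \<Sum>j\<in>J. lap (\<lambda>x. - inverse (of_nat (c j)) * (sqnorm x ^ Suc j * H j x)) x)"
      unfolding S_def by (rule lap_sum, rule hom_poly_cmult, rule hJ)
    also have "\<dots> = (\<lambda>x. \<Sum>j\<in>J. - (sqnorm x ^ j * H j x))"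
    proof (intro ext sum.cong refl)
      fix x j assume j: "j \<in> J"
      have "of_nat (c j) \<noteq> (0::complex)" using c(1)[OF j] by simp
      then show "lap (\<lambda>x. - inverse (of_nat (c j)) * (sqnorm x ^ Suc j * H j x)) x = - (sqnorm x ^ j * H j x)"
        unfolding lap_cmult[OF hJ[OF j]] c(2)[OF j] by (simp add: field_simps)
    qed
    finally have lS: "lap S = (\<lambda>x. - lap Q x)" unfolding lQ J_def by (simp add: sum_negf)
    \<comment> \<open>Solving for Q: \<open>G 0\<close> is the harmonic remainder Q + S, and the
      terms of -S give the later components. They carry one power of \<open>sqnorm\<close> more than
      the terms of the Laplacian of Q, hence the shifted index.\<close>
    define G where "G = (\<lambda>j. case j of 0 \<Rightarrow> (\<lambda>x. Q x + S x) | Suc i \<Rightarrow> (\<lambda>x. inverse (of_nat (c i)) * H i x))"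
    have idx: "{j. 2 * j \<le> m} = insert 0 (Suc ` J)"
    proof (intro set_eqI iffI)
      fix j assume "j \<in> {j. 2 * j \<le> m}"
      then show "j \<in> insert 0 (Suc ` J)" by (cases j) (auto simp: J_def)
    qed (use False in \<open>auto simp: J_def\<close>)
    have fJ: "finite J" unfolding J_def by (rule finite_subset[of _ "{..m}"]) auto
    show ?thesis
    proof (intro exI[of _ G] conjI allI impI)
      fix j assume j: "2 * j \<le> m"
      show "harm (m - 2 * j) (G j)"
      proof (cases j)
        case 0
        have "lap (\<lambda>x. Q x + S x) = (\<lambda>x. 0)" unfolding lap_add[OF less.prems hS] lS by simp
        then show ?thesis using 0 hom_poly_add[OF less.prems hS] by (simp add: G_def harm_def)
      next
        case (Suc i)
        then have "harm (m - 2 - 2 * i) (H i)" using j by (intro H) auto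
        moreover have "m - 2 - 2 * i = m - 2 * j" using Suc by simp
        ultimately have H: "hom_poly (m - 2 * j) (H i)" "lap (H i) = (\<lambda>x. 0)" by (simp_all add: harm_def)
        show ?thesis unfolding Suc[symmetric] using hom_poly_cmult[OF H(1)] lap_cmult[OF H(1)] H(2)
          by (simp only: Suc G_def harm_def nat.case mult_zero_right simp_thms)
      qed
    next
      show "Q = (\<lambda>x. \<Sum>j\<in>{j. 2 * j \<le> m}. sqnorm x ^ j * G j x)"
      proof
        fix x
        have "(\<Sum>j\<in>{j. 2 * j \<le> m}. sqnorm x ^ j * G j x) = G 0 x + (\<Sum>i\<in>J. sqnorm x ^ Suc i * G (Suc i) x)"
          unfolding idx using fJ by (subst sum.insert) (auto simp: sum.reindex)
        moreover have G0: "G 0 x = Q x + S x" by (simp add: G_def)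
        moreover have "S x = - (\<Sum>i\<in>J. sqnorm x ^ Suc i * G (Suc i) x)"
          unfolding S_def G_def sum_negf[symmetric] by (intro sum.cong refl) simp
        ultimately show "Q x = (\<Sum>j\<in>{j. 2 * j \<le> m}. sqnorm x ^ j * G j x)"
          by (simp add: G0)
      qed
    qed
  qed
qed

section \<open>Bessel functions\<close>

text \<open>
  The entire function with \<open>J\<^sub>\<mu>(x) = (x/2)\<^sup>\<mu> phi \<mu> (x\<^sup>2/4)\<close>; working with it avoids the singularity of the
  real power at \<open>0\<close>.
\<close>

definition phi :: "real \<Rightarrow> real \<Rightarrow> real" where
  "phi \<mu> z = (\<Sum>m. (-1) ^ m * rGamma (real m + \<mu> + 1) / fact m * z ^ m)"

text \<open>Since \<open>rGamma x = x * rGamma (x + 1)\<close>, the quotient of consecutive terms is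
  at most |z| / (m + 1) as soon as m + \<mu> + 1 \<ge> 1, and N makes it at most 1/2. The functional
  equation also holds at the poles of Gamma, so \<mu> = -1, which occurs for d = 2, is
  covered.\<close>

lemma phi_summable: "summable (\<lambda>m. (-1) ^ m * rGamma (real m + \<mu> + 1) / fact m * z ^ m)"
proof -
  obtain N :: nat where N: "real N \<ge> \<bar>\<mu>\<bar> + 2 * \<bar>z\<bar>" using real_arch_simple by blast
  show ?thesis
  proof (rule summable_ratio_test[of "1/2" N])
    fix m assume m: "N \<le> m"
    then have m': "real m \<ge> \<bar>\<mu>\<bar> + 2 * \<bar>z\<bar>" using N by linarith
    define g where "g = \<bar>rGamma (real m + \<mu> + 2)\<bar>"
    have e: "rGamma (real m + \<mu> + 1) = (real m + \<mu> + 1) * rGamma (real m + \<mu> + 2)"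
      using rGamma_plus1[of "real m + \<mu> + 1"] by (simp add: add.assoc)
    have "1 * g \<le> \<bar>real m + \<mu> + 1\<bar> * g" using m' unfolding g_def by (intro mult_right_mono) auto
    then have 1: "g \<le> \<bar>rGamma (real m + \<mu> + 1)\<bar>" unfolding e abs_mult g_def by simp
    have 2: "\<bar>z\<bar> / real (Suc m) \<le> 1 / 2" using m' by (simp add: field_simps)
    have "norm ((-1) ^ Suc m * rGamma (real (Suc m) + \<mu> + 1) / fact (Suc m) * z ^ Suc m)
       = (\<bar>z\<bar> / real (Suc m)) * (g / fact m * \<bar>z\<bar> ^ m)"
    proof -
      have "real (Suc m) + \<mu> + 1 = real m + \<mu> + 2" by simp
      then show ?thesis by (simp only: g_def) (simp add: abs_mult power_abs del: of_nat_Suc)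
    qed
    also have "\<dots> \<le> (1/2) * (\<bar>rGamma (real m + \<mu> + 1)\<bar> / fact m * \<bar>z\<bar> ^ m)"
      using 1 2 by (intro mult_mono divide_right_mono mult_right_mono) (auto simp: g_def)
    also have "\<dots> = 1/2 * norm ((-1) ^ m * rGamma (real m + \<mu> + 1) / fact m * z ^ m)"
      by (simp add: abs_mult power_abs)
    finally show "norm ((-1) ^ Suc m * rGamma (real (Suc m) + \<mu> + 1) / fact (Suc m) * z ^ Suc m)
      \<le> 1/2 * norm ((-1) ^ m * rGamma (real m + \<mu> + 1) / fact m * z ^ m)" .
  qed simp
qed

lemma phi_sums: "(\<lambda>m. (-1) ^ m * rGamma (real m + \<mu> + 1) / fact m * z ^ m) sums phi \<mu> z"
  unfolding phi_def by (rule summable_sums[OF phi_summable])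

lemma phi_diffs: "diffs (\<lambda>m. (-1) ^ m * rGamma (real m + \<mu> + 1) / fact m)
   = (\<lambda>m. - ((-1) ^ m * rGamma (real m + (\<mu> + 1) + 1) / fact m))"
proof
  fix m
  have "real (Suc m) + \<mu> + 1 = real m + (\<mu> + 1) + 1" by simp
  then show "diffs (\<lambda>m. (-1) ^ m * rGamma (real m + \<mu> + 1) / fact m) m
   = - ((-1) ^ m * rGamma (real m + (\<mu> + 1) + 1) / fact m)"
    unfolding diffs_def by (simp only:) (simp del: of_nat_Suc)
qed

lemma phi_deriv: "(phi \<mu> has_field_derivative - phi (\<mu> + 1) z) (at z)"
proof -
  have "DERIV (\<lambda>z. \<Sum>m. (-1) ^ m * rGamma (real m + \<mu> + 1) / fact m * z ^ m) z :>
      (\<Sum>m. diffs (\<lambda>m. (-1) ^ m * rGamma (real m + \<mu> + 1) / fact m) m * z ^ m)"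
    by (rule termdiffs_strong_converges_everywhere) (rule phi_summable)
  moreover have "(\<Sum>m. diffs (\<lambda>m. (-1) ^ m * rGamma (real m + \<mu> + 1) / fact m) m * z ^ m) = - phi (\<mu> + 1) z"
    unfolding phi_diffs using sums_minus[OF phi_sums[of "\<mu> + 1" z]] by (simp add: sums_iff)
  ultimately show ?thesis by (simp add: phi_def[abs_def])
qed

text \<open>Termwise this is (m + \<mu>) rGamma (m + \<mu> + 1) = rGamma (m + \<mu>): the factor m
  acts as z d/dz, and the derivative of \<open>phi \<mu>\<close> is
  \<open>- phi (\<mu> + 1)\<close>.\<close>

lemma phi_rec: "phi (\<mu> - 1) z = \<mu> * phi \<mu> z - z * phi (\<mu> + 1) z"
proof -
  let ?c = "\<lambda>m. (-1) ^ m * rGamma (real m + \<mu> + 1) / fact m"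
  have "(\<lambda>m. z * (- ((-1) ^ m * rGamma (real m + (\<mu> + 1) + 1) / fact m * z ^ m))) sums (z * - phi (\<mu> + 1) z)"
    by (intro sums_mult sums_minus phi_sums)
  moreover have "z * (- ((-1) ^ m * rGamma (real m + (\<mu> + 1) + 1) / fact m * z ^ m)) = real (Suc m) * (?c (Suc m) * z ^ Suc m)" for m
  proof -
    have "real (Suc m) + \<mu> + 1 = real m + (\<mu> + 1) + 1" by simp
    then show ?thesis by (simp only:) (simp del: of_nat_Suc)
  qed
  ultimately have "(\<lambda>m. real (Suc m) * (?c (Suc m) * z ^ Suc m)) sums (z * - phi (\<mu> + 1) z)" by (simp only:)
  \<comment> \<open>The term with m = 0 carries the factor 0, so the shifted series can be started
    at 0 with the same sum.\<close>
  then have "(\<lambda>m. real m * (?c m * z ^ m)) sums (z * - phi (\<mu> + 1) z)"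
    using sums_Suc_iff[of "\<lambda>m. real m * (?c m * z ^ m)" "z * - phi (\<mu> + 1) z"] by simp
  from sums_add[OF this sums_mult[OF phi_sums, of \<mu> \<mu> z]]
  have "(\<lambda>m. (real m + \<mu>) * (?c m * z ^ m)) sums (\<mu> * phi \<mu> z - z * phi (\<mu> + 1) z)"
    by (simp add: distrib_right add_divide_distrib)
  moreover have "(real m + \<mu>) * (?c m * z ^ m) = (-1) ^ m * rGamma (real m + (\<mu> - 1) + 1) / fact m * z ^ m" for m
  proof -
    have "rGamma (real m + (\<mu> - 1) + 1) = (real m + \<mu>) * rGamma (real m + \<mu> + 1)"
      using rGamma_plus1[of "real m + \<mu>"] by simp
    then show ?thesis by (simp only:) simp
  qed
  ultimately have "(\<lambda>m. (-1) ^ m * rGamma (real m + (\<mu> - 1) + 1) / fact m * z ^ m) sums (\<mu> * phi \<mu> z - z * phi (\<mu> + 1) z)"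
    by (simp only:)
  then show ?thesis by (rule sums_unique2[OF phi_sums])
qed

lemma phi_0: "phi \<mu> 0 = rGamma (\<mu> + 1)"
  unfolding phi_def using powser_zero[of "\<lambda>m. (-1) ^ m * rGamma (real m + \<mu> + 1) / fact m"] by simp

lemma phi_continuous: "continuous_on S (phi \<mu>)"
  by (rule DERIV_continuous_on) (blast intro: phi_deriv has_field_derivative_at_within)

lemma bessel_J_phi:
  assumes x: "x > 0"
  shows "bessel_J a x = (x / 2) powr a * phi a ((x / 2)\<^sup>2)"
proof -
  have e: "(-1) ^ m * rGamma (real m + a + 1) / fact m * (x / 2) powr (2 * real m + a)
     = (x / 2) powr a * ((-1) ^ m * rGamma (real m + a + 1) / fact m * ((x / 2)\<^sup>2) ^ m)" for m
  proof -
    have "(x / 2) powr (2 * real m + a) = (x / 2) powr real (2 * m) * (x / 2) powr a" by (simp add: powr_add)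
    also have "(x / 2) powr real (2 * m) = ((x / 2)\<^sup>2) ^ m" using x by (subst powr_realpow) (auto simp: power_mult)
    finally show ?thesis by simp
  qed
  show ?thesis unfolding bessel_J_def e phi_def by (rule suminf_mult[OF phi_summable])
qed

section \<open>Three-term recurrence and differences of the values Lambda\<close>

lemma bessel_J_rec:
  assumes x: "x > 0"
  shows "bessel_J (a - 1) x + bessel_J (a + 1) x = 2 * a / x * bessel_J a x"
proof -
  let ?z = "(x / 2)\<^sup>2" let ?p = "(x / 2) powr (a - 1)"
  have p: "(x / 2) powr (a + 1) = ?p * ?z" "(x / 2) powr a = ?p * (x / 2)"
    using x powr_add[of "x / 2" "a - 1" 2] powr_add[of "x / 2" "a - 1" 1] by (auto simp: add.commute)
  have "bessel_J (a - 1) x + bessel_J (a + 1) x = ?p * (phi (a - 1) ?z + ?z * phi (a + 1) ?z)"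
    unfolding bessel_J_phi[OF x] p by (simp add: distrib_left)
  also have "\<dots> = ?p * (a * phi a ?z)" by (simp add: phi_rec)
  also have "\<dots> = 2 * a / x * bessel_J a x" unfolding bessel_J_phi[OF x] p using x by simp
  finally show ?thesis .
qed

text \<open>The recurrence expresses the functions of order a - 1 and a + 2 through those of order a
  and a + 1. The squares cancel, and the mixed products remain with coefficients a + 1 and
  -a.\<close>

lemma Lambda_diff:
  assumes x: "\<rho> > 0"
  shows "Lambda k \<nu> \<rho> - Lambda (Suc k) \<nu> \<rho> = bessel_J (\<nu> + real k) \<rho> * bessel_J (\<nu> + real k + 1) \<rho>"
proof -
  define a where "a = \<nu> + real k"
  define J where "J = (\<lambda>a. bessel_J a \<rho>)"
  have s: "\<nu> + real (Suc k) = a + 1" by (simp add: a_def)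
  have 1: "J (a - 1) = 2 * a / \<rho> * J a - J (a + 1)" using bessel_J_rec[OF x, of a] by (simp add: J_def)
  have 2: "J (a + 1 + 1) = 2 * (a + 1) / \<rho> * J (a + 1) - J a" using bessel_J_rec[OF x, of "a + 1"] by (simp add: J_def)
  have "Lambda k \<nu> \<rho> - Lambda (Suc k) \<nu> \<rho> = \<rho>/2 * (J a)\<^sup>2 - \<rho>/2 * J (a - 1) * J (a + 1) - (\<rho>/2 * (J (a + 1))\<^sup>2 - \<rho>/2 * J a * J (a + 1 + 1))"
    unfolding Lambda_def s by (simp add: a_def J_def)
  also have "\<dots> = J a * J (a + 1)" unfolding 1 2 using x by (simp add: field_simps power2_eq_square)
  finally show ?thesis by (simp add: J_def a_def)
qed

lemma Lambda_diff2:
  assumes x: "\<rho> > 0"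
  shows "Lambda k \<nu> \<rho> - Lambda (k + 2) \<nu> \<rho> = 2 * (\<nu> + real k + 1) / \<rho> * (bessel_J (\<nu> + real k + 1) \<rho>)\<^sup>2"
proof -
  have "Lambda k \<nu> \<rho> - Lambda (k + 2) \<nu> \<rho> =
      bessel_J (\<nu> + real k + 1) \<rho> * (bessel_J (\<nu> + real k) \<rho> + bessel_J (\<nu> + real k + 1 + 1) \<rho>)"
    using Lambda_diff[OF x, of k \<nu>] Lambda_diff[OF x, of "Suc k" \<nu>] by (simp add: algebra_simps)
  also have "bessel_J (\<nu> + real k) \<rho> + bessel_J (\<nu> + real k + 1 + 1) \<rho>
     = 2 * (\<nu> + real k + 1) / \<rho> * bessel_J (\<nu> + real k + 1) \<rho>"
    using bessel_J_rec[OF x, of "\<nu> + real k + 1"] by simp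
  finally show ?thesis by (simp add: power2_eq_square)
qed

text \<open>
  \<open>(x/2)\<^bsup>2\<mu>\<^esup> turan \<mu> (x\<^sup>2/4) = J\<^sub>\<mu>(x)\<^sup>2 - J\<^bsub>\<mu>-1\<^esub>(x) J\<^bsub>\<mu>+1\<^esub>(x)\<close>.
\<close>

definition turan :: "real \<Rightarrow> real \<Rightarrow> real" where
  "turan \<mu> z = (phi \<mu> z)\<^sup>2 - phi (\<mu> - 1) z * phi (\<mu> + 1) z"

section \<open>Lommel's integral and positivity of Lambda\<close>

lemma turan_deriv: "(turan \<mu> has_field_derivative (phi (\<mu> - 1) z * phi (\<mu> + 2) z - phi \<mu> z * phi (\<mu> + 1) z)) (at z)"
proof -
  have "(turan \<mu> has_field_derivative (2 * phi \<mu> z * (- phi (\<mu> + 1) z)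
     - (phi (\<mu> - 1) z * (- phi (\<mu> + 1 + 1) z) + (- phi (\<mu> - 1 + 1) z) * phi (\<mu> + 1) z))) (at z)"
    unfolding turan_def[abs_def]
    by (rule derivative_eq_intros phi_deriv refl | simp add: mult.commute)+
  then show ?thesis by (simp add: add.assoc)
qed

text \<open>This says that z^(\<mu> + 1) \<open>turan \<mu> z\<close> has derivative z^\<mu> times
  the square of \<open>phi \<mu> z\<close>: Lommel's integral of x J(x)^2 in the variable z = x^2 /
  4, freed of fractional powers. The recurrence at \<mu> and at \<mu> + 1 removes
  \<open>phi (\<mu> - 1)\<close> and \<open>phi (\<mu> + 2)\<close>.\<close>

lemma turan_ode: "(\<mu> + 1) * turan \<mu> z + z * (phi (\<mu> - 1) z * phi (\<mu> + 2) z - phi \<mu> z * phi (\<mu> + 1) z) = (phi \<mu> z)\<^sup>2"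
proof -
  have a: "phi (\<mu> - 1) z = \<mu> * phi \<mu> z - z * phi (\<mu> + 1) z" by (rule phi_rec)
  have b: "z * phi (\<mu> + 2) z = (\<mu> + 1) * phi (\<mu> + 1) z - phi \<mu> z" using phi_rec[of "\<mu> + 1" z] by (simp add: add.assoc)
  have "(\<mu> + 1) * turan \<mu> z + z * (phi (\<mu> - 1) z * phi (\<mu> + 2) z - phi \<mu> z * phi (\<mu> + 1) z)
    = (\<mu> + 1) * turan \<mu> z + phi (\<mu> - 1) z * (z * phi (\<mu> + 2) z) - z * phi \<mu> z * phi (\<mu> + 1) z"
    by (simp add: algebra_simps)
  also have "\<dots> = (phi \<mu> z)\<^sup>2" unfolding b turan_def a by (simp add: power2_eq_square algebra_simps)
  finally show ?thesis .
qed

text \<open>For r > 0 the derivative is r times the squared Bessel function of order \<mu> at r.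
  With \<mu> = \<nu> + k the exponent N = d + 2 k is a natural number, so nothing is singular at r =
  0 and the fundamental theorem applies on the closed interval.\<close>

lemma radial_antideriv:
  assumes N: "real N = 2 * \<mu> + 2" "N > 0"
  shows "((\<lambda>r. 2 * (r / 2) ^ N * turan \<mu> ((r / 2)\<^sup>2)) has_field_derivative
     2 * (r / 2) ^ (N - 1) * (phi \<mu> ((r / 2)\<^sup>2))\<^sup>2) (at r)"
proof (cases N)
  case 0
  then show ?thesis using N by simp
next
  case (Suc n)
  let ?z = "(r / 2)\<^sup>2"
  let ?D = "phi (\<mu> - 1) ?z * phi (\<mu> + 2) ?z - phi \<mu> ?z * phi (\<mu> + 1) ?z"
  have z: "((\<lambda>r. (r / 2)\<^sup>2) has_field_derivative r / 2) (at r)"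
    by (auto intro!: derivative_eq_intros)
  have t: "((\<lambda>r. turan \<mu> ((r / 2)\<^sup>2)) has_field_derivative ?D * (r / 2)) (at r)"
    by (rule DERIV_chain2[OF turan_deriv z])
  have p: "((\<lambda>r. 2 * (r / 2) ^ N) has_field_derivative real N * (r / 2) ^ n) (at r)"

  proof -
    have "((\<lambda>r. 2 * (r / 2) ^ N) has_field_derivative 2 * (real N * (1 / 2 * (r / 2) ^ n))) (at r)"
      unfolding Suc by (intro DERIV_cmult, rule DERIV_cong[OF DERIV_power_Suc[OF DERIV_cdivide[OF DERIV_ident]]])
        (simp del: of_nat_Suc power_Suc)
    then show ?thesis by simp
  qed
  have "real N * (r / 2) ^ n * turan \<mu> ?z + 2 * (r / 2) ^ N * (?D * (r / 2))
     = 2 * (r / 2) ^ n * ((\<mu> + 1) * turan \<mu> ?z + ?z * ?D)"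
    unfolding N(1) unfolding Suc by (simp add: algebra_simps power2_eq_square)
  also have "\<dots> = 2 * (r / 2) ^ n * (phi \<mu> ?z)\<^sup>2" unfolding turan_ode ..
  finally have e: "real N * (r / 2) ^ n * turan \<mu> ?z + 2 * (r / 2) ^ N * (?D * (r / 2)) = 2 * (r / 2) ^ (N - 1) * (phi \<mu> ?z)\<^sup>2"
    by (simp add: Suc)
  have "((\<lambda>r. 2 * (r / 2) ^ N * turan \<mu> ((r / 2)\<^sup>2)) has_field_derivative
     real N * (r / 2) ^ n * turan \<mu> ?z + ?D * (r / 2) * (2 * (r / 2) ^ N)) (at r)"
    by (rule DERIV_mult[OF p t])
  then show ?thesis using e by (simp add: mult.commute)
qed

lemma Lambda_turan:
  assumes x: "\<rho> > 0" and N: "real N = 2 * (\<nu> + real k) + 2" "N > 0"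
  shows "Lambda k \<nu> \<rho> = (\<rho> / 2) ^ (N - 1) * turan (\<nu> + real k) ((\<rho> / 2)\<^sup>2)"
proof -
  define \<mu> where "\<mu> = \<nu> + real k"
  let ?z = "(\<rho> / 2)\<^sup>2" let ?h = "\<rho> / 2"
  have p: "?h powr (\<mu> - 1) * ?h powr (\<mu> + 1) = ?h powr \<mu> * ?h powr \<mu>"
    unfolding powr_add[symmetric] by (rule arg_cong[of _ _ "(powr) ?h"]) simp
  have "?h ^ (N - 1) = ?h powr (real (N - 1))" using x by (simp add: powr_realpow)
  also have "real (N - 1) = \<mu> + \<mu> + 1" using N by (simp add: \<mu>_def)
  also have "?h powr \<dots> = ?h powr \<mu> * ?h powr \<mu> * ?h" using x unfolding powr_add by simp
  finally have q: "?h ^ (N - 1) = ?h powr \<mu> * ?h powr \<mu> * ?h" .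
  have "Lambda k \<nu> \<rho> = ?h * (?h powr \<mu> * ?h powr \<mu>) * (phi \<mu> ?z)\<^sup>2 - ?h * (?h powr (\<mu> - 1) * ?h powr (\<mu> + 1)) * (phi (\<mu> - 1) ?z * phi (\<mu> + 1) ?z)"
    unfolding Lambda_def \<mu>_def[symmetric] bessel_J_phi[OF x] by (simp only: power2_eq_square mult_ac)
  also have "\<dots> = ?h ^ (N - 1) * turan \<mu> ?z" unfolding p q turan_def by (simp add: algebra_simps)
  finally show ?thesis by (simp add: \<mu>_def)
qed

lemma radial_integral:
  assumes x: "\<rho> > 0" and N: "real N = 2 * (\<nu> + real k) + 2" "N > 0"
  shows "has_bochner_integral lborel (\<lambda>r. indicator {0..\<rho>} r * (2 * (r / 2) ^ (N - 1) * (phi (\<nu> + real k) ((r / 2)\<^sup>2))\<^sup>2)) (\<rho> * Lambda k \<nu> \<rho>)"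
proof -
  let ?f = "\<lambda>r. 2 * (r / 2) ^ (N - 1) * (phi (\<nu> + real k) ((r / 2)\<^sup>2))\<^sup>2"
  let ?F = "\<lambda>r. 2 * (r / 2) ^ N * turan (\<nu> + real k) ((r / 2)\<^sup>2)"
  have "has_bochner_integral lborel (\<lambda>r. ?f r * indicator {0..\<rho>} r) (?F \<rho> - ?F 0)"
  proof (rule has_bochner_integral_FTC_Icc_nonneg[where f = ?f and F = ?F])
    have "continuous_on UNIV ?f"
      by (intro continuous_intros continuous_on_compose2[OF phi_continuous[of UNIV]]) auto
    then show "?f \<in> borel_measurable borel" by (rule borel_measurable_continuous_onI)
    show "\<And>r. r \<in> {0..\<rho>} \<Longrightarrow> DERIV ?F r :> ?f r" by (rule radial_antideriv[OF N])
  qed (use x in auto)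
  moreover have "?F \<rho> - ?F 0 = \<rho> * Lambda k \<nu> \<rho>"
  proof (cases N)
    case (Suc n)
    then show ?thesis using x by (simp add: Lambda_turan[OF x N])
  qed (use N in auto)
  ultimately show ?thesis by (simp add: mult.commute)
qed

text \<open>\<rho> \<open>Lambda k\<close> is the integral of r J(r)^2 over [0, \<rho>],
  nondecreasing in the upper end. If it vanished, \<open>phi\<close> would be zero along the whole
  interval, and continuity at the origin would force \<open>rGamma (\<mu> + 1) = 0\<close>,
  impossible as \<mu> + 1 > 0. Looking at the origin spares any knowledge of the zeros of J.\<close>

lemma Lambda_pos:
  assumes x: "\<rho> > 0" and N: "real N = 2 * (\<nu> + real k) + 2" "N > 0"
  shows "Lambda k \<nu> \<rho> > 0"
proof -
  define \<mu> where "\<mu> = \<nu> + real k"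
  have N': "real N = 2 * \<mu> + 2" using N by (simp add: \<mu>_def)
  let ?F = "\<lambda>r. 2 * (r / 2) ^ N * turan \<mu> ((r / 2)\<^sup>2)"
  have d: "(?F has_field_derivative 2 * (r / 2) ^ (N - 1) * (phi \<mu> ((r / 2)\<^sup>2))\<^sup>2) (at r)" for r
    by (rule radial_antideriv[OF N' N(2)])
  have mono: "?F a \<le> ?F b" if "0 \<le> a" "a \<le> b" for a b
    by (rule DERIV_nonneg_imp_nondecreasing[OF that(2)]) (use d that in \<open>force intro!: mult_nonneg_nonneg\<close>)
  have F0: "?F 0 = 0" using N(2) by simp
  have L: "?F \<rho> = \<rho> * Lambda k \<nu> \<rho>"
    using x N(2) by (cases N) (simp_all add: Lambda_turan[OF x N] \<mu>_def)
  have "?F \<rho> > 0"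
  proof (rule ccontr)
    assume "\<not> ?F \<rho> > 0"
    then have z: "?F r = 0" if "0 \<le> r" "r \<le> \<rho>" for r
      using mono[of 0 r] mono[of r \<rho>] F0 that by linarith
    have p0: "phi \<mu> ((r / 2)\<^sup>2) = 0" if r: "0 < r" "r < \<rho>" for r
    proof -
      have z': "?F s = 0" if "s \<in> {0<..<\<rho>}" for s using that by (intro z) auto
      have "((\<lambda>r. 0) has_field_derivative 2 * (r / 2) ^ (N - 1) * (phi \<mu> ((r / 2)\<^sup>2))\<^sup>2) (at r)"
        by (rule has_field_derivative_transform_within_open[where a = r and S = "{0<..<\<rho>}", OF d]) (use r in simp, use r in simp, rule z')
      then have "2 * (r / 2) ^ (N - 1) * (phi \<mu> ((r / 2)\<^sup>2))\<^sup>2 = 0" using DERIV_const DERIV_unique by blast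
      then show ?thesis using r by simp
    qed
    have "((\<lambda>r. phi \<mu> ((r / 2)\<^sup>2)) \<longlongrightarrow> phi \<mu> ((0 / 2)\<^sup>2)) (at_right 0)"
    proof -
      have "continuous_on UNIV (\<lambda>r. phi \<mu> ((r / 2)\<^sup>2))"
        by (intro continuous_intros continuous_on_compose2[OF phi_continuous[of UNIV]]) auto
      then show ?thesis unfolding continuous_on_def by (blast intro: tendsto_within_subset)
    qed
    moreover have "((\<lambda>r. phi \<mu> ((r / 2)\<^sup>2)) \<longlongrightarrow> 0) (at_right 0)"
      by (rule tendsto_eventually) (use p0 x in \<open>auto simp: eventually_at_right_field\<close>)
    ultimately have "phi \<mu> 0 = 0" using tendsto_unique[of "at_right (0::real)"] by force
    then have "rGamma (\<mu> + 1) = 0" by (simp add: phi_0)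
    moreover have "\<mu> + 1 > 0" using N N' by simp
    ultimately show False by (auto simp: rGamma_eq_zero_iff elim!: nonpos_Ints_cases)
  qed
  then show ?thesis using L x by (simp add: zero_less_mult_iff)
qed

lemma bessel_no_common_zero:
  assumes x: "\<rho> > 0" and N: "real N = 2 * (\<nu> + real k) + 2" "N > 0"
  shows "bessel_J (\<nu> + real k) \<rho> \<noteq> 0 \<or> bessel_J (\<nu> + real k + 1) \<rho> \<noteq> 0"
  using Lambda_pos[OF assms] unfolding Lambda_def by auto

section \<open>Monotonicity in the degree and the sign cases\<close>

lemma Lambda_step2_le:
  assumes "\<rho> > 0" "\<nu> \<ge> 0"
  shows "Lambda (k + 2 * j) \<nu> \<rho> \<le> Lambda k \<nu> \<rho>"
proof (induction j)
  case (Suc j)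
  have "Lambda (k + 2 * j) \<nu> \<rho> - Lambda (k + 2 * j + 2) \<nu> \<rho> \<ge> 0"
    unfolding Lambda_diff2[OF assms(1)] using assms by simp
  then show ?case using Suc by simp
qed simp

text \<open>e and q are the first even and the first odd degree outside K. Within each parity class
  the values do not increase, so the gaps at e and q bound all later ones, and the smaller of the
  two serves as \<delta>.\<close>

lemma Lambda_gap:
  assumes "\<rho> > 0" "\<nu> \<ge> 0" "even e" "odd q" "Lambda e \<nu> \<rho> < C" "Lambda q \<nu> \<rho> < C"
    and K: "K = {k. even k \<and> k < e \<or> odd k \<and> k < q}"
  shows "\<exists>\<delta>>0. \<forall>k. k \<notin> K \<longrightarrow> Lambda k \<nu> \<rho> \<le> C - \<delta>"
proof (intro exI[of _ "min (C - Lambda e \<nu> \<rho>) (C - Lambda q \<nu> \<rho>)"] conjI allI impI)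
  fix k assume k: "k \<notin> K"
  have "\<exists>j. k = e + 2 * j \<or> k = q + 2 * j"
  proof (cases "even k")
    case True
    then have "e \<le> k" "even (k - e)" using k K assms(3) by auto
    then show ?thesis by (metis evenE le_add_diff_inverse)
  next
    case False
    then have "q \<le> k" "even (k - q)" using k K assms(4) by auto
    then show ?thesis by (metis evenE le_add_diff_inverse)
  qed
  then obtain j where "k = e + 2 * j \<or> k = q + 2 * j" ..
  then show "Lambda k \<nu> \<rho> \<le> C - min (C - Lambda e \<nu> \<rho>) (C - Lambda q \<nu> \<rho>)"
    using Lambda_step2_le[OF assms(1,2), of e j] Lambda_step2_le[OF assms(1,2), of q j] by auto
qed (use assms in simp)

text \<open>For the gap two strict inequalities are enough in each case, at the pair (e, q) = (2,
  1), (0, 3), (2, 3) or (4, 3). At degrees 0 and 1 the sign of J0 J1 decides; at degrees 2, 3 and 4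
  strictness amounts to J1, J2 and J3 being nonzero.\<close>

lemma Lambda_cases:
  assumes x: "\<rho> > 0" and nu: "\<nu> = real d / 2 - 1" and d: "d \<ge> 2"
  defines "J0 \<equiv> bessel_J \<nu> \<rho>" and "J1 \<equiv> bessel_J (\<nu> + 1) \<rho>"
  defines "C \<equiv> max (Lambda 0 \<nu> \<rho>) (Lambda 1 \<nu> \<rho>)"
  shows "J0 * J1 \<ge> 0 \<Longrightarrow> C = Lambda 0 \<nu> \<rho>"
    and "J0 * J1 \<le> 0 \<Longrightarrow> C = Lambda 1 \<nu> \<rho>"
    and "J0 * J1 > 0 \<and> K = {0} \<or> J0 * J1 < 0 \<and> K = {1} \<or> J0 = 0 \<and> K = {0, 1} \<or> J1 = 0 \<and> K = {0, 1, 2}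
      \<Longrightarrow> (\<forall>k\<in>K. Lambda k \<nu> \<rho> = C) \<and> (\<exists>\<delta>>0. \<forall>k. k \<notin> K \<longrightarrow> Lambda k \<nu> \<rho> \<le> C - \<delta>)"
proof -
  have nu0: "\<nu> \<ge> 0" using nu d by simp
  let ?L = "\<lambda>k. Lambda k \<nu> \<rho>"
  define J2 where "J2 = bessel_J (\<nu> + 2) \<rho>"
  define J3 where "J3 = bessel_J (\<nu> + 3) \<rho>"
  have D: "?L 0 - ?L 1 = J0 * J1" using Lambda_diff[OF x, of 0 \<nu>] by (simp add: J0_def J1_def)
  have D02: "?L 0 - ?L 2 = 2 * (\<nu> + 1) / \<rho> * J1\<^sup>2"
    using Lambda_diff2[OF x, of 0 \<nu>] by (simp add: J1_def numeral_2_eq_2)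
  have D13: "?L 1 - ?L 3 = 2 * (\<nu> + 2) / \<rho> * J2\<^sup>2"
    using Lambda_diff2[OF x, of 1 \<nu>] by (simp add: J2_def add_ac numeral_3_eq_3)
  have D24: "?L 2 - ?L 4 = 2 * (\<nu> + 3) / \<rho> * J3\<^sup>2"
    using Lambda_diff2[OF x, of 2 \<nu>] by (simp add: J3_def add_ac)
  have R1: "J0 + J2 = 2 * (\<nu> + 1) / \<rho> * J1" using bessel_J_rec[OF x, of "\<nu> + 1"] by (simp add: J0_def J1_def J2_def add_ac)
  have R2: "J1 + J3 = 2 * (\<nu> + 2) / \<rho> * J2" using bessel_J_rec[OF x, of "\<nu> + 2"] by (simp add: J3_def J1_def J2_def add_ac)
  have Z01: "J0 \<noteq> 0 \<or> J1 \<noteq> 0" using bessel_no_common_zero[OF x, of d \<nu> 0] nu d by (simp add: J0_def J1_def)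
  have Z12: "J1 \<noteq> 0 \<or> J2 \<noteq> 0" using bessel_no_common_zero[OF x, of "d + 2" \<nu> 1] nu d by (simp add: J2_def J1_def add_ac)
  show 1: "J0 * J1 \<ge> 0 \<Longrightarrow> C = ?L 0" and 2: "J0 * J1 \<le> 0 \<Longrightarrow> C = ?L 1" using D by (auto simp: C_def)
  have gap: "?L e < C \<Longrightarrow> ?L q < C \<Longrightarrow> even e \<Longrightarrow> odd q \<Longrightarrow> K = {k. even k \<and> k < e \<or> odd k \<and> k < q} \<Longrightarrow>
     (\<exists>\<delta>>0. \<forall>k. k \<notin> K \<longrightarrow> ?L k \<le> C - \<delta>)" for e q
    using Lambda_gap[OF x nu0] by blast
  have p: "2 * (\<nu> + 1) / \<rho> > 0" "2 * (\<nu> + 2) / \<rho> > 0" "2 * (\<nu> + 3) / \<rho> > 0" using nu0 x by simp_all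
  have L02: "?L 2 < ?L 0 \<longleftrightarrow> J1 \<noteq> 0" "?L 2 = ?L 0 \<longleftrightarrow> J1 = 0"
    and L13: "?L 3 < ?L 1 \<longleftrightarrow> J2 \<noteq> 0" and L24: "?L 4 < ?L 2 \<longleftrightarrow> J3 \<noteq> 0"
    using D02 D13 D24 mult_pos_pos[OF p(1), of "J1\<^sup>2"] mult_pos_pos[OF p(2), of "J2\<^sup>2"] mult_pos_pos[OF p(3), of "J3\<^sup>2"]
    by (cases "J1 = 0"; cases "J2 = 0"; cases "J3 = 0"; auto)+
  assume "J0 * J1 > 0 \<and> K = {0} \<or> J0 * J1 < 0 \<and> K = {1} \<or> J0 = 0 \<and> K = {0, 1} \<or> J1 = 0 \<and> K = {0, 1, 2}"
  then consider (a) "J0 * J1 > 0" "K = {0}" | (b) "J0 * J1 < 0" "K = {1}" | (c) "J0 = 0" "K = {0, 1}" | (d) "J1 = 0" "K = {0, 1, 2}" by blast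
  then show "(\<forall>k\<in>K. ?L k = C) \<and> (\<exists>\<delta>>0. \<forall>k. k \<notin> K \<longrightarrow> ?L k \<le> C - \<delta>)"
  proof cases
    case a
    have "C = ?L 0" using 1 a by simp
    moreover have "J1 \<noteq> 0" using a by auto
    ultimately have "?L 2 < C" "?L 1 < C" "\<forall>k\<in>K. ?L k = C" using L02 D a by auto
    moreover have "K = {k. even k \<and> k < 2 \<or> odd k \<and> k < 1}" unfolding a by (auto simp: less_2_cases_iff)
    ultimately show ?thesis using gap[of 2 1] by (intro conjI) simp_all
  next
    case b
    have "C = ?L 1" using 2 b by simp
    \<comment> \<open>If J2 were 0, the recurrence would make J0 a positive multiple of J1, against
      J0 J1 < 0.\<close>
    moreover have "J2 \<noteq> 0"
    proof
      assume "J2 = 0"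
      then have "J0 * J1 = 2 * (\<nu> + 1) / \<rho> * (J1 * J1)" using R1 by simp
      then show False using b p(1) by (smt (verit) mult_nonneg_nonneg zero_le_square)
    qed
    ultimately have "?L 0 < C" "?L 3 < C" "\<forall>k\<in>K. ?L k = C" using L13 D b by auto
    moreover have "K = {k. even k \<and> k < 0 \<or> odd k \<and> k < 3}" unfolding b by (auto simp: less_Suc_eq numeral_3_eq_3)
    ultimately show ?thesis using gap[of 0 3] by (intro conjI) simp_all
  next
    case c
    have "C = ?L 0" "C = ?L 1" using 1 2 c by simp_all
    \<comment> \<open>J0 = 0 turns the recurrence into J2 = positive multiple of J1, and J1 has no
      common zero with J0.\<close>
    moreover have "J1 \<noteq> 0" "J2 \<noteq> 0" using Z01 c R1 p(1) by auto
    ultimately have "?L 2 < C" "?L 3 < C" "\<forall>k\<in>K. ?L k = C" using L13 L02 c by auto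
    moreover have "K = {k. even k \<and> k < 2 \<or> odd k \<and> k < 3}" unfolding c by (auto simp: less_Suc_eq numeral_3_eq_3 less_2_cases_iff)
    ultimately show ?thesis using gap[of 2 3] by (intro conjI) simp_all
  next
    case d
    have "C = ?L 0" "C = ?L 1" using 1 2 d by simp_all
    \<comment> \<open>Degree 2 now ties with degree 0, so degree 4 has to be separated: J1 = 0 makes
      J3 a positive multiple of J2, and J2 cannot vanish together with J1.\<close>
    moreover have "J3 \<noteq> 0" "J2 \<noteq> 0" using Z12 d R2 p(2) by auto
    ultimately have "?L 4 < C" "?L 3 < C" "\<forall>k\<in>K. ?L k = C" using L13 L24 L02 d by auto
    moreover have "K = {k. even k \<and> k < 4 \<or> odd k \<and> k < 3}"
    proof -
      have "k \<in> {0, 1, 2} \<longleftrightarrow> even k \<and> k < 4 \<or> odd k \<and> k < 3" for k :: nat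
      proof -
        consider "k = 0" | "k = 1" | "k = 2" | "k = 3" | "k > 3" by linarith
        then show ?thesis by cases auto
      qed
      then show ?thesis unfolding d(2) by (intro set_eqI) (simp only: mem_Collect_eq)
    qed
    ultimately show ?thesis using gap[of 4 3] by (intro conjI) simp_all
  qed
qed

section \<open>Polar coordinates\<close>

lemma space_sphere_measure [simp]: "space sphere_measure = sphere 0 1"
  unfolding sphere_measure_def space_scale_measure space_distr by (simp add: space_restrict_space)

lemma sets_sphere_measure [simp, measurable_cong]:
  "sets (sphere_measure :: (real^'n) measure) = sets (restrict_space borel (sphere 0 1))"
  by (simp add: sphere_measure_def)

lemma emeasure_distr_restrict:
  assumes "f \<in> restrict_space M R \<rightarrow>\<^sub>M N" "R \<in> sets M" "X \<in> sets N" "space M = UNIV"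
  shows "emeasure (distr (restrict_space M R) N f) X = emeasure M (f -` X \<inter> R)"
proof -
  have "emeasure (distr (restrict_space M R) N f) X = emeasure (restrict_space M R) (f -` X \<inter> R)"
    using assms by (subst emeasure_distr) (simp_all add: space_restrict_space)
  also have "\<dots> = emeasure M (f -` X \<inter> R)"
    using assms(2,4) by (intro emeasure_restrict_space) simp_all
  finally show ?thesis .
qed

lemma normalize_measurable:
  "(\<lambda>x::real^'n. x /\<^sub>R norm x) \<in> restrict_space lborel (- {0}) \<rightarrow>\<^sub>M restrict_space borel (sphere 0 1)"
  by (rule measurable_restrict_space3) (auto intro!: borel_measurable_continuous_on_indicator simp: measurable_restrict_space1)

text \<open>The truncated cone over B without its apex. The radius 1 belongs to the definition of
  the sphere measure; variable radii serve to compare measures on rays.\<close>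

definition rcone :: "real \<Rightarrow> (real^'n) set \<Rightarrow> (real^'n) set" where
  "rcone r B = {x. 0 < norm x \<and> norm x < r \<and> x /\<^sub>R norm x \<in> B}"

lemma rcone_measurable:
  fixes B :: "(real^'n) set"
  assumes "B \<in> sets borel" shows "rcone r B \<in> sets borel"
proof -
  have [measurable]: "B \<in> sets borel" by fact
  show ?thesis unfolding rcone_def by measurable
qed

text \<open>The translation by 0 gives the set the shape of an affine image, as the scaling rule for
  Lebesgue measure expects.\<close>

lemma rcone_scale:
  assumes r: "r > 0" shows "rcone r B = (\<lambda>x. r *\<^sub>R x + 0) ` rcone 1 B"
proof (intro set_eqI iffI)
  fix x assume "x \<in> rcone r B"
  then have "x /\<^sub>R r \<in> rcone 1 B" using r by (auto simp: rcone_def field_simps)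
  then show "x \<in> (\<lambda>x. r *\<^sub>R x + 0) ` rcone 1 B" using r by (intro image_eqI[of _ _ "x /\<^sub>R r"]) auto
next
  fix x assume "x \<in> (\<lambda>x. r *\<^sub>R x + 0) ` rcone 1 B"
  then obtain y where y: "y \<in> rcone 1 B" "x = r *\<^sub>R y" by auto
  then have "x /\<^sub>R norm x = y /\<^sub>R norm y" using r by simp
  then show "x \<in> rcone r B" using y r by (simp add: rcone_def del: scaleR_scaleR inverse_eq_divide)
qed

lemma emeasure_rcone:
  fixes B :: "(real^'n) set"
  assumes B: "B \<in> sets borel" and r: "r > 0"
  shows "emeasure lborel (rcone r B) = ennreal (r ^ CARD('n)) * emeasure lborel (rcone 1 B)"
proof -
  have "emeasure lebesgue (rcone r B) = ennreal (r ^ CARD('n)) * emeasure lebesgue (rcone 1 B)"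
    using emeasure_lebesgue_affine[of r 0 "rcone 1 B"] r unfolding rcone_scale[OF r] by simp
  then show ?thesis using rcone_measurable[OF B] by simp
qed

lemma sphere_sets_iff: "B \<in> sets (sphere_measure :: (real^'n) measure) \<longleftrightarrow> B \<in> sets borel \<and> B \<subseteq> sphere 0 1"
  by (auto simp: sets_restrict_space_iff)

lemma emeasure_sphere_measure:
  fixes B :: "(real^'n) set"
  assumes B: "B \<in> sets sphere_measure"
  shows "emeasure sphere_measure B = of_nat CARD('n) * emeasure lborel (rcone 1 B)"
proof -
  have m: "(\<lambda>x::real^'n. x /\<^sub>R norm x) \<in> restrict_space lborel (ball 0 1 - {0}) \<rightarrow>\<^sub>M restrict_space borel (sphere 0 1)"
    by (rule measurable_restrict_space3) auto
  have v: "(\<lambda>x. x /\<^sub>R norm x) -` B \<inter> (ball 0 1 - {0}) = rcone 1 B"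
    by (auto simp: rcone_def)
  have "emeasure (distr (restrict_space lborel (ball 0 1 - {0})) (restrict_space borel (sphere 0 1)) (\<lambda>x. x /\<^sub>R norm x)) B
     = emeasure lborel (rcone 1 B)"
    using B by (subst emeasure_distr_restrict[OF m]) (simp_all add: v)
  then show ?thesis unfolding sphere_measure_def by (simp only: emeasure_scale_measure)
qed

lemma rcone_1_subset: "rcone 1 B \<subseteq> ball 0 1" by (auto simp: rcone_def)

lemma finite_sphere_measure: "finite_measure (sphere_measure :: (real^'n) measure)"
proof
  have "emeasure lborel (rcone 1 (sphere (0::real^'n) 1)) \<le> emeasure lborel (ball (0::real^'n) 1)"
    by (rule emeasure_mono[OF rcone_1_subset]) simp
  also have "\<dots> < \<infinity>" by (rule emeasure_lborel_ball_finite)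
  finally have "emeasure lborel (rcone 1 (sphere (0::real^'n) 1)) < top" by simp
  then show "emeasure sphere_measure (space (sphere_measure :: (real^'n) measure)) \<noteq> \<infinity>"
    by (subst emeasure_sphere_measure, simp only: sphere_sets_iff space_sphere_measure)
      (auto simp: ennreal_mult_eq_top_iff of_nat_less_top less_top[symmetric])
qed

interpretation sphere: finite_measure "sphere_measure :: (real^'n) measure"
  by (rule finite_sphere_measure)

lemma measure_sphere_space:
  "measure sphere_measure (sphere (0::real^'n) 1) = real CARD('n) * unit_ball_vol (real CARD('n))"
proof -
  have "rcone 1 (sphere (0::real^'n) 1) = ball 0 1 - {0}" by (auto simp: rcone_def)
  then have "emeasure lborel (rcone 1 (sphere (0::real^'n) 1)) = emeasure lborel (ball (0::real^'n) 1)"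
    by (simp only:) (rule emeasure_Diff_null_set, simp_all add: null_sets_def)
  also have "\<dots> = ennreal (unit_ball_vol (real CARD('n)))" by (simp add: emeasure_ball)
  finally have "emeasure sphere_measure (sphere (0::real^'n) 1) = ennreal (real CARD('n) * unit_ball_vol (real CARD('n)))"
    by (subst emeasure_sphere_measure, simp only: sphere_sets_iff)
      (auto simp: ennreal_mult ennreal_of_nat_eq_real_of_nat)
  then show ?thesis by (simp add: measure_def)
qed

section \<open>Lebesgue measure as a product in polar coordinates\<close>

definition radial :: "nat \<Rightarrow> real measure" where
  "radial d = density lborel (\<lambda>r. ennreal (r ^ (d - 1)) * indicator {0..} r)"

lemma sets_radial [simp, measurable_cong]: "sets (radial d) = sets borel"
  and space_radial [simp]: "space (radial d) = UNIV"
  by (simp_all add: radial_def)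

lemma emeasure_radial_lessThan:
  assumes d: "d > 0"
  shows "emeasure (radial d) {..<a} = (if a > 0 then ennreal (a ^ d / real d) else 0)"
proof -
  have m: "(\<lambda>r::real. ennreal (r ^ (d - 1)) * indicator {0..} r) \<in> borel_measurable lborel" by measurable
  have "emeasure (radial d) {..<a} = (\<integral>\<^sup>+r. ennreal (r ^ (d - 1)) * indicator {0..} r * indicator {..<a} r \<partial>lborel)"
    unfolding radial_def by (rule emeasure_density[OF m]) simp
  also have "\<dots> = (if a > 0 then ennreal (a ^ d / real d) else 0)"
  proof (cases "a > 0")
    case True
    have "(\<integral>\<^sup>+r. ennreal (r ^ (d - 1)) * indicator {0..} r * indicator {..<a} r \<partial>lborel)
       = (\<integral>\<^sup>+r. ennreal (r ^ (d - 1)) * indicator {0..a} r \<partial>lborel)"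
      by (rule nn_integral_cong_AE, use AE_lborel_singleton[of a] in eventually_elim) (auto simp: indicator_def)
    also have "\<dots> = ennreal (a ^ d / real d - 0 ^ d / real d)"
    proof (rule nn_integral_FTC_Icc)
      fix x :: real
      show "((\<lambda>x. x ^ d / real d) has_field_derivative x ^ (d - 1)) (at x)"
        using d by (auto intro!: derivative_eq_intros)
    qed (use True in auto)
    finally show ?thesis using True d by (simp add: zero_power)
  next
    case False
    then have "(\<integral>\<^sup>+r. ennreal (r ^ (d - 1)) * indicator {0..} r * indicator {..<a} r \<partial>lborel) = (\<integral>\<^sup>+r. 0 \<partial>(lborel :: real measure))"
      by (intro nn_integral_cong) (auto simp: indicator_def)
    then show ?thesis using False by simp
  qed
  finally show ?thesis .
qed

lemma sigma_finite_radial: assumes "d > 0" shows "sigma_finite_measure (radial d)"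
proof
  show "\<exists>A. countable A \<and> A \<subseteq> sets (radial d) \<and> (\<Union>A) = space (radial d) \<and> (\<forall>a\<in>A. emeasure (radial d) a \<noteq> \<infinity>)"
    by (intro exI[of _ "range (\<lambda>n::nat. {..<real n})"])
       (auto simp: emeasure_radial_lessThan[OF assms] intro: reals_Archimedean2)
qed

text \<open>With B fixed both sides are measures in A. On the ray below a > 0 they agree: the cone
  of radius a has a^d times the volume of the unit cone, the radial measure of the ray is a^d / d,
  and the sphere measure of B is d times the volume of the unit cone. Such rays generate the Borel
  sets and are closed under intersection.\<close>

lemma polar_product_set:
  fixes B :: "(real^'n) set"
  assumes A: "A \<in> sets borel" and B: "B \<in> sets sphere_measure"
  shows "emeasure (radial CARD('n)) A * emeasure sphere_measure B
    = emeasure lborel {x. x \<noteq> 0 \<and> norm x \<in> A \<and> x /\<^sub>R norm x \<in> B}"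
proof -
  have B': "B \<in> sets borel" using B sphere_sets_iff by blast
  then have [measurable]: "B \<in> sets borel" .
  define R where "R = {x::real^'n. x \<noteq> 0 \<and> x /\<^sub>R norm x \<in> B}"
  have [measurable]: "R \<in> sets borel" unfolding R_def by measurable
  define N1 where "N1 = distr (restrict_space lborel R) borel norm"
  define N2 where "N2 = scale_measure (emeasure sphere_measure B) (radial CARD('n))"
  have mN: "norm \<in> restrict_space lborel R \<rightarrow>\<^sub>M borel" by (simp add: measurable_restrict_space1)
  have e1: "emeasure N1 X = emeasure lborel {x. x \<noteq> 0 \<and> norm x \<in> X \<and> x /\<^sub>R norm x \<in> B}" if "X \<in> sets borel" for X
  proof -
    have "norm -` X \<inter> R = {x. x \<noteq> 0 \<and> norm x \<in> X \<and> x /\<^sub>R norm x \<in> B}" by (auto simp: R_def)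
    moreover have "emeasure N1 X = emeasure lborel (norm -` X \<inter> R)"
      unfolding N1_def using that by (intro emeasure_distr_restrict[OF mN]) simp_all
    ultimately show ?thesis by simp
  qed
  have c: "{x. x \<noteq> 0 \<and> norm x \<in> {..<a} \<and> x /\<^sub>R norm x \<in> B} = rcone a B" for a by (auto simp: rcone_def)
  have eq: "emeasure N1 {..<a} = emeasure N2 {..<a}" for a :: real
  proof (cases "a > 0")
    case True
    have "emeasure N2 {..<a} = of_nat CARD('n) * emeasure lborel (rcone 1 B) * ennreal (a ^ CARD('n) / real CARD('n))"
      using True by (simp add: N2_def emeasure_radial_lessThan emeasure_sphere_measure[OF B])
    also have "\<dots> = (ennreal (real CARD('n)) * ennreal (a ^ CARD('n) / real CARD('n))) * emeasure lborel (rcone 1 B)"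
      by (simp add: ennreal_of_nat_eq_real_of_nat mult_ac)
    also have "ennreal (real CARD('n)) * ennreal (a ^ CARD('n) / real CARD('n)) = ennreal (a ^ CARD('n))"
      using True by (simp add: ennreal_mult[symmetric])
    also have "\<dots> * emeasure lborel (rcone 1 B) = emeasure N1 {..<a}"
      by (simp add: e1 c emeasure_rcone[OF B' True] del: lessThan_iff)
    finally show ?thesis ..
  next
    case False
    then have "rcone a B = {}" by (auto simp: rcone_def dest: le_less_trans[OF norm_ge_zero])
    then show ?thesis using False by (simp add: e1 c N2_def emeasure_radial_lessThan del: lessThan_iff)
  qed
  have "N1 = N2"
  proof (rule measure_eqI_generator_eq[where E = "range lessThan" and \<Omega> = UNIV and A = "\<lambda>n. {..<real n}"])
    show "Int_stable (range (lessThan :: real \<Rightarrow> _))"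
    proof (rule Int_stableI)
      fix X Y :: "real set" assume "X \<in> range lessThan" "Y \<in> range lessThan"
      then obtain a b where "X = {..<a}" "Y = {..<b}" by blast
      then have "X \<inter> Y = {..<min a b}" by auto
      then show "X \<inter> Y \<in> range lessThan" by simp
    qed
    show "sets N1 = sigma_sets UNIV (range lessThan)" "sets N2 = sigma_sets UNIV (range lessThan)"
      by (simp_all add: N1_def N2_def borel_Iio)
    show "emeasure N1 {..<real n} \<noteq> \<infinity>" for n :: nat
    proof -
      have "emeasure lborel (rcone (real n) B) \<le> emeasure lborel (ball (0::real^'n) (real n))"
        by (rule emeasure_mono) (auto simp: rcone_def)
      also have "\<dots> < \<infinity>" by (rule emeasure_lborel_ball_finite)
      finally show ?thesis by (simp add: e1 c del: lessThan_iff)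
    qed
    show "(\<Union>n. {..<real n}) = UNIV" by (auto intro: reals_Archimedean2)
  qed (auto simp: eq)
  then have "emeasure N1 A = emeasure N2 A" by simp
  then show ?thesis using A by (simp add: e1 N2_def mult.commute)
qed

text \<open>Rectangles determine a product of sigma-finite measures. The origin is removed because
  its normalization is 0, which does not lie on the sphere.\<close>

lemma polar_measure:
  "radial CARD('n) \<Otimes>\<^sub>M (sphere_measure :: (real^'n) measure)
   = distr (restrict_space lborel (- {0})) (borel \<Otimes>\<^sub>M restrict_space borel (sphere 0 1)) (\<lambda>x. (norm x, x /\<^sub>R norm x))"
proof (rule pair_measure_eqI)
  have m: "(\<lambda>x::real^'n. (norm x, x /\<^sub>R norm x)) \<in> restrict_space lborel (- {0}) \<rightarrow>\<^sub>M (borel \<Otimes>\<^sub>M restrict_space borel (sphere 0 1))"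
    by (intro measurable_Pair normalize_measurable) (simp add: measurable_restrict_space1)
  show "sigma_finite_measure (radial CARD('n))" by (rule sigma_finite_radial) simp
  show "sigma_finite_measure (sphere_measure :: (real^'n) measure)" by unfold_locales
  show "sets (radial CARD('n) \<Otimes>\<^sub>M (sphere_measure :: (real^'n) measure)) =
     sets (distr (restrict_space lborel (- {0})) (borel \<Otimes>\<^sub>M restrict_space borel (sphere 0 1)) (\<lambda>x::real^'n. (norm x, x /\<^sub>R norm x)))"
    by (simp cong: sets_pair_measure_cong)
  fix A and B :: "(real^'n) set" assume A: "A \<in> sets (radial CARD('n))" and B: "B \<in> sets sphere_measure"
  have AB: "A \<times> B \<in> sets (borel \<Otimes>\<^sub>M restrict_space borel (sphere 0 1))" using A B by auto
  have "(\<lambda>x. (norm x, x /\<^sub>R norm x)) -` (A \<times> B) \<inter> - {0} = {x. x \<noteq> 0 \<and> norm x \<in> A \<and> x /\<^sub>R norm x \<in> B}" by auto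
  then have "emeasure (distr (restrict_space lborel (- {0})) (borel \<Otimes>\<^sub>M restrict_space borel (sphere 0 1)) (\<lambda>x. (norm x, x /\<^sub>R norm x))) (A \<times> B)
    = emeasure lborel {x. x \<noteq> 0 \<and> norm x \<in> A \<and> x /\<^sub>R norm x \<in> B}"
    by (subst emeasure_distr_restrict[OF m _ AB]) simp_all
  then show "emeasure (radial CARD('n)) A * emeasure sphere_measure B =
     emeasure (distr (restrict_space lborel (- {0})) (borel \<Otimes>\<^sub>M restrict_space borel (sphere 0 1)) (\<lambda>x. (norm x, x /\<^sub>R norm x))) (A \<times> B)"
    using polar_product_set[of A B] A B by simp
qed

text \<open>Multiplying radius and direction undoes the polar map, and only the origin is lost, a
  null set. With \<open>lborel\<close> as the image measure, integrals pull back to the product,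
  where Fubini applies.\<close>

lemma polar_distr:
  "distr (radial CARD('n) \<Otimes>\<^sub>M (sphere_measure :: (real^'n) measure)) borel (\<lambda>(r, w). r *\<^sub>R w) = lborel"
proof -
  have m: "(\<lambda>x::real^'n. (norm x, x /\<^sub>R norm x)) \<in> restrict_space lborel (- {0}) \<rightarrow>\<^sub>M (borel \<Otimes>\<^sub>M restrict_space borel (sphere 0 1))"
    by (intro measurable_Pair normalize_measurable) (simp add: measurable_restrict_space1)
  have m2: "(\<lambda>(r, w::real^'n). r *\<^sub>R w) \<in> (borel \<Otimes>\<^sub>M restrict_space borel (sphere 0 1)) \<rightarrow>\<^sub>M borel"
    unfolding case_prod_beta'
    by (intro borel_measurable_scaleR measurable_fst) (rule measurable_compose[OF measurable_snd], simp add: measurable_restrict_space1)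
  show ?thesis
  proof (rule measure_eqI)
    fix X assume "X \<in> sets (distr (radial CARD('n) \<Otimes>\<^sub>M (sphere_measure :: (real^'n) measure)) borel (\<lambda>(r, w). r *\<^sub>R w))"
    then have X: "X \<in> sets borel" by simp
    have "emeasure (distr (radial CARD('n) \<Otimes>\<^sub>M sphere_measure) borel (\<lambda>(r, w). r *\<^sub>R w)) X
      = emeasure (distr (restrict_space lborel (- {0})) borel (\<lambda>x. x)) X"
      unfolding polar_measure by (subst distr_distr[OF m2 m]) (intro arg_cong2[of _ _ _ _ emeasure] distr_cong refl, auto simp: space_restrict_space)
    also have "\<dots> = emeasure lborel (X - {0})"
      using X by (subst emeasure_distr_restrict) (simp_all add: measurable_restrict_space1 Diff_eq)
    also have "\<dots> = emeasure lborel X" using X by (intro emeasure_Diff_null_set) (simp_all add: null_sets_def)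
    finally show "emeasure (distr (radial CARD('n) \<Otimes>\<^sub>M sphere_measure) borel (\<lambda>(r, w). r *\<^sub>R w)) X = emeasure lborel X" .
  qed simp
qed

lemma polar_integral:
  fixes F :: "real^'n \<Rightarrow> 'b::{banach, second_countable_topology}"
  assumes F: "integrable lborel F"
  shows "(\<integral>x. F x \<partial>lborel) = (\<integral>r. (\<integral>w. F (r *\<^sub>R w) \<partial>sphere_measure) \<partial>radial CARD('n))"
proof -
  interpret R: sigma_finite_measure "radial CARD('n)" by (rule sigma_finite_radial) simp
  interpret P: pair_sigma_finite "radial CARD('n)" "sphere_measure :: (real^'n) measure" ..
  have m2: "(\<lambda>(r, w::real^'n). r *\<^sub>R w) \<in> (radial CARD('n) \<Otimes>\<^sub>M sphere_measure) \<rightarrow>\<^sub>M borel"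
    unfolding case_prod_beta'
    by (intro borel_measurable_scaleR) (rule measurable_compose[OF measurable_fst], simp,
        rule measurable_compose[OF measurable_snd], simp add: measurable_restrict_space1 cong: measurable_cong_sets)
  have Fb: "F \<in> borel_measurable borel" using F by auto
  let ?G = "\<lambda>(r, w). F (r *\<^sub>R w)"
  have G: "?G = (\<lambda>p. F ((\<lambda>(r, w). r *\<^sub>R w) p))" by auto
  have "integrable (radial CARD('n) \<Otimes>\<^sub>M sphere_measure) ?G"
    unfolding G using F by (subst integrable_distr_eq[OF m2 Fb, symmetric]) (simp add: polar_distr)
  from P.integral_fst'[OF this] have "(\<integral>r. (\<integral>w. F (r *\<^sub>R w) \<partial>sphere_measure) \<partial>radial CARD('n))
     = integral\<^sup>L (radial CARD('n) \<Otimes>\<^sub>M sphere_measure) ?G" by simp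
  also have "\<dots> = integral\<^sup>L lborel F"
    unfolding G by (subst integral_distr[OF m2 Fb, symmetric]) (simp add: polar_distr)
  finally show ?thesis ..
qed

section \<open>Gaussian integrals of polynomials\<close>

definition gauss :: "real^'n \<Rightarrow> real" where "gauss x = exp (- (norm x)\<^sup>2 / 2)"

definition gmoment :: "nat \<Rightarrow> real" where "gmoment a = (\<integral>t. t ^ a * exp (- t\<^sup>2 / 2) \<partial>lborel)"

lemma gauss_std: "t ^ a * exp (- t\<^sup>2 / 2) = sqrt (2 * pi) * (std_normal_density t * t ^ a)"
  by (simp add: std_normal_density_def)

lemma gmoment_integrable: "integrable lborel (\<lambda>t. t ^ a * exp (- t\<^sup>2 / 2 :: real))"
  unfolding gauss_std by (intro integrable_mult_right integrable_std_normal_moment)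

lemma gmoment_even: "gmoment (2 * k) = sqrt (2 * pi) * (fact (2 * k) / (2 ^ k * fact k))"
  unfolding gmoment_def gauss_std by (simp add: integral_std_normal_moment_even)

lemma gmoment_odd: "gmoment (2 * k + 1) = 0"
  unfolding gmoment_def gauss_std using integral_std_normal_moment_odd[of k] by simp

text \<open>Integration by parts in one variable, read off from the closed forms of the moments. At
  a = 0 the truncated index \<open>a - 1\<close> is multiplied by 0.\<close>

lemma gmoment_Suc: "gmoment (Suc a) = real a * gmoment (a - 1)"
proof (cases "even a")
  case True
  then obtain k where k: "a = 2 * k" by blast
  show ?thesis
  proof (cases k)
    case 0
    then show ?thesis using k gmoment_odd[of 0] by simp
  next
    case (Suc j)
    then show ?thesis using k gmoment_odd[of k] gmoment_odd[of j] by simp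
  qed
next
  case False
  then obtain k where k: "a = 2 * k + 1" using oddE by blast
  have "gmoment (Suc a) = gmoment (2 * Suc k)" by (simp add: k)
  also have "\<dots> = sqrt (2 * pi) * (fact (2 * Suc k) / (2 ^ Suc k * fact (Suc k)))" by (rule gmoment_even)
  also have "fact (2 * Suc k) / (2 ^ Suc k * fact (Suc k)) = real a * (fact (2 * k) / (2 ^ k * fact k))"
  proof -
    have 1: "(fact (2 * Suc k) :: real) = (2 * real (Suc k)) * (real a * fact (2 * k))" by (simp add: k)
    have 2: "(2 ^ Suc k * fact (Suc k) :: real) = (2 * real (Suc k)) * (2 ^ k * fact k)" by simp
    have "2 * real (Suc k) \<noteq> 0" by simp
    then show ?thesis unfolding 1 2 by (subst mult_divide_mult_cancel_left) simp_all
  qed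
  also have "sqrt (2 * pi) * \<dots> = real a * gmoment (2 * k)" by (simp add: gmoment_even)
  finally show ?thesis by (simp add: k)
qed

section \<open>Gaussian integrals in several variables\<close>

lemma prod_Basis_axis:
  fixes f :: "(real^'n) \<Rightarrow> 'b::comm_monoid_mult"
  shows "(\<Prod>b\<in>Basis. f b) = (\<Prod>i\<in>(UNIV::'n set). f (axis i 1))"
proof -
  have "Basis = range (\<lambda>i::'n. axis i (1::real))" by (auto simp: Basis_vec_def)
  moreover have "inj (\<lambda>i::'n. axis i (1::real))" by (auto simp: inj_def axis_eq_axis)
  ultimately have "(\<Prod>b\<in>Basis. f b) = (\<Prod>b\<in>range (\<lambda>i::'n. axis i (1::real)). f b)" "inj (\<lambda>i::'n. axis i (1::real))" by simp_all
  then show ?thesis by (simp add: prod.reindex)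
qed

lemma gauss_prod: "gauss x = (\<Prod>i\<in>UNIV. exp (- (x $ i)\<^sup>2 / 2))"
proof -
  have "(norm x)\<^sup>2 = (\<Sum>i\<in>UNIV. (x $ i)\<^sup>2)" by (simp add: norm_vec_def L2_set_def sum_nonneg)
  then show ?thesis unfolding gauss_def by (simp add: exp_sum[symmetric] sum_negf sum_divide_distrib)
qed

text \<open>The Gaussian and every monomial factor over the coordinates, and \<open>lborel\<close>
  is the image of a product measure over \<open>Basis\<close>, so both claims reduce to one
  variable.\<close>

lemma
  fixes \<alpha> :: "'n::finite \<Rightarrow> nat"
  shows monomial_gauss_integrable: "integrable lborel (\<lambda>x. monomial_fun \<alpha> x * gauss x)"
    and monomial_gauss_integral: "(\<integral>x. monomial_fun \<alpha> x * gauss x \<partial>lborel) = (\<Prod>i\<in>UNIV. gmoment (\<alpha> i))"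
proof -
  interpret product_sigma_finite "\<lambda>_::real^'n. lborel :: real measure" ..
  \<comment> \<open>The product measure is indexed by basis vectors and not by coordinates, so the
    exponents are transported along \<open>axis_index\<close>.\<close>
  define \<beta> where "\<beta> b = \<alpha> (axis_index b)" for b :: "real^'n"
  let ?h = "\<lambda>b t. t ^ \<beta> b * exp (- t\<^sup>2 / 2) :: real"
  let ?T = "\<lambda>f. \<Sum>b\<in>Basis. f b *\<^sub>R (b :: real^'n)"
  have \<beta>: "\<beta> (axis i 1) = \<alpha> i" for i
  proof -
    have "axis i (1::real) = axis (axis_index (axis i (1::real))) 1" by (rule axis_index) (simp add: axis_in_Basis_iff)
    then have "axis_index (axis i (1::real)) = i" by (simp add: axis_eq_axis)
    then show ?thesis by (simp add: \<beta>_def)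
  qed
  have F: "monomial_fun \<alpha> x * gauss x = (\<Prod>b\<in>Basis. ?h b (x \<bullet> b))" for x
    unfolding prod_Basis_axis \<beta> monomial_fun_def gauss_prod prod.distrib by (simp add: inner_axis)
  have FT: "monomial_fun \<alpha> (?T f) * gauss (?T f) = (\<Prod>b\<in>Basis. ?h b (f b))" for f
    unfolding F by (intro prod.cong refl) (simp add: inner_sum_left_Basis)
  have lb: "(lborel :: (real^'n) measure) = distr (Pi\<^sub>M Basis (\<lambda>b. lborel)) borel ?T"
    by (subst lborel_def) (simp add: lborel_eq_real)
  have mT: "?T \<in> measurable (Pi\<^sub>M Basis (\<lambda>b. lborel)) borel" by measurable
  have mF: "(\<lambda>x::real^'n. monomial_fun \<alpha> x * gauss x) \<in> borel_measurable borel"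
    unfolding monomial_fun_def gauss_def
    by (intro borel_measurable_continuous_onI continuous_intros) simp
  have i: "integrable (Pi\<^sub>M Basis (\<lambda>b::real^'n. lborel)) (\<lambda>f. \<Prod>b\<in>Basis. ?h b (f b))"
    by (intro product_integrable_prod finite_Basis gmoment_integrable)
  show "integrable lborel (\<lambda>x::real^'n. monomial_fun \<alpha> x * gauss x)"
    unfolding lb using i by (subst integrable_distr_eq[OF mT mF]) (simp add: FT)
  have "(\<integral>x. monomial_fun \<alpha> x * gauss x \<partial>lborel) = (\<integral>f. (\<Prod>b\<in>Basis. ?h b (f b)) \<partial>Pi\<^sub>M Basis (\<lambda>b::real^'n. lborel))"
    unfolding lb by (subst integral_distr[OF mT mF]) (simp add: FT)
  also have "\<dots> = (\<Prod>b\<in>Basis. \<integral>t. ?h b t \<partial>lborel)"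
    by (intro product_integral_prod finite_Basis gmoment_integrable)
  also have "\<dots> = (\<Prod>i\<in>UNIV. gmoment (\<alpha> i))" unfolding prod_Basis_axis \<beta> gmoment_def ..
  finally show "(\<integral>x. monomial_fun \<alpha> x * gauss x \<partial>lborel) = (\<Prod>i\<in>UNIV. gmoment (\<alpha> i))" .
qed

definition gauss_int :: "(real^'n \<Rightarrow> complex) \<Rightarrow> complex" where
  "gauss_int P = (\<integral>x. P x * complex_of_real (gauss x) \<partial>lborel)"

lemma hom_poly_expand:
  assumes "hom_poly k P"
  obtains A c where "finite A" "\<forall>\<alpha>\<in>A. (\<Sum>i\<in>UNIV. \<alpha> i) = k" "P = (\<lambda>x. \<Sum>\<alpha>\<in>A. c \<alpha> * complex_of_real (monomial_fun \<alpha> x))"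
  using assms unfolding homogeneous_poly_iff_hom_poly[symmetric] homogeneous_poly_def by blast

lemma monomial_gauss_int_integrable: "integrable lborel (\<lambda>x. c * complex_of_real (monomial_fun \<alpha> x) * complex_of_real (gauss x))"
proof -
  have "integrable lborel (\<lambda>x. c * complex_of_real (monomial_fun \<alpha> x * gauss x))"
    by (intro integrable_mult_right integrable_of_real monomial_gauss_integrable)
  then show ?thesis by (simp add: mult.assoc)
qed

lemma hom_poly_gauss_integrable:
  assumes "hom_poly k P" shows "integrable lborel (\<lambda>x. P x * complex_of_real (gauss x))"
proof -
  from hom_poly_expand[OF assms] obtain A c where P: "P = (\<lambda>x. \<Sum>\<alpha>\<in>A. c \<alpha> * complex_of_real (monomial_fun \<alpha> x))" by metis
  show ?thesis unfolding P sum_distrib_right by (intro Bochner_Integration.integrable_sum monomial_gauss_int_integrable)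
qed

lemma gauss_int_monomial: "gauss_int (\<lambda>x. complex_of_real (monomial_fun \<alpha> x)) = complex_of_real (\<Prod>i\<in>UNIV. gmoment (\<alpha> i))"
proof -
  have "gauss_int (\<lambda>x. complex_of_real (monomial_fun \<alpha> x)) = (\<integral>x. complex_of_real (monomial_fun \<alpha> x * gauss x) \<partial>lborel)"
    by (simp add: gauss_int_def)
  also have "\<dots> = complex_of_real (\<Prod>i\<in>UNIV. gmoment (\<alpha> i))"
    unfolding integral_complex_of_real monomial_gauss_integral ..
  finally show ?thesis .
qed

lemma gauss_int_cmult: "gauss_int (\<lambda>x. c * P x) = c * gauss_int P"
  unfolding gauss_int_def mult.assoc by simp

lemma gauss_int_add: "hom_poly k P \<Longrightarrow> hom_poly l Q \<Longrightarrow> gauss_int (\<lambda>x. P x + Q x) = gauss_int P + gauss_int Q"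
  unfolding gauss_int_def distrib_right by (intro Bochner_Integration.integral_add hom_poly_gauss_integrable)

lemma gauss_int_sum: "(\<And>a. a \<in> A \<Longrightarrow> hom_poly k (P a)) \<Longrightarrow> gauss_int (\<lambda>x. \<Sum>a\<in>A. P a x) = (\<Sum>a\<in>A. gauss_int (P a))"
  unfolding gauss_int_def sum_distrib_right by (intro Bochner_Integration.integral_sum hom_poly_gauss_integrable)

lemma gauss_int_zero [simp]: "gauss_int (\<lambda>x. 0) = 0"
  by (simp add: gauss_int_def)

lemma partial_monomial:
  fixes \<alpha> :: "'n::finite \<Rightarrow> nat"
  shows "partial i (\<lambda>x. complex_of_real (monomial_fun \<alpha> x)) = (\<lambda>x. of_nat (\<alpha> i) * complex_of_real (monomial_fun (\<alpha>(i := \<alpha> i - 1)) x))"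
proof (rule ext, rule partial_eqI)
  fix x :: "real^'n"
  let ?R = "\<Prod>j\<in>UNIV - {i}. (x $ j) ^ \<alpha> j"
  have 1: "monomial_fun \<alpha> (x + t *\<^sub>R axis i 1) = (x $ i + t) ^ \<alpha> i * ?R" for t
    unfolding monomial_fun_def by (subst prod.remove[of _ i]) (auto simp: axis_def intro!: prod.cong)
  have 2: "monomial_fun (\<alpha>(i := \<alpha> i - 1)) x = (x $ i) ^ (\<alpha> i - 1) * ?R"
    unfolding monomial_fun_def by (subst prod.remove[of _ i]) (auto intro!: prod.cong)
  have "((\<lambda>t. (x $ i + t) ^ \<alpha> i * ?R) has_real_derivative (real (\<alpha> i) * (x $ i) ^ (\<alpha> i - 1) * ?R)) (at 0)"
    by (auto intro!: derivative_eq_intros)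
  then have "((\<lambda>t. complex_of_real ((x $ i + t) ^ \<alpha> i * ?R)) has_vector_derivative complex_of_real (real (\<alpha> i) * (x $ i) ^ (\<alpha> i - 1) * ?R)) (at 0)"
    by (intro has_vector_derivative_of_real) (simp add: has_real_derivative_iff_has_vector_derivative)
  then show "((\<lambda>t. complex_of_real (monomial_fun \<alpha> (x + t *\<^sub>R axis i 1))) has_vector_derivative
     of_nat (\<alpha> i) * complex_of_real (monomial_fun (\<alpha>(i := \<alpha> i - 1)) x)) (at 0)"
    unfolding 1 2 by (simp add: mult.assoc)
qed

lemma gauss_int_coord_monomial:
  fixes \<alpha> :: "'n::finite \<Rightarrow> nat"
  shows "gauss_int (\<lambda>x. complex_of_real (x $ i) * complex_of_real (monomial_fun \<alpha> x)) = gauss_int (partial i (\<lambda>x. complex_of_real (monomial_fun \<alpha> x)))"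
proof -
  have p: "(\<Prod>j\<in>UNIV. gmoment ((\<alpha>(i := a)) j)) = gmoment a * (\<Prod>j\<in>UNIV - {i}. gmoment (\<alpha> j))" for a
    by (subst prod.remove[of _ i]) (auto intro!: prod.cong)
  have "gauss_int (\<lambda>x. complex_of_real (x $ i) * complex_of_real (monomial_fun \<alpha> x)) = gauss_int (\<lambda>x. complex_of_real (monomial_fun (\<alpha>(i := Suc (\<alpha> i))) x))"
    unfolding monomial_Suc by simp
  also have "\<dots> = complex_of_real (gmoment (Suc (\<alpha> i)) * (\<Prod>j\<in>UNIV - {i}. gmoment (\<alpha> j)))"
    unfolding gauss_int_monomial p ..
  also have "\<dots> = of_nat (\<alpha> i) * complex_of_real (gmoment (\<alpha> i - 1) * (\<Prod>j\<in>UNIV - {i}. gmoment (\<alpha> j)))"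
    by (simp add: gmoment_Suc)
  also have "\<dots> = gauss_int (partial i (\<lambda>x. complex_of_real (monomial_fun \<alpha> x)))"
    unfolding partial_monomial gauss_int_cmult gauss_int_monomial p ..
  finally show ?thesis .
qed

text \<open>Integration by parts: the i-th derivative of the Gaussian is minus the i-th coordinate
  times itself. On a monomial only the i-th one-dimensional moment changes; the rest is linearity,
  and boundary terms never appear.\<close>

lemma gauss_int_coord:
  assumes "hom_poly k P" shows "gauss_int (\<lambda>x. complex_of_real (x $ i) * P x) = gauss_int (partial i P)"
proof -
  from hom_poly_expand[OF assms] obtain A c where A: "\<forall>\<alpha>\<in>A. (\<Sum>i\<in>UNIV. \<alpha> i) = k"
    and P: "P = (\<lambda>x. \<Sum>\<alpha>\<in>A. c \<alpha> * complex_of_real (monomial_fun \<alpha> x))" by metis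
  have h: "hom_poly k (\<lambda>x. complex_of_real (monomial_fun \<alpha> x))" if "\<alpha> \<in> A" for \<alpha>
    using A that by (intro hom_poly_monomial) simp
  have h1: "hom_poly k (\<lambda>x. c \<alpha> * complex_of_real (monomial_fun \<alpha> x))" if "\<alpha> \<in> A" for \<alpha>
    by (rule hom_poly_cmult[OF h[OF that]])
  have "gauss_int (\<lambda>x. complex_of_real (x $ i) * P x) = gauss_int (\<lambda>x. \<Sum>\<alpha>\<in>A. complex_of_real (x $ i) * (c \<alpha> * complex_of_real (monomial_fun \<alpha> x)))"
    by (simp only: P sum_distrib_left)
  also have "\<dots> = (\<Sum>\<alpha>\<in>A. gauss_int (\<lambda>x. complex_of_real (x $ i) * (c \<alpha> * complex_of_real (monomial_fun \<alpha> x))))"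
    by (rule gauss_int_sum, rule hom_poly_coord, rule h1)
  also have "\<dots> = (\<Sum>\<alpha>\<in>A. gauss_int (partial i (\<lambda>x. c \<alpha> * complex_of_real (monomial_fun \<alpha> x))))"
  proof (rule sum.cong[OF refl])
    fix \<alpha> assume "\<alpha> \<in> A"
    have "gauss_int (\<lambda>x. complex_of_real (x $ i) * (c \<alpha> * complex_of_real (monomial_fun \<alpha> x))) = c \<alpha> * gauss_int (\<lambda>x. complex_of_real (x $ i) * complex_of_real (monomial_fun \<alpha> x))"
      by (simp only: mult.left_commute[of _ "c \<alpha>"] gauss_int_cmult)
    then show "gauss_int (\<lambda>x. complex_of_real (x $ i) * (c \<alpha> * complex_of_real (monomial_fun \<alpha> x))) = gauss_int (partial i (\<lambda>x. c \<alpha> * complex_of_real (monomial_fun \<alpha> x)))"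
      by (simp only: gauss_int_coord_monomial partial_cmult[OF h[OF \<open>\<alpha> \<in> A\<close>]] gauss_int_cmult)
  qed
  also have "\<dots> = gauss_int (\<lambda>x. \<Sum>\<alpha>\<in>A. partial i (\<lambda>x. c \<alpha> * complex_of_real (monomial_fun \<alpha> x)) x)"
    by (rule gauss_int_sum[symmetric], rule hom_poly_partial, rule h1)
  also have "\<dots> = gauss_int (partial i P)" unfolding P by (subst partial_sum[OF h1]) simp_all
  finally show ?thesis .
qed

section \<open>Euler's identity, the Laplacian and orthogonality under the Gaussian\<close>

lemma gauss_int_grad:
  assumes "\<And>i. hom_poly k (R i)"
  shows "gauss_int (\<lambda>x. \<Sum>i\<in>UNIV. complex_of_real (x $ i) * R i x) = (\<Sum>i\<in>UNIV. gauss_int (partial i (R i)))"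
  by (subst gauss_int_sum[where k = "Suc k"], rule hom_poly_coord, rule assms) (simp only: gauss_int_coord[OF assms])

text \<open>One of the two equal coordinates in each term of the squared norm is integrated by
  parts. The derivative of the other one contributes the dimension after summation, and Euler's
  identity contributes k.\<close>

lemma gauss_int_sqnorm_mult:
  fixes P :: "real^'n \<Rightarrow> complex"
  assumes P: "hom_poly k P"
  shows "gauss_int (\<lambda>x. sqnorm x * P x) = of_nat (CARD('n) + k) * gauss_int P"
proof -
  have h: "hom_poly (k - 1) (partial i P)" for i by (rule hom_poly_partial[OF P])
  have h2: "hom_poly (Suc (k - 1)) (\<lambda>x. complex_of_real (x $ i) * partial i P x)" for i by (rule hom_poly_coord[OF h])
  have "gauss_int (\<lambda>x. sqnorm x * P x) = gauss_int (\<lambda>x. \<Sum>i\<in>UNIV. complex_of_real (x $ i) * (complex_of_real (x $ i) * P x))"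
    by (simp only: sqnorm_def sum_distrib_right mult.assoc)
  also have "\<dots> = (\<Sum>i\<in>UNIV. gauss_int (\<lambda>x. P x + complex_of_real (x $ i) * partial i P x))"
    by (subst gauss_int_grad[OF hom_poly_coord[OF P]]) (simp add: partial_coord[OF P])
  also have "\<dots> = (\<Sum>i\<in>(UNIV::'n set). gauss_int P) + (\<Sum>i\<in>UNIV. gauss_int (\<lambda>x. complex_of_real (x $ i) * partial i P x))"
    by (subst gauss_int_add[OF P h2]) (rule sum.distrib)
  also have "(\<Sum>i\<in>UNIV. gauss_int (\<lambda>x. complex_of_real (x $ i) * partial i P x)) = gauss_int (\<lambda>x. \<Sum>i\<in>UNIV. complex_of_real (x $ i) * partial i P x)"
    by (rule gauss_int_sum[OF h2, symmetric])
  also have "\<dots> = of_nat k * gauss_int P" by (simp only: hom_poly_Euler[OF P] gauss_int_cmult)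
  finally show ?thesis by (simp add: distrib_right)
qed

text \<open>k P = x . grad P by Euler's identity, and integration by parts turns the right-hand side
  into the Laplacian of P, which is zero.\<close>

lemma gauss_int_harm_0: assumes P: "harm k P" and k: "k > 0" shows "gauss_int P = 0"
proof -
  have h: "hom_poly k P" using P by (rule harm_hom_poly)
  have "of_nat k * gauss_int P = gauss_int (\<lambda>x. \<Sum>i\<in>UNIV. complex_of_real (x $ i) * partial i P x)"
    by (simp only: hom_poly_Euler[OF h] gauss_int_cmult)
  also have "\<dots> = (\<Sum>i\<in>UNIV. gauss_int (partial i (partial i P)))" by (rule gauss_int_grad[OF hom_poly_partial[OF h]])
  also have "\<dots> = gauss_int (lap P)" unfolding lap_def[abs_def] by (rule gauss_int_sum[symmetric], rule hom_poly_partial, rule hom_poly_partial[OF h])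
  also have "\<dots> = 0" using P by (simp add: harm_def)
  finally show ?thesis using k by simp
qed

text \<open>
  The right-hand side is symmetric in \<open>P\<close> and \<open>Q\<close>, so harmonic polynomials of different degrees are
  orthogonal.
\<close>

lemma gauss_int_green:
  fixes P :: "real^'n \<Rightarrow> complex"
  assumes P: "harm k P" and Q: "hom_poly l Q"
  shows "of_nat k * gauss_int (\<lambda>x. P x * Q x) = (\<Sum>i\<in>UNIV. gauss_int (\<lambda>x. partial i P x * partial i Q x))"
proof -
  have h: "hom_poly k P" using P by (rule harm_hom_poly)
  have hl: "hom_poly (k - 1 - 1 + l) (\<lambda>x. partial i (partial i P) x * Q x)" for i by (intro hom_poly_mult hom_poly_partial h Q)
  have hr: "hom_poly (k - 1 + (l - 1)) (\<lambda>x. partial i P x * partial i Q x)" for i by (intro hom_poly_mult hom_poly_partial h Q)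
  have "of_nat k * gauss_int (\<lambda>x. P x * Q x) = gauss_int (\<lambda>x. \<Sum>i\<in>UNIV. complex_of_real (x $ i) * (partial i P x * Q x))"
    by (simp only: mult.assoc[symmetric] sum_distrib_right[symmetric] hom_poly_Euler[OF h]) (simp only: mult.assoc gauss_int_cmult)
  also have "\<dots> = (\<Sum>i\<in>UNIV. gauss_int (partial i (\<lambda>x. partial i P x * Q x)))"
    by (rule gauss_int_grad, rule hom_poly_mult, rule hom_poly_partial[OF h], rule Q)
  also have "\<dots> = (\<Sum>i\<in>UNIV. gauss_int (\<lambda>x. partial i P x * partial i Q x) + gauss_int (\<lambda>x. partial i (partial i P) x * Q x))"
    by (simp only: partial_mult[OF hom_poly_partial[OF h] Q] gauss_int_add[OF hr hl])
  also have "\<dots> = (\<Sum>i\<in>UNIV. gauss_int (\<lambda>x. partial i P x * partial i Q x)) + (\<Sum>i\<in>UNIV. gauss_int (\<lambda>x. partial i (partial i P) x * Q x))"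
    by (rule sum.distrib)
  also have "(\<Sum>i\<in>UNIV. gauss_int (\<lambda>x. partial i (partial i P) x * Q x)) = gauss_int (\<lambda>x. \<Sum>i\<in>UNIV. partial i (partial i P) x * Q x)"
    by (rule gauss_int_sum[OF hl, symmetric])
  also have "\<dots> = gauss_int (\<lambda>x. lap P x * Q x)" by (simp only: lap_def sum_distrib_right)
  also have "\<dots> = 0" using P by (simp add: harm_def)
  finally show ?thesis by simp
qed

lemma gauss_int_orthogonal:
  assumes P: "harm k P" and Q: "harm l Q" and kl: "k \<noteq> l"
  shows "gauss_int (\<lambda>x. P x * Q x) = 0"
proof -
  have "of_nat k * gauss_int (\<lambda>x. P x * Q x) = of_nat l * gauss_int (\<lambda>x. Q x * P x)"
    unfolding gauss_int_green[OF P harm_hom_poly[OF Q]] gauss_int_green[OF Q harm_hom_poly[OF P]] by (simp add: mult.commute)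
  then have "(of_nat k - of_nat l) * gauss_int (\<lambda>x. P x * Q x) = 0" by (simp add: mult.commute left_diff_distrib)
  then show ?thesis using kl by simp
qed

section \<open>Moments of harmonics against powers of a linear form\<close>

definition lin :: "real^'n \<Rightarrow> real^'n \<Rightarrow> complex" where
  "lin \<xi> x = (\<Sum>i\<in>UNIV. complex_of_real (\<xi> $ i) * complex_of_real (x $ i))"

lemma lin_inner: "lin \<xi> x = complex_of_real (x \<bullet> \<xi>)"
  by (simp add: lin_def inner_vec_def mult.commute)

lemma hom_poly_lin: "hom_poly 1 (lin \<xi>)"
  unfolding lin_def[abs_def] by (rule hom_poly_sum, rule hom_poly_cmult, rule hom_poly_x)

lemma partial_lin: "partial i (lin \<xi>) = (\<lambda>x. complex_of_real (\<xi> $ i))"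
proof -
  have "partial i (lin \<xi>) = (\<lambda>x. \<Sum>j\<in>UNIV. partial i (\<lambda>x. complex_of_real (\<xi> $ j) * complex_of_real (x $ j)) x)"
    unfolding lin_def[abs_def] by (rule partial_sum, rule hom_poly_cmult, rule hom_poly_x)
  then show ?thesis by (simp add: partial_cmult[OF hom_poly_x] partial_x if_distrib cong: if_cong)
qed

lemma hom_poly_lin_power: "hom_poly n (\<lambda>x. lin \<xi> x ^ n)"
  using hom_poly_power[OF hom_poly_lin, of n] by simp

lemma partial_lin_power: "partial i (\<lambda>x. lin \<xi> x ^ n) = (\<lambda>x. of_nat n * complex_of_real (\<xi> $ i) * lin \<xi> x ^ (n - 1))"
proof (induction n)
  case (Suc n)
  have "partial i (\<lambda>x. lin \<xi> x ^ Suc n) = (\<lambda>x. lin \<xi> x * partial i (\<lambda>x. lin \<xi> x ^ n) x + partial i (lin \<xi>) x * lin \<xi> x ^ n)"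
    unfolding power_Suc by (rule partial_mult[OF hom_poly_lin hom_poly_lin_power])
  then show ?case unfolding Suc partial_lin by (cases n) (simp_all add: fun_eq_iff algebra_simps)
qed simp

definition dir_deriv :: "real^'n \<Rightarrow> (real^'n \<Rightarrow> complex) \<Rightarrow> real^'n \<Rightarrow> complex" where
  "dir_deriv \<xi> P x = (\<Sum>i\<in>UNIV. complex_of_real (\<xi> $ i) * partial i P x)"

lemma hom_poly_dir_deriv: "hom_poly k P \<Longrightarrow> hom_poly (k - 1) (dir_deriv \<xi> P)"
  unfolding dir_deriv_def[abs_def] by (rule hom_poly_sum, rule hom_poly_cmult, rule hom_poly_partial)

lemma lap_partial:
  assumes h: "hom_poly k P" shows "lap (partial i P) = partial i (lap P)"
proof -
  have "lap (partial i P) = (\<lambda>x. \<Sum>j\<in>UNIV. partial i (partial j (partial j P)) x)"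
    unfolding lap_def[abs_def] partial_commute[OF h, of _ i] partial_commute[OF hom_poly_partial[OF h], of _ i] ..
  also have "\<dots> = partial i (lap P)"
    unfolding lap_def[abs_def] by (rule partial_sum[symmetric], rule hom_poly_partial, rule hom_poly_partial[OF h])
  finally show ?thesis .
qed

lemma harm_dir_deriv:
  assumes P: "harm k P" shows "harm (k - 1) (dir_deriv \<xi> P)"
proof -
  have h: "hom_poly k P" using P by (rule harm_hom_poly)
  have "lap (dir_deriv \<xi> P) = (\<lambda>x. \<Sum>i\<in>UNIV. lap (\<lambda>x. complex_of_real (\<xi> $ i) * partial i P x) x)"
    unfolding dir_deriv_def[abs_def] by (rule lap_sum, rule hom_poly_cmult, rule hom_poly_partial[OF h])
  also have "\<dots> = (\<lambda>x. 0)" using P by (simp add: lap_cmult[OF hom_poly_partial[OF h]] lap_partial[OF h] harm_def)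
  finally show ?thesis using hom_poly_dir_deriv[OF h] by (simp add: harm_def)
qed

lemma gauss_int_lin_mult:
  assumes Q: "hom_poly k Q" shows "gauss_int (\<lambda>x. lin \<xi> x * Q x) = gauss_int (dir_deriv \<xi> Q)"
proof -
  have "gauss_int (\<lambda>x. lin \<xi> x * Q x) = gauss_int (\<lambda>x. \<Sum>i\<in>UNIV. complex_of_real (\<xi> $ i) * (complex_of_real (x $ i) * Q x))"
    by (simp only: lin_def sum_distrib_right mult.assoc)
  also have "\<dots> = (\<Sum>i\<in>UNIV. complex_of_real (\<xi> $ i) * gauss_int (partial i Q))"
    by (subst gauss_int_sum[where k = "Suc k"], rule hom_poly_cmult, rule hom_poly_coord[OF Q]) (simp only: gauss_int_cmult gauss_int_coord[OF Q])
  also have "\<dots> = gauss_int (dir_deriv \<xi> Q)"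
    unfolding dir_deriv_def[abs_def] by (subst gauss_int_sum[where k = "k - 1"], rule hom_poly_cmult, rule hom_poly_partial[OF Q]) (simp only: gauss_int_cmult)
  finally show ?thesis .
qed

text \<open>One factor \<open>lin \<xi>\<close> is integrated by parts along \<xi>. Either P is
  differentiated and degree and power both drop by one, or the power loses two factors; the excess
  of the power over the degree keeps its parity. Both inductions below rest on this recursion. At m
  = 0 the truncated power \<open>m - 1\<close> is multiplied by 0.\<close>

lemma gauss_int_lin_power_step:
  fixes P :: "real^'n \<Rightarrow> complex"
  assumes P: "hom_poly k P"
  shows "gauss_int (\<lambda>x. P x * lin \<xi> x ^ Suc m) = gauss_int (\<lambda>x. dir_deriv \<xi> P x * lin \<xi> x ^ m) + of_nat m * sqnorm \<xi> * gauss_int (\<lambda>x. P x * lin \<xi> x ^ (m - 1))"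
proof -
  have h: "hom_poly (k + m) (\<lambda>x. P x * lin \<xi> x ^ m)" by (rule hom_poly_mult[OF P hom_poly_lin_power])
  have "dir_deriv \<xi> (\<lambda>x. P x * lin \<xi> x ^ m) x = dir_deriv \<xi> P x * lin \<xi> x ^ m + of_nat m * sqnorm \<xi> * (P x * lin \<xi> x ^ (m - 1))" for x
    unfolding dir_deriv_def partial_mult[OF P hom_poly_lin_power] partial_lin_power sqnorm_def sum_distrib_left sum_distrib_right sum.distrib[symmetric]
    by (rule sum.cong) (simp_all add: algebra_simps)
  then have e: "dir_deriv \<xi> (\<lambda>x. P x * lin \<xi> x ^ m) = (\<lambda>x. dir_deriv \<xi> P x * lin \<xi> x ^ m + of_nat m * sqnorm \<xi> * (P x * lin \<xi> x ^ (m - 1)))" by (rule ext)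
  have "gauss_int (\<lambda>x. P x * lin \<xi> x ^ Suc m) = gauss_int (\<lambda>x. lin \<xi> x * (P x * lin \<xi> x ^ m))" by (simp only: power_Suc mult.left_commute)
  also have "\<dots> = gauss_int (\<lambda>x. dir_deriv \<xi> P x * lin \<xi> x ^ m + of_nat m * sqnorm \<xi> * (P x * lin \<xi> x ^ (m - 1)))"
    unfolding gauss_int_lin_mult[OF h] e ..
  also have "\<dots> = gauss_int (\<lambda>x. dir_deriv \<xi> P x * lin \<xi> x ^ m) + gauss_int (\<lambda>x. of_nat m * sqnorm \<xi> * (P x * lin \<xi> x ^ (m - 1)))"
    by (rule gauss_int_add, rule hom_poly_mult, rule hom_poly_dir_deriv[OF P], rule hom_poly_lin_power, rule hom_poly_cmult, rule hom_poly_mult[OF P hom_poly_lin_power])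
  finally show ?thesis unfolding gauss_int_cmult .
qed

lemma dir_deriv_self: "hom_poly k P \<Longrightarrow> dir_deriv \<xi> P \<xi> = of_nat k * P \<xi>"
  unfolding dir_deriv_def by (rule hom_poly_Euler)

lemma dir_deriv_hp0: "hom_poly 0 P \<Longrightarrow> dir_deriv \<xi> P = (\<lambda>x. 0)"
  by (simp add: dir_deriv_def fun_eq_iff partial_hp0)

text \<open>The power n is below k or differs from it by an odd number. The recursion preserves
  this, since it keeps n - k or lowers it by 2, and it ends at n = 0 < k.\<close>

lemma gauss_int_harm_lin_power_eq_0:
  fixes P :: "real^'n \<Rightarrow> complex"
  assumes "harm k P" "\<forall>j. n \<noteq> k + 2 * j"
  shows "gauss_int (\<lambda>x. P x * lin \<xi> x ^ n) = 0"
  using assms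
proof (induction n arbitrary: k P rule: less_induct)
  case (less n)
  show ?case
  proof (cases n)
    case 0
    then have "k > 0" using less.prems(2) by (cases k) auto
    then show ?thesis using gauss_int_harm_0[OF less.prems(1)] 0 by simp
  next
    case (Suc m)
    have "gauss_int (\<lambda>x. dir_deriv \<xi> P x * lin \<xi> x ^ m) = 0"
    proof (cases k)
      case 0
      then show ?thesis using dir_deriv_hp0[of P \<xi>] harm_hom_poly[OF less.prems(1)] by simp
    next
      case (Suc l)
      have "\<forall>j. m \<noteq> l + 2 * j" using less.prems(2) \<open>n = Suc m\<close> Suc by auto
      then show ?thesis using less.IH[of m l "dir_deriv \<xi> P"] harm_dir_deriv[OF less.prems(1), of \<xi>] \<open>n = Suc m\<close> Suc by simp
    qed
    moreover have "of_nat m * gauss_int (\<lambda>x. P x * lin \<xi> x ^ (m - 1)) = 0"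
    proof (cases m)
      case (Suc l)
      have "\<forall>j. l \<noteq> k + 2 * j"
      proof (intro allI notI)
        fix j assume "l = k + 2 * j"
        then have "n = k + 2 * Suc j" using \<open>n = Suc m\<close> Suc by simp
        then show False using less.prems(2) by blast
      qed
      then show ?thesis using less.IH[of l k P] less.prems(1) Suc \<open>n = Suc m\<close> by simp
    qed simp
    ultimately show ?thesis
      unfolding Suc gauss_int_lin_power_step[OF harm_hom_poly[OF less.prems(1)]] by (metis add_0 mult.commute mult.assoc mult_zero_right)
  qed
qed

text \<open>With n = k + 2 j the coefficient n! / (2^j j!) is k! times the number of ways to pair
  off 2 j of the n linear factors; the other k factors differentiate P along \<xi> down to k!
  P(\<xi>). In the induction the factor n splits into k, from Euler's identity at \<xi>, and 2 j,
  from the second term of the recursion.\<close>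

lemma gauss_int_harm_lin_power:
  fixes P :: "real^'n \<Rightarrow> complex"
  assumes "harm k P"
  shows "gauss_int (\<lambda>x. P x * lin \<xi> x ^ (k + 2 * j)) = gauss_int (\<lambda>x::real^'n. 1) * (fact (k + 2 * j) / (2 ^ j * fact j)) * sqnorm \<xi> ^ j * P \<xi>"
  using assms
proof (induction "k + 2 * j" arbitrary: k j P rule: less_induct)
  case less
  show ?case
  proof (cases "k + 2 * j")
    case 0
    then have kj: "k = 0" "j = 0" by auto
    have "hom_poly 0 P" using harm_hom_poly[OF less.prems] kj by simp
    then have "P x = P \<xi>" for x using hom_poly_scaleR[of 0 P 0 x] hom_poly_scaleR[of 0 P 0 \<xi>] by simp
    then have "P = (\<lambda>x. P \<xi> * 1)" by auto
    from arg_cong[OF this, of gauss_int] have "gauss_int P = P \<xi> * gauss_int (\<lambda>x::real^'n. 1)" by (simp only: gauss_int_cmult)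
    then show ?thesis using kj by simp
  next
    case (Suc m)
    let ?E = "gauss_int (\<lambda>x::real^'n. 1)"
    have h: "hom_poly k P" by (rule harm_hom_poly[OF less.prems])
    have A: "gauss_int (\<lambda>x. dir_deriv \<xi> P x * lin \<xi> x ^ m) = ?E * (fact m / (2 ^ j * fact j)) * sqnorm \<xi> ^ j * (of_nat k * P \<xi>)"
    proof (cases k)
      case 0
      then show ?thesis using dir_deriv_hp0[of P \<xi>] h by simp
    next
      case (Suc l)
      have m: "m = l + 2 * j" using \<open>k + 2 * j = Suc m\<close> Suc by simp
      have "harm l (dir_deriv \<xi> P)" using harm_dir_deriv[OF less.prems, of \<xi>] Suc by simp
      moreover have "l + 2 * j < k + 2 * j" using Suc by simp
      ultimately show ?thesis using less.hyps[of l j "dir_deriv \<xi> P"] unfolding m[symmetric] dir_deriv_self[OF h] by simp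
    qed
    have B: "of_nat m * sqnorm \<xi> * gauss_int (\<lambda>x. P x * lin \<xi> x ^ (m - 1)) = ?E * (fact m / (2 ^ j * fact j)) * sqnorm \<xi> ^ j * (of_nat (2 * j) * P \<xi>)"
    proof (cases j)
      case 0
      \<comment> \<open>For m > 0 the remaining power m - 1 = k - 2 lies below the degree k, so the
        integral vanishes; for m = 0 the factor does.\<close>
      have "of_nat m * gauss_int (\<lambda>x. P x * lin \<xi> x ^ (m - 1)) = 0"
      proof (cases m)
        case (Suc l)
        have "gauss_int (\<lambda>x. P x * lin \<xi> x ^ (m - 1)) = 0"
          by (rule gauss_int_harm_lin_power_eq_0[OF less.prems]) (use \<open>k + 2 * j = Suc m\<close> 0 Suc in auto)
        then show ?thesis by simp
      qed simp
      then have "of_nat m * sqnorm \<xi> * gauss_int (\<lambda>x. P x * lin \<xi> x ^ (m - 1)) = 0" by auto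
      then show ?thesis using 0 by (simp only: mult_0_right of_nat_0 mult_zero_left mult_zero_right)
    next
      case (Suc i)
      have m: "m = Suc (k + 2 * i)" using \<open>k + 2 * j = Suc m\<close> Suc by simp
      have IH: "gauss_int (\<lambda>x. P x * lin \<xi> x ^ (k + 2 * i)) = ?E * (fact (k + 2 * i) / (2 ^ i * fact i)) * sqnorm \<xi> ^ i * P \<xi>"
        by (rule less.hyps[OF _ less.prems]) (use Suc in simp)
      have f: "of_nat m * (fact (k + 2 * i) / (2 ^ i * fact i)) = (fact m / (2 ^ j * fact j)) * (of_nat (2 * j) :: complex)"
        unfolding Suc m by (simp add: divide_simps del: of_nat_Suc) (simp add: algebra_simps)
      have "of_nat m * sqnorm \<xi> * gauss_int (\<lambda>x. P x * lin \<xi> x ^ (m - 1)) = ?E * (of_nat m * (fact (k + 2 * i) / (2 ^ i * fact i))) * (sqnorm \<xi> * sqnorm \<xi> ^ i) * P \<xi>"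
        using IH by (simp add: m algebra_simps del: of_nat_Suc)
      then show ?thesis unfolding f by (simp add: Suc algebra_simps)
    qed
    have "gauss_int (\<lambda>x. P x * lin \<xi> x ^ (k + 2 * j)) = ?E * (fact m / (2 ^ j * fact j)) * sqnorm \<xi> ^ j * (of_nat k * P \<xi>) + ?E * (fact m / (2 ^ j * fact j)) * sqnorm \<xi> ^ j * (of_nat (2 * j) * P \<xi>)"
      unfolding Suc gauss_int_lin_power_step[OF h] A B ..
    also have "\<dots> = ?E * (of_nat (k + 2 * j) * fact m / (2 ^ j * fact j)) * sqnorm \<xi> ^ j * P \<xi>"
      by (simp add: algebra_simps add_divide_distrib)
    also have "of_nat (k + 2 * j) * fact m = (fact (k + 2 * j) :: complex)" unfolding Suc by simp
    finally show ?thesis .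
  qed
qed

section \<open>Fourier transforms of spherical harmonics\<close>

abbreviation sphere_int :: "(real^'n \<Rightarrow> complex) \<Rightarrow> complex" where
  "sphere_int F \<equiv> (\<integral>w. F w \<partial>sphere_measure)"

lemma sphere_measurable:
  fixes f :: "real^'n \<Rightarrow> 'b::topological_space"
  assumes "continuous_on (sphere 0 1) f" shows "f \<in> borel_measurable sphere_measure"
  using borel_measurable_continuous_on_restrict[OF assms] by (simp cong: measurable_cong_sets)

lemma sphere_bounded:
  fixes f :: "real^'n \<Rightarrow> 'b::real_normed_vector"
  assumes "continuous_on (sphere 0 1) f"
  obtains B where "B > 0" "\<And>w. w \<in> sphere 0 1 \<Longrightarrow> norm (f w) \<le> B"
proof -
  have "bounded (f ` sphere 0 1)" by (intro compact_imp_bounded compact_continuous_image assms) simp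
  then show ?thesis using that unfolding bounded_pos by blast
qed

lemma sphere_integrable:
  fixes f :: "real^'n \<Rightarrow> 'b::{banach, second_countable_topology}"
  assumes "continuous_on (sphere 0 1) f" shows "integrable sphere_measure f"
proof -
  from sphere_bounded[OF assms] obtain B where "\<And>w. w \<in> sphere 0 1 \<Longrightarrow> norm (f w) \<le> B" by metis
  then show ?thesis
    by (intro sphere.integrable_const_bound[of _ B] AE_I2 sphere_measurable assms) simp
qed

lemma hom_poly_sphere_integrable: "hom_poly k P \<Longrightarrow> integrable sphere_measure P"
  by (rule sphere_integrable) (rule hom_poly_continuous)

section \<open>From Gaussian to spherical integrals\<close>

definition radial_gauss :: "nat \<Rightarrow> nat \<Rightarrow> real" where
  "radial_gauss d k = (\<integral>r. r ^ k * exp (- r\<^sup>2 / 2) \<partial>radial d)"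

lemma radial_density: "radial d = density lborel (\<lambda>r. ennreal (indicator {0..} r * r ^ (d - 1)))"
  unfolding radial_def by (intro arg_cong[of _ _ "density lborel"] ext) (simp add: indicator_def)

lemma radial_weight_nonneg: "indicator {0..} r * r ^ (d - 1) \<ge> (0::real)"
  by (simp add: indicator_def)

lemma integral_radial:
  fixes f :: "real \<Rightarrow> 'b::{banach, second_countable_topology}"
  assumes "f \<in> borel_measurable borel"
  shows "(\<integral>r. f r \<partial>radial d) = (\<integral>r. (indicator {0..} r * r ^ (d - 1)) *\<^sub>R f r \<partial>lborel)"
  unfolding radial_density using assms by (intro integral_density AE_I2 radial_weight_nonneg) simp_all

text \<open>In polar coordinates a homogeneous integrand splits into a radial factor and its
  restriction to the sphere. Since the radial factor is positive and depends on the degree alone,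
  identities for \<open>gauss_int\<close> carry over to the sphere.\<close>

lemma gauss_int_sphere:
  fixes P :: "real^'n \<Rightarrow> complex"
  assumes P: "hom_poly k P"
  shows "gauss_int P = complex_of_real (radial_gauss CARD('n) k) * sphere_int P"
proof -
  have e: "P (r *\<^sub>R w) * complex_of_real (gauss (r *\<^sub>R w)) = complex_of_real (r ^ k * exp (- r\<^sup>2 / 2)) * P w"
    if "w \<in> sphere 0 1" for r w
    using that by (simp add: hom_poly_scaleR[OF P] gauss_def power_mult_distrib)
  have "gauss_int P = (\<integral>r. sphere_int (\<lambda>w. P (r *\<^sub>R w) * complex_of_real (gauss (r *\<^sub>R w))) \<partial>radial CARD('n))"
    unfolding gauss_int_def by (rule polar_integral[OF hom_poly_gauss_integrable[OF P]])
  also have "\<dots> = (\<integral>r. sphere_int (\<lambda>w. complex_of_real (r ^ k * exp (- r\<^sup>2 / 2)) * P w) \<partial>radial CARD('n))"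
    by (intro Bochner_Integration.integral_cong refl e) simp
  also have "\<dots> = (\<integral>r. complex_of_real (r ^ k * exp (- r\<^sup>2 / 2)) * sphere_int P \<partial>radial CARD('n))" by simp
  also have "\<dots> = complex_of_real (radial_gauss CARD('n) k) * sphere_int P"
    unfolding radial_gauss_def integral_complex_of_real[symmetric] by (rule integral_mult_left_zero)
  finally show ?thesis .
qed

lemma radial_gauss_pos: "radial_gauss d k > 0"
proof -
  let ?f = "\<lambda>r::real. indicator {0..} r *\<^sub>R (r ^ (d - 1 + k) * exp (- r\<^sup>2 / 2))"
  have c: "radial_gauss d k = integral\<^sup>L lborel ?f"
    unfolding radial_gauss_def by (subst integral_radial) (auto simp: power_add mult_ac)
  have i: "integrable lborel ?f"
    by (intro integrable_mult_indicator gmoment_integrable) simp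
  have nn: "?f r \<ge> 0" for r by (simp add: indicator_def)
  have "integral\<^sup>L lborel ?f \<noteq> 0"
  proof
    assume "integral\<^sup>L lborel ?f = 0"
    then have "AE r in lborel. ?f r = 0" using integral_nonneg_eq_0_iff_AE[OF i] nn by simp
    then have "AE r in lborel. r \<notin> {0<..<1::real}" by eventually_elim (auto simp: indicator_def)
    then have "emeasure lborel {0<..<1::real} = 0" by (subst (asm) AE_iff_measurable[of "{0<..<1}"]) auto
    then show False by simp
  qed
  moreover have "integral\<^sup>L lborel ?f \<ge> 0" using nn by simp
  ultimately show ?thesis unfolding c by linarith
qed

definition area :: "'n::finite itself \<Rightarrow> real" where
  "area _ = measure (sphere_measure :: (real^'n) measure) (sphere 0 1)"

lemma area_eq: "area TYPE('n::finite) = 2 * pi powr (real CARD('n) / 2) * rGamma (real CARD('n) / 2)"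
proof -
  have g: "Gamma (real CARD('n) / 2 + 1) = real CARD('n) / 2 * Gamma (real CARD('n) / 2)"
    by (rule Gamma_plus1) auto
  show ?thesis unfolding area_def measure_sphere_space unit_ball_vol_def g
    by (simp add: rGamma_inverse_Gamma field_simps)
qed

lemma area_pos: "area TYPE('n::finite) > 0"
proof -
  have "rGamma (real CARD('n) / 2) > 0" by (simp add: rGamma_inverse_Gamma Gamma_real_pos)
  then show ?thesis unfolding area_eq by simp
qed

lemma sphere_int_const: "sphere_int (\<lambda>w::real^'n. c) = complex_of_real (area TYPE('n)) * c"
  by (simp add: area_def scaleR_conv_of_real)

lemma gauss_int_1: "gauss_int (\<lambda>x::real^'n. 1) = complex_of_real ((2 * pi) powr (real CARD('n) / 2))"
proof -
  have "gauss_int (\<lambda>x::real^'n. 1) = gauss_int (\<lambda>x::real^'n. complex_of_real (monomial_fun (\<lambda>_. 0) x))"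
    by (simp add: monomial_fun_def)
  also have "\<dots> = complex_of_real (gmoment 0 ^ CARD('n))" unfolding gauss_int_monomial by simp
  also have "gmoment 0 = (2 * pi) powr (1 / 2)" using gmoment_even[of 0] by (simp add: powr_half_sqrt)
  also have "((2 * pi) powr (1 / 2)) ^ CARD('n) = (2 * pi) powr (real CARD('n) / 2)"
    by (simp add: powr_powr powr_realpow[symmetric])
  finally show ?thesis .
qed

lemma gauss_int_sqnorm_power: "gauss_int (\<lambda>x::real^'n. sqnorm x ^ j) = gauss_int (\<lambda>x::real^'n. 1) * complex_of_real (2 ^ j * pochhammer (real CARD('n) / 2) j)"
proof (induction j)
  case (Suc j)
  have h: "hom_poly (2 * j) (\<lambda>x::real^'n. sqnorm x ^ j)" using hom_poly_power[OF hom_poly_sqnorm, of j] by (simp add: mult.commute)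
  have "gauss_int (\<lambda>x::real^'n. sqnorm x ^ Suc j) = of_nat (CARD('n) + 2 * j) * gauss_int (\<lambda>x::real^'n. sqnorm x ^ j)"
    unfolding power_Suc by (rule gauss_int_sqnorm_mult[OF h])
  then show ?case unfolding Suc by (simp add: pochhammer_Suc algebra_simps)
qed simp

text \<open>The radial moment comes from integrating |x|^(2 j) in two ways: on the sphere the result
  is the area, over the whole space it is a Pochhammer product. The reciprocal Gamma value is
  multiplied in because it is the coefficient that occurs in \<open>phi\<close>.\<close>

lemma radial_gauss_even:
  "radial_gauss CARD('n::finite) (2 * j) * rGamma (real CARD('n) / 2 + real j) * 2 * pi powr (real CARD('n) / 2) = (2 * pi) powr (real CARD('n) / 2) * 2 ^ j"
proof -
  let ?d = "real CARD('n) / 2"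
  have h: "hom_poly (2 * j) (\<lambda>x::real^'n. sqnorm x ^ j)" using hom_poly_power[OF hom_poly_sqnorm, of j] by (simp add: mult.commute)
  have "sphere_int (\<lambda>w::real^'n. sqnorm w ^ j) = sphere_int (\<lambda>w::real^'n. 1)"
    by (rule Bochner_Integration.integral_cong) (auto simp: sqnorm_norm)
  then have "complex_of_real (radial_gauss CARD('n) (2 * j) * area TYPE('n)) = gauss_int (\<lambda>x::real^'n. sqnorm x ^ j)"
    unfolding gauss_int_sphere[OF h] sphere_int_const by simp
  also have "\<dots> = complex_of_real ((2 * pi) powr ?d * (2 ^ j * pochhammer ?d j))"
    unfolding gauss_int_sqnorm_power gauss_int_1 by simp
  finally have e: "radial_gauss CARD('n) (2 * j) * area TYPE('n) = (2 * pi) powr ?d * (2 ^ j * pochhammer ?d j)"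
    by (simp only: of_real_eq_iff)
  have nz: "?d + real j > 0" by (simp add: add_pos_nonneg)
  have "pochhammer ?d j = Gamma (?d + real j) / Gamma ?d" by (rule pochhammer_Gamma) auto
  then have p: "pochhammer ?d j * rGamma (?d + real j) = rGamma ?d"
    using Gamma_real_pos[OF nz] by (simp add: rGamma_inverse_Gamma field_simps)
  have "rGamma ?d * (radial_gauss CARD('n) (2 * j) * rGamma (?d + real j) * 2 * pi powr ?d) = radial_gauss CARD('n) (2 * j) * area TYPE('n) * rGamma (?d + real j)"
    unfolding area_eq by simp
  also have "\<dots> = rGamma ?d * ((2 * pi) powr ?d * 2 ^ j)" unfolding e p[symmetric] by simp
  finally have e2: "rGamma ?d * (radial_gauss CARD('n) (2 * j) * rGamma (?d + real j) * 2 * pi powr ?d) = rGamma ?d * ((2 * pi) powr ?d * 2 ^ j)" .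
  have "rGamma ?d \<noteq> 0" using area_pos[where 'n = 'n] unfolding area_eq by auto
  then show ?thesis using e2 by (rule mult_left_cancel[THEN iffD1])
qed

lemma sphere_int_harm_lin_power_eq_0:
  fixes P :: "real^'n \<Rightarrow> complex"
  assumes P: "harm k P" and n: "\<forall>j. n \<noteq> k + 2 * j"
  shows "sphere_int (\<lambda>w. P w * lin \<xi> w ^ n) = 0"
proof -
  have h: "hom_poly (k + n) (\<lambda>w. P w * lin \<xi> w ^ n)" by (rule hom_poly_mult[OF harm_hom_poly[OF P] hom_poly_lin_power])
  show ?thesis using gauss_int_sphere[OF h] gauss_int_harm_lin_power_eq_0[OF P n] radial_gauss_pos[of "CARD('n)" "k + n"] by simp
qed

lemma sphere_int_harm_lin_power:
  fixes P :: "real^'n \<Rightarrow> complex"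
  assumes P: "harm k P"
  shows "sphere_int (\<lambda>w. P w * lin \<xi> w ^ (k + 2 * j))
    = complex_of_real (2 * pi powr (real CARD('n) / 2) * rGamma (real CARD('n) / 2 + real (k + j)) / 2 ^ (k + j)
        * (fact (k + 2 * j) / (2 ^ j * fact j)) * (norm \<xi>) ^ (2 * j)) * P \<xi>"
proof -
  let ?d = "real CARD('n) / 2"
  let ?c = "radial_gauss CARD('n) (2 * (k + j))"
  \<comment> \<open>P and the power of \<open>lin \<xi>\<close> have total degree k + (k + 2 j),
    which is even; this is why only even radial moments were evaluated.\<close>
  have h: "hom_poly (2 * (k + j)) (\<lambda>w. P w * lin \<xi> w ^ (k + 2 * j))"
    using hom_poly_mult[OF harm_hom_poly[OF P] hom_poly_lin_power[of "k + 2 * j" \<xi>]] by (simp add: mult_2 ac_simps)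
  have c: "?c > 0" by (rule radial_gauss_pos)
  have "(2 * pi) powr ?d = ?c * (2 * pi powr ?d * rGamma (?d + real (k + j)) / 2 ^ (k + j))"
    using radial_gauss_even[of "k + j", where 'n = 'n] by (simp add: field_simps)
  then have eq: "complex_of_real ?c * sphere_int (\<lambda>w. P w * lin \<xi> w ^ (k + 2 * j)) =
      complex_of_real ?c * (complex_of_real (2 * pi powr ?d * rGamma (?d + real (k + j)) / 2 ^ (k + j)) * (fact (k + 2 * j) / (2 ^ j * fact j)) * sqnorm \<xi> ^ j * P \<xi>)"
    unfolding gauss_int_sphere[OF h, symmetric] gauss_int_harm_lin_power[OF P] gauss_int_1 by simp
  have "sphere_int (\<lambda>w. P w * lin \<xi> w ^ (k + 2 * j)) = complex_of_real (2 * pi powr ?d * rGamma (?d + real (k + j)) / 2 ^ (k + j)) * (fact (k + 2 * j) / (2 ^ j * fact j)) * sqnorm \<xi> ^ j * P \<xi>"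
    by (rule mult_left_cancel[THEN iffD1, OF _ eq]) (use c in simp)
  also have "sqnorm \<xi> ^ j = complex_of_real ((norm \<xi>) ^ (2 * j))" by (simp add: sqnorm_norm power_mult)
  finally show ?thesis by simp
qed

section \<open>Orthogonality of degrees on the sphere\<close>

lemma sphere_int_orthogonal:
  fixes P :: "real^'n \<Rightarrow> complex"
  assumes P: "harm k P" and Q: "harm l Q" and kl: "k \<noteq> l"
  shows "sphere_int (\<lambda>w. P w * Q w) = 0"
  using gauss_int_sphere[OF hom_poly_mult[OF harm_hom_poly[OF P] harm_hom_poly[OF Q]]] gauss_int_orthogonal[OF P Q kl] radial_gauss_pos[of "CARD('n)" "k + l"] by simp

lemma partial_cnj: "hom_poly k P \<Longrightarrow> partial i (\<lambda>x. cnj (P x)) = (\<lambda>x. cnj (partial i P x))"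
  by (intro ext partial_eqI bounded_linear.has_vector_derivative[OF bounded_linear_cnj] hom_poly_partial_works)

text \<open>Turns the bilinear orthogonality relation into the Hermitian one.\<close>

lemma harm_cnj: assumes "harm k P" shows "harm k (\<lambda>x. cnj (P x))"
proof -
  have h: "hom_poly k P" using assms by (rule harm_hom_poly)
  have "lap (\<lambda>x. cnj (P x)) = (\<lambda>x. cnj (lap P x))"
    by (simp add: lap_def fun_eq_iff partial_cnj[OF h] partial_cnj[OF hom_poly_partial[OF h]])
  then show ?thesis using assms hom_poly_cnj[OF h] by (simp add: harm_def)
qed

text \<open>The scalars \<open>a k\<close> are kept apart from the harmonics because in the
  quadratic form they are functions of the radius, frozen on each sphere.\<close>

lemma sphere_pythagoras:
  fixes Y :: "nat \<Rightarrow> real^'n \<Rightarrow> complex"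
  assumes A: "finite A" and Y: "\<And>k. k \<in> A \<Longrightarrow> harm k (Y k)"
  shows "(\<integral>w. (cmod (\<Sum>k\<in>A. a k * Y k w))\<^sup>2 \<partial>sphere_measure) = (\<Sum>k\<in>A. (cmod (a k))\<^sup>2 * (\<integral>w. (cmod (Y k w))\<^sup>2 \<partial>sphere_measure))"
proof -
  have cont: "continuous_on (sphere 0 1) (Y k)" if "k \<in> A" for k by (rule hom_poly_continuous[OF harm_hom_poly[OF Y[OF that]]])
  have o: "sphere_int (\<lambda>w. Y k w * cnj (Y l w)) = (if k = l then complex_of_real (\<integral>w. (cmod (Y k w))\<^sup>2 \<partial>sphere_measure) else 0)"
    if "k \<in> A" "l \<in> A" for k l
  proof (cases "k = l")
    case True
    then show ?thesis by (simp add: complex_norm_square[symmetric] of_real_power[symmetric] del: of_real_power)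
  next
    case False
    then show ?thesis using sphere_int_orthogonal[OF Y[OF that(1)] harm_cnj[OF Y[OF that(2)]]] by simp
  qed
  have "complex_of_real (\<integral>w. (cmod (\<Sum>k\<in>A. a k * Y k w))\<^sup>2 \<partial>sphere_measure) = sphere_int (\<lambda>w. complex_of_real ((cmod (\<Sum>k\<in>A. a k * Y k w))\<^sup>2))"
    by (rule integral_complex_of_real[symmetric])
  also have "\<dots> = sphere_int (\<lambda>w. \<Sum>k\<in>A. \<Sum>l\<in>A. a k * cnj (a l) * (Y k w * cnj (Y l w)))"
    by (simp add: complex_norm_square sum_product mult_ac del: of_real_power)
  also have "\<dots> = (\<Sum>k\<in>A. \<Sum>l\<in>A. sphere_int (\<lambda>w. a k * cnj (a l) * (Y k w * cnj (Y l w))))"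
    by (subst Bochner_Integration.integral_sum, fastforce intro!: sphere_integrable continuous_intros cont)
       (intro sum.cong refl Bochner_Integration.integral_sum sphere_integrable continuous_intros cont)
  also have "\<dots> = (\<Sum>k\<in>A. \<Sum>l\<in>A. a k * cnj (a l) * (if k = l then complex_of_real (\<integral>w. (cmod (Y k w))\<^sup>2 \<partial>sphere_measure) else 0))"
    by (intro sum.cong refl) (simp only: integral_mult_right_zero o)
  also have "\<dots> = (\<Sum>k\<in>A. a k * cnj (a k) * complex_of_real (\<integral>w. (cmod (Y k w))\<^sup>2 \<partial>sphere_measure))"
    using A by (simp add: if_distrib sum.delta cong: if_cong)
  also have "\<dots> = complex_of_real (\<Sum>k\<in>A. (cmod (a k))\<^sup>2 * (\<integral>w. (cmod (Y k w))\<^sup>2 \<partial>sphere_measure))"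
    by (simp add: complex_norm_square[symmetric])
  finally show ?thesis by (simp only: of_real_eq_iff)
qed

text \<open>The factorial in the moment formula cancels that of the exponential series, and what is
  left is the series of \<open>phi\<close> in the squared half norm of \<xi>. Written with
  \<open>phi\<close> instead of \<open>bessel_J\<close>, the formula includes \<xi> = 0.\<close>

lemma extension_op_harm:
  fixes P :: "real^'n \<Rightarrow> complex"
  assumes P: "harm k P" and \<nu>: "\<nu> = real CARD('n) / 2 - 1"
  shows "extension_op P \<xi> = complex_of_real (2 * pi powr (real CARD('n) / 2) * phi (\<nu> + real k) ((norm \<xi> / 2)\<^sup>2)) * (- \<i> / 2) ^ k * P \<xi>"
proof -
  let ?d = "real CARD('n) / 2"
  let ?f = "\<lambda>n w. (- \<i>) ^ n / fact n * (P w * lin \<xi> w ^ n)"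
  have cP: "continuous_on S P" for S by (rule hom_poly_continuous[OF harm_hom_poly[OF P]])
  have cl: "continuous_on S (lin \<xi>)" for S by (rule hom_poly_continuous[OF hom_poly_lin])
  obtain B where B: "B > 0" "\<And>w. w \<in> sphere 0 1 \<Longrightarrow> norm (P w) \<le> B" using sphere_bounded[OF cP] by metis
  have lb: "norm (lin \<xi> w) \<le> norm \<xi>" if "w \<in> sphere 0 1" for w
    using Cauchy_Schwarz_ineq2[of w \<xi>] that by (simp add: lin_inner)
  have fb: "norm (?f n w) \<le> B * (norm \<xi> ^ n / fact n)" if "w \<in> sphere 0 1" for n w
  proof -
    have "norm (?f n w) = norm (P w) * norm (lin \<xi> w) ^ n / fact n" by (simp add: norm_mult norm_divide norm_power)
    also have "\<dots> \<le> B * norm \<xi> ^ n / fact n"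
      using B lb[OF that] that by (intro divide_right_mono mult_mono power_mono) auto
    finally show ?thesis by simp
  qed
  have se: "summable (\<lambda>n. B * (norm \<xi> ^ n / fact n))"
    by (intro summable_mult) (use summable_exp[of "norm \<xi>"] in \<open>simp add: field_simps\<close>)
  have int: "integrable sphere_measure (?f n)" for n
    by (intro sphere_integrable continuous_intros cP cl)
  \<comment> \<open>Sum and integral may be exchanged: on the sphere the scalar product with \<xi>
    is bounded by its norm, so the exponential series dominates.\<close>
  have s: "(\<lambda>n. sphere_int (?f n)) sums sphere_int (\<lambda>w. \<Sum>n. ?f n w)"
  proof (rule sums_integral[OF int])
    show "AE w in sphere_measure. summable (\<lambda>n. norm (?f n w))"
    proof (rule AE_I2)
      fix w :: "real^'n" assume "w \<in> space sphere_measure"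
      then have w: "w \<in> sphere 0 1" by simp
      show "summable (\<lambda>n. norm (?f n w))"
        by (rule summable_comparison_test'[OF se, of 0]) (use fb[OF w] in simp)
    qed
    show "summable (\<lambda>n. \<integral>w. norm (?f n w) \<partial>sphere_measure)"
    proof (rule summable_comparison_test'[OF summable_mult[OF se, of "area TYPE('n)"], of 0])
      fix n :: nat
      have "(\<integral>w. norm (?f n w) \<partial>sphere_measure) \<le> (\<integral>w. B * (norm \<xi> ^ n / fact n) \<partial>(sphere_measure :: (real^'n) measure))"
        by (intro integral_mono integrable_norm int sphere.integrable_const) (simp only: space_sphere_measure fb)
      then show "norm (\<integral>w. norm (?f n w) \<partial>sphere_measure) \<le> area TYPE('n) * (B * (norm \<xi> ^ n / fact n))"
        by (simp add: area_def abs_of_nonneg)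
    qed
  qed
  have ef: "(\<Sum>n. ?f n w) = P w * exp (- \<i> * complex_of_real (w \<bullet> \<xi>))" for w
  proof -
    have "(\<lambda>n. P w * ((- \<i> * complex_of_real (w \<bullet> \<xi>)) ^ n /\<^sub>R fact n)) sums (P w * exp (- \<i> * complex_of_real (w \<bullet> \<xi>)))"
      by (intro sums_mult exp_converges)
    moreover have "P w * ((- \<i> * complex_of_real (w \<bullet> \<xi>)) ^ n /\<^sub>R fact n) = ?f n w" for n
      by (simp only: power_mult_distrib lin_inner scaleR_conv_of_real) (simp add: divide_simps)
    ultimately have "?f n w = P w * ((- \<i> * complex_of_real (w \<bullet> \<xi>)) ^ n /\<^sub>R fact n)"
      "(\<lambda>n. ?f n w) sums (P w * exp (- \<i> * complex_of_real (w \<bullet> \<xi>)))" for n by simp_all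
    then show ?thesis by (simp only: sums_iff)
  qed
  have s1: "(\<lambda>n. sphere_int (?f n)) sums extension_op P \<xi>"
    using s unfolding ef extension_op_def .
  let ?K = "complex_of_real (2 * pi powr ?d) * (- \<i> / 2) ^ k * P \<xi>"
  have z: "sphere_int (?f n) = 0" if "n \<notin> range (\<lambda>j. k + 2 * j)" for n
    using sphere_int_harm_lin_power_eq_0[OF P, of n \<xi>] that by (simp add: image_iff)
  \<comment> \<open>Only the powers n = k + 2 j contribute, and the series is reindexed along this
    strictly increasing map.\<close>
  have "(\<lambda>j. sphere_int (?f (k + 2 * j))) sums extension_op P \<xi>"
    using s1 sums_mono_reindex[of "\<lambda>j. k + 2 * j" "\<lambda>n. sphere_int (?f n)"] z by (simp add: strict_mono_def)
  moreover have "sphere_int (?f (k + 2 * j)) = ?K * complex_of_real ((-1) ^ j * rGamma (real j + (\<nu> + real k) + 1) / fact j * ((norm \<xi> / 2)\<^sup>2) ^ j)" for j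
  proof -
    have g: "?d + real (k + j) = real j + (\<nu> + real k) + 1" by (simp add: \<nu>)
    have i: "(- \<i>) ^ (k + 2 * j) = (- \<i>) ^ k * (-1) ^ j" by (simp add: power_add power_mult)
    have n: "((norm \<xi> / 2)\<^sup>2) ^ j = norm \<xi> ^ (2 * j) / (2 ^ j * 2 ^ j)"
    proof -
      have "((norm \<xi> / 2)\<^sup>2) ^ j = (norm \<xi> / 2) ^ (2 * j)" by (rule power_mult[symmetric])
      also have "\<dots> = norm \<xi> ^ (2 * j) / 2 ^ (j + j)" unfolding power_divide mult_2 ..
      finally show ?thesis unfolding power_add .
    qed
    have "sphere_int (?f (k + 2 * j)) = (- \<i>) ^ (k + 2 * j) / fact (k + 2 * j) * sphere_int (\<lambda>w. P w * lin \<xi> w ^ (k + 2 * j))"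
      by (rule integral_mult_right_zero)
    also have "\<dots> = ?K * complex_of_real ((-1) ^ j * rGamma (real j + (\<nu> + real k) + 1) / fact j * ((norm \<xi> / 2)\<^sup>2) ^ j)"
      unfolding sphere_int_harm_lin_power[OF P] g i n power_divide[of "- \<i>" 2 k] by (simp add: power_add mult_ac)
    finally show ?thesis .
  qed
  ultimately have "(\<lambda>j. ?K * complex_of_real ((-1) ^ j * rGamma (real j + (\<nu> + real k) + 1) / fact j * ((norm \<xi> / 2)\<^sup>2) ^ j)) sums extension_op P \<xi>"
    by simp
  moreover have "(\<lambda>j. ?K * complex_of_real ((-1) ^ j * rGamma (real j + (\<nu> + real k) + 1) / fact j * ((norm \<xi> / 2)\<^sup>2) ^ j)) sums (?K * complex_of_real (phi (\<nu> + real k) ((norm \<xi> / 2)\<^sup>2)))"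
    by (intro sums_mult sums_of_real phi_sums)
  ultimately show ?thesis using sums_unique2 by fastforce
qed

section \<open>The quadratic form on finite sums of harmonics\<close>

definition ball_form :: "real \<Rightarrow> (real^'n \<Rightarrow> complex) \<Rightarrow> real" where
  "ball_form \<rho> f = 1 / \<rho> * (LINT x : ball 0 \<rho> | lborel. (cmod (extension_op f x))\<^sup>2 / (2 * pi) ^ CARD('n))"

text \<open>On a sphere of radius r the extension is a sum of harmonics whose coefficients depend on
  r alone, so the cross terms cancel before the radial integration. Each degree then leaves one
  Lommel integral.\<close>

lemma ball_form_harm_sum:
  fixes Y :: "nat \<Rightarrow> real^'n \<Rightarrow> complex"
  assumes A: "finite A" and Y: "\<And>k. k \<in> A \<Longrightarrow> harm k (Y k)" and \<rho>: "\<rho> > 0" and \<nu>: "\<nu> = real CARD('n) / 2 - 1"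
  shows "ball_form \<rho> (\<lambda>w. \<Sum>k\<in>A. Y k w) = (\<Sum>k\<in>A. Lambda k \<nu> \<rho> * (\<integral>w. (cmod (Y k w))\<^sup>2 \<partial>sphere_measure))"
proof -
  let ?d = "CARD('n)"
  define a where "a k r = complex_of_real (2 * pi powr (real ?d / 2) * phi (\<nu> + real k) ((r / 2)\<^sup>2)) * (- \<i> / 2) ^ k" for k r
  define p where "p = (\<lambda>w. \<Sum>k\<in>A. Y k w)"
  have cY: "continuous_on S (Y k)" if "k \<in> A" for k S by (rule hom_poly_continuous[OF harm_hom_poly[OF Y[OF that]]])
  have ep: "extension_op p x = (\<Sum>k\<in>A. a k (norm x) * Y k x)" for x
  proof -
    have "extension_op p x = (\<Sum>k\<in>A. extension_op (Y k) x)"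
      unfolding extension_op_def p_def sum_distrib_right
      by (intro Bochner_Integration.integral_sum sphere_integrable continuous_intros cY)
    then show ?thesis by (simp add: extension_op_harm[OF Y \<nu>] a_def cong: sum.cong)
  qed
  define F where "F x = indicator (ball 0 \<rho>) x *\<^sub>R ((cmod (extension_op p x))\<^sup>2 / (2 * pi) ^ ?d)" for x :: "real^'n"
  have intF: "integrable lborel F"
  proof -
    have "continuous_on UNIV (\<lambda>x. (cmod (extension_op p x))\<^sup>2 / (2 * pi) ^ ?d)"
      unfolding ep a_def
      by (intro continuous_intros cY continuous_on_compose2[OF phi_continuous[of UNIV]]) auto
    then have "set_integrable lborel (cball 0 \<rho>) (\<lambda>x. (cmod (extension_op p x))\<^sup>2 / (2 * pi) ^ ?d)"
      unfolding set_integrable_def by (intro borel_integrable_compact) (auto intro: continuous_on_subset)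
    then have "set_integrable lborel (ball 0 \<rho>) (\<lambda>x. (cmod (extension_op p x))\<^sup>2 / (2 * pi) ^ ?d)"
      by (rule set_integrable_subset) auto
    then show ?thesis unfolding set_integrable_def F_def[abs_def] .
  qed
  define E where "E k = (\<integral>w. (cmod (Y k w))\<^sup>2 \<partial>sphere_measure)" for k
  let ?g = "\<lambda>k r. indicator {0..\<rho>} r * (2 * (r / 2) ^ (?d + 2 * k - 1) * (phi (\<nu> + real k) ((r / 2)\<^sup>2))\<^sup>2)"
  \<comment> \<open>The identity is stated for every real r, where r w has norm |r|; hence the
    symmetric interval. The radial density discards negative r afterwards.\<close>
  have inner: "(\<integral>w. F (r *\<^sub>R w) \<partial>sphere_measure) = (\<Sum>k\<in>A. indicator {-\<rho><..<\<rho>} r * ((cmod (a k r))\<^sup>2 * r ^ (2 * k) / (2 * pi) ^ ?d) * E k)" for r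
  proof -
    have "(\<integral>w. F (r *\<^sub>R w) \<partial>sphere_measure) = (\<integral>w. indicator {-\<rho><..<\<rho>} r / (2 * pi) ^ ?d * (cmod (\<Sum>k\<in>A. (a k r * complex_of_real r ^ k) * Y k w))\<^sup>2 \<partial>sphere_measure)"
    proof (rule Bochner_Integration.integral_cong[OF refl])
      fix w :: "real^'n" assume "w \<in> space sphere_measure"
      then have w: "norm w = 1" by simp
      have "extension_op p (r *\<^sub>R w) = (\<Sum>k\<in>A. (a k r * complex_of_real r ^ k) * Y k w)"
        unfolding ep by (intro sum.cong refl) (simp add: hom_poly_scaleR[OF harm_hom_poly[OF Y]] a_def w power_divide)
      then show "F (r *\<^sub>R w) = indicator {-\<rho><..<\<rho>} r / (2 * pi) ^ ?d * (cmod (\<Sum>k\<in>A. (a k r * complex_of_real r ^ k) * Y k w))\<^sup>2"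
        unfolding F_def by (auto simp: indicator_def w)
    qed
    also have "\<dots> = indicator {-\<rho><..<\<rho>} r / (2 * pi) ^ ?d * (\<Sum>k\<in>A. (cmod (a k r * complex_of_real r ^ k))\<^sup>2 * E k)"
      unfolding E_def by (simp only: integral_mult_right_zero sphere_pythagoras[OF A Y])
    also have "\<dots> = (\<Sum>k\<in>A. indicator {-\<rho><..<\<rho>} r * ((cmod (a k r))\<^sup>2 * r ^ (2 * k) / (2 * pi) ^ ?d) * E k)"
      unfolding sum_distrib_left
      by (intro sum.cong refl) (simp add: norm_mult norm_power power_mult_distrib power_even_abs power_mult[symmetric] mult.commute[of 2])
    finally show ?thesis .
  qed
  have ca [measurable]: "a k \<in> borel_measurable borel" for k
    unfolding a_def[abs_def] by (intro borel_measurable_continuous_onI continuous_intros continuous_on_compose2[OF phi_continuous[of UNIV]]) auto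
  have "integral\<^sup>L lborel F = (\<integral>r. (\<Sum>k\<in>A. indicator {-\<rho><..<\<rho>} r * ((cmod (a k r))\<^sup>2 * r ^ (2 * k) / (2 * pi) ^ ?d) * E k) \<partial>radial ?d)"
    unfolding polar_integral[OF intF] inner ..
  also have "\<dots> = (\<integral>r. (indicator {0..} r * r ^ (?d - 1)) *\<^sub>R (\<Sum>k\<in>A. indicator {-\<rho><..<\<rho>} r * ((cmod (a k r))\<^sup>2 * r ^ (2 * k) / (2 * pi) ^ ?d) * E k) \<partial>lborel)"
    by (rule integral_radial) measurable
  also have "\<dots> = (\<integral>r. (\<Sum>k\<in>A. ?g k r * E k) \<partial>lborel)"
  proof (rule integral_cong_AE)
    \<comment> \<open>The ball is open while the Lommel integral runs over a closed interval; they
      differ at this one radius.\<close>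
    have "AE r in lborel. r \<noteq> \<rho>" by (rule AE_lborel_singleton)
    then show "AE r in lborel. (indicator {0..} r * r ^ (?d - 1)) *\<^sub>R (\<Sum>k\<in>A. indicator {-\<rho><..<\<rho>} r * ((cmod (a k r))\<^sup>2 * r ^ (2 * k) / (2 * pi) ^ ?d) * E k) = (\<Sum>k\<in>A. ?g k r * E k)"
    proof eventually_elim
      fix r assume r: "r \<noteq> \<rho>"
      have h: "indicator {0..} r * r ^ (?d - 1) * (indicator {-\<rho><..<\<rho>} r * ((cmod (a k r))\<^sup>2 * r ^ (2 * k) / (2 * pi) ^ ?d)) = ?g k r" for k
      proof -
        have pp: "(pi powr (real ?d / 2))\<^sup>2 = pi ^ ?d" by (simp add: powr_realpow[symmetric] powr_powr power2_eq_square powr_add[symmetric])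
        \<comment> \<open>The normalization leaves (2 pi^(d/2))^2 / (2 pi)^d = 4 / 2^d. Together
          with the 2^(2 k) of this line, the powers of two pair with those of r to 2 (r/2)^(d + 2 k
          - 1).\<close>
        have "(cmod (a k r))\<^sup>2 = 4 * pi ^ ?d * (phi (\<nu> + real k) ((r / 2)\<^sup>2))\<^sup>2 / 2 ^ (2 * k)"
          unfolding a_def by (simp add: norm_mult norm_power norm_divide power_mult_distrib pp power_divide power_mult[symmetric] mult.commute[of 2])
        then have e1: "(cmod (a k r))\<^sup>2 * r ^ (2 * k) / (2 * pi) ^ ?d = 4 * (phi (\<nu> + real k) ((r / 2)\<^sup>2))\<^sup>2 * r ^ (2 * k) / (2 ^ (2 * k) * 2 ^ ?d)"
          by (simp add: power_mult_distrib)
        have e2: "r ^ (?d - 1) * (4 * (phi (\<nu> + real k) ((r / 2)\<^sup>2))\<^sup>2 * r ^ (2 * k) / (2 ^ (2 * k) * 2 ^ ?d))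
           = 2 * (r / 2) ^ (?d + 2 * k - 1) * (phi (\<nu> + real k) ((r / 2)\<^sup>2))\<^sup>2"
        proof -
          obtain m where m: "?d = Suc m" by (metis Suc_pred' zero_less_card_finite)
          show ?thesis unfolding m by (simp add: power_add power_divide)
        qed
        have e3: "indicator {0..} r * (indicator {-\<rho><..<\<rho>} r :: real) = indicator {0..\<rho>} r" using r \<rho> by (auto simp: indicator_def)
        have "indicator {0..} r * r ^ (?d - 1) * (indicator {-\<rho><..<\<rho>} r * ((cmod (a k r))\<^sup>2 * r ^ (2 * k) / (2 * pi) ^ ?d))
          = (indicator {0..} r * indicator {-\<rho><..<\<rho>} r) * (r ^ (?d - 1) * ((cmod (a k r))\<^sup>2 * r ^ (2 * k) / (2 * pi) ^ ?d))"
          by (simp only: mult_ac)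
        then show ?thesis unfolding e1 e2 e3 .
      qed
      show "(indicator {0..} r * r ^ (?d - 1)) *\<^sub>R (\<Sum>k\<in>A. indicator {-\<rho><..<\<rho>} r * ((cmod (a k r))\<^sup>2 * r ^ (2 * k) / (2 * pi) ^ ?d) * E k) = (\<Sum>k\<in>A. ?g k r * E k)"
        unfolding real_scaleR_def sum_distrib_left
      proof (intro sum.cong refl)
        fix k
        show "indicator {0..} r * r ^ (?d - 1) * (indicator {-\<rho><..<\<rho>} r * ((cmod (a k r))\<^sup>2 * r ^ (2 * k) / (2 * pi) ^ ?d) * E k) = ?g k r * E k"
          unfolding h[symmetric] by (simp only: mult.assoc)
      qed
    qed
  next
    show "(\<lambda>r. (indicator {0..} r * r ^ (?d - 1)) *\<^sub>R (\<Sum>k\<in>A. indicator {-\<rho><..<\<rho>} r * ((cmod (a k r))\<^sup>2 * r ^ (2 * k) / (2 * pi) ^ ?d) * E k)) \<in> borel_measurable lborel"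
      by measurable
    have "(\<lambda>r. (phi (\<nu> + real k) ((r / 2)\<^sup>2))\<^sup>2) \<in> borel_measurable borel" for k
      by (intro borel_measurable_continuous_onI continuous_intros continuous_on_compose2[OF phi_continuous[of UNIV]]) auto
    then show "(\<lambda>r. \<Sum>k\<in>A. ?g k r * E k) \<in> borel_measurable lborel" by measurable
  qed
  also have "\<dots> = (\<Sum>k\<in>A. \<rho> * Lambda k \<nu> \<rho> * E k)"
  proof -
    have "has_bochner_integral lborel (?g k) (\<rho> * Lambda k \<nu> \<rho>)" for k
      by (rule radial_integral[OF \<rho>]) (simp_all add: \<nu>)
    then have "has_bochner_integral lborel (\<lambda>r. \<Sum>k\<in>A. ?g k r * E k) (\<Sum>k\<in>A. \<rho> * Lambda k \<nu> \<rho> * E k)"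
      by (intro has_bochner_integral_sum has_bochner_integral_mult_left)
    then show ?thesis by (rule has_bochner_integral_integral_eq)
  qed
  finally have "integral\<^sup>L lborel F = (\<Sum>k\<in>A. \<rho> * Lambda k \<nu> \<rho> * E k)" .
  then have "ball_form \<rho> p = 1 / \<rho> * (\<Sum>k\<in>A. \<rho> * Lambda k \<nu> \<rho> * E k)"
    unfolding ball_form_def set_lebesgue_integral_def F_def by simp
  also have "\<dots> = (\<Sum>k\<in>A. Lambda k \<nu> \<rho> * E k)" using \<rho> by (simp add: sum_distrib_left)
  finally show ?thesis by (simp add: p_def E_def)
qed

section \<open>Density of spherical harmonics\<close>

lemma cmod_add_sq: "(cmod (a + b))\<^sup>2 \<le> 2 * (cmod a)\<^sup>2 + 2 * (cmod b)\<^sup>2"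
proof -
  have "(cmod (a + b))\<^sup>2 \<le> (cmod a + cmod b)\<^sup>2" by (intro power_mono norm_triangle_ineq) simp
  also have "\<dots> \<le> 2 * (cmod a)\<^sup>2 + 2 * (cmod b)\<^sup>2"
    using sum_squares_bound[of "cmod a" "cmod b"] by (simp add: power2_sum)
  finally show ?thesis .
qed

section \<open>Square integrable functions and sums of harmonics\<close>

lemma L2_meas: "f \<in> L2_sphere \<Longrightarrow> f \<in> borel_measurable sphere_measure"
  and L2_int: "f \<in> L2_sphere \<Longrightarrow> integrable sphere_measure (\<lambda>w. (cmod (f w))\<^sup>2)"
  by (simp_all add: L2_sphere_def)

lemma L2_bound:
  fixes f :: "real^'n \<Rightarrow> complex"
  assumes "f \<in> borel_measurable sphere_measure" "integrable sphere_measure g" "\<And>w. w \<in> sphere 0 1 \<Longrightarrow> (cmod (f w))\<^sup>2 \<le> g w"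
  shows "f \<in> L2_sphere"
  unfolding L2_sphere_def
proof (intro CollectI conjI assms(1))
  show "integrable sphere_measure (\<lambda>w. (cmod (f w))\<^sup>2)"
    using assms(1)
    by (intro Bochner_Integration.integrable_bound[OF assms(2)] AE_I2)
       (simp, simp, metis abs_ge_self assms(3) mem_sphere_0 order_trans)
qed

lemma L2_add: "f \<in> L2_sphere \<Longrightarrow> g \<in> L2_sphere \<Longrightarrow> (\<lambda>w. f w + g w) \<in> L2_sphere"
  by (rule L2_bound[where g = "\<lambda>w. 2 * (cmod (f w))\<^sup>2 + 2 * (cmod (g w))\<^sup>2"])
     (auto intro!: cmod_add_sq L2_int borel_measurable_add intro: L2_meas)

lemma L2_cmult: "f \<in> L2_sphere \<Longrightarrow> (\<lambda>w. c * f w) \<in> L2_sphere"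
  by (rule L2_bound[where g = "\<lambda>w. (cmod c)\<^sup>2 * (cmod (f w))\<^sup>2"])
     (auto intro!: L2_int dest: L2_meas simp: norm_mult power_mult_distrib)

lemma L2_diff: "f \<in> L2_sphere \<Longrightarrow> g \<in> L2_sphere \<Longrightarrow> (\<lambda>w. f w - g w) \<in> L2_sphere"
  using L2_add[OF _ L2_cmult[of g "-1"]] by simp

lemma L2_continuous: "continuous_on (sphere 0 1) f \<Longrightarrow> f \<in> L2_sphere"
  unfolding L2_sphere_def by (auto intro!: sphere_measurable sphere_integrable continuous_intros)

lemma L2_norm_sq_nonneg: "L2_norm_sq f \<ge> 0" by (simp add: L2_norm_sq_def)

lemma L2_norm_sq_add:
  assumes "f \<in> L2_sphere" "g \<in> L2_sphere"
  shows "L2_norm_sq (\<lambda>w. f w + g w) \<le> 2 * L2_norm_sq f + 2 * L2_norm_sq g"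
proof -
  have "L2_norm_sq (\<lambda>w. f w + g w) \<le> (\<integral>w. 2 * (cmod (f w))\<^sup>2 + 2 * (cmod (g w))\<^sup>2 \<partial>sphere_measure)"
    unfolding L2_norm_sq_def using L2_int[OF L2_add[OF assms]] L2_int[OF assms(1)] L2_int[OF assms(2)]
    by (intro integral_mono cmod_add_sq) auto
  then show ?thesis unfolding L2_norm_sq_def using L2_int[OF assms(1)] L2_int[OF assms(2)] by simp
qed

lemma L2_norm_sq_cmult: "L2_norm_sq (\<lambda>w. c * f w) = (cmod c)\<^sup>2 * L2_norm_sq f"
  by (simp add: L2_norm_sq_def norm_mult power_mult_distrib)

definition harm_sum :: "(real^'n \<Rightarrow> complex) \<Rightarrow> bool" where
  "harm_sum p \<longleftrightarrow> (\<exists>N Y. (\<forall>k. harm k (Y k)) \<and> (\<forall>w\<in>sphere 0 1. p w = (\<Sum>k<(N::nat). Y k w)))"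

lemma harm_zero [simp]: "harm k (\<lambda>x. 0)" by (simp add: harm_def hom_poly_zero)

lemma harm_add: "harm k P \<Longrightarrow> harm k Q \<Longrightarrow> harm k (\<lambda>x. P x + Q x)"
  unfolding harm_def using lap_add[of k P k Q] by (auto intro: hom_poly_add)

lemma harm_cmult: "harm k P \<Longrightarrow> harm k (\<lambda>x. c * P x)"
  unfolding harm_def using lap_cmult[of k P c] by (auto intro: hom_poly_cmult)

lemma harm_sum_harm:
  assumes "harm k P" shows "harm_sum P"
  unfolding harm_sum_def
  by (rule exI[of _ "Suc k"], rule exI[of _ "\<lambda>j. if j = k then P else (\<lambda>x. 0)"])
     (use assms in \<open>auto simp: sum.delta if_distrib[of "\<lambda>f. f _"] cong: if_cong\<close>)

lemma harm_sum_add: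
  fixes p q :: "real^'n \<Rightarrow> complex"
  assumes "harm_sum p" "harm_sum q" shows "harm_sum (\<lambda>x. p x + q x)"
proof -
  obtain N Y where p: "\<And>k. harm k (Y k)" "\<And>w. w \<in> sphere 0 1 \<Longrightarrow> p w = (\<Sum>k<(N::nat). Y k w)"
    using assms(1) unfolding harm_sum_def by metis
  obtain M Z where q: "\<And>k. harm k (Z k)" "\<And>w. w \<in> sphere 0 1 \<Longrightarrow> q w = (\<Sum>k<(M::nat). Z k w)"
    using assms(2) unfolding harm_sum_def by metis
  define X where "X k = (\<lambda>x. (if k < N then Y k x else 0) + (if k < M then Z k x else 0))" for k
  have "harm k (X k)" for k
    unfolding X_def by (intro harm_add) (cases "k < N"; cases "k < M"; simp add: p q)+
  moreover have "p w + q w = (\<Sum>k<max N M. X k w)" if "w \<in> sphere 0 1" for w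
    unfolding p(2)[OF that] q(2)[OF that] X_def sum.distrib
    by (intro arg_cong2[of _ _ _ _ "(+)"] sum.mono_neutral_cong_left) auto
  ultimately show ?thesis unfolding harm_sum_def by (intro exI[of _ "max N M"] exI[of _ X]) simp
qed

lemma harm_sum_cmult:
  assumes "harm_sum p" shows "harm_sum (\<lambda>x. c * p x)"
proof -
  obtain N Y where p: "\<And>k. harm k (Y k)" "\<And>w. w \<in> sphere 0 1 \<Longrightarrow> p w = (\<Sum>k<(N::nat). Y k w)"
    using assms unfolding harm_sum_def by metis
  then show ?thesis unfolding harm_sum_def
    by (intro exI[of _ N] exI[of _ "\<lambda>k x. c * Y k x"]) (simp add: harm_cmult sum_distrib_left)
qed

lemma harm_sum_sum: "finite A \<Longrightarrow> (\<And>a. a \<in> A \<Longrightarrow> harm_sum (p a)) \<Longrightarrow> harm_sum (\<lambda>x. \<Sum>a\<in>A. p a x)"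
  by (induction A rule: finite_induct) (auto intro: harm_sum_add harm_sum_harm[OF harm_zero[of 0]])

lemma harm_sum_cong: "harm_sum p \<Longrightarrow> (\<And>w. w \<in> sphere 0 1 \<Longrightarrow> p w = q w) \<Longrightarrow> harm_sum q"
  unfolding harm_sum_def by metis

text \<open>On the sphere all powers of \<open>sqnorm\<close> in the harmonic decomposition equal
  1.\<close>

lemma hom_poly_harm_sum:
  assumes "hom_poly m Q" shows "harm_sum Q"
proof -
  from hom_poly_decomposition[OF assms] obtain H where
    HH: "(\<forall>j. 2 * j \<le> m \<longrightarrow> harm (m - 2 * j) (H j)) \<and> Q = (\<lambda>x. \<Sum>j\<in>{j. 2 * j \<le> m}. sqnorm x ^ j * H j x)" ..
  have "harm_sum (\<lambda>x. \<Sum>j\<in>{j. 2 * j \<le> m}. H j x)"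
  proof (rule harm_sum_sum)
    show "finite {j. 2 * j \<le> m}" by (rule finite_subset[of _ "{..m}"]) auto
    show "harm_sum (H j)" if "j \<in> {j. 2 * j \<le> m}" for j
      using HH that by (intro harm_sum_harm[of "m - 2 * j"]) simp
  qed
  then show ?thesis
  proof (rule harm_sum_cong)
    fix w :: "real^'a" assume "w \<in> sphere 0 1"
    then have "sqnorm w = 1" by (simp add: sqnorm_norm)
    moreover have "Q w = (\<Sum>j\<in>{j. 2 * j \<le> m}. sqnorm w ^ j * H j w)" by (rule fun_cong[OF conjunct2[OF HH]])
    ultimately show "(\<Sum>j\<in>{j. 2 * j \<le> m}. H j w) = Q w" by simp
  qed
qed

text \<open>Homogeneous polynomials do not add across degrees. This closure under sums, which is
  then also closed under products, receives the \<open>real_polynomial_function\<close> that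
  Stone-Weierstrass supplies.\<close>

inductive poly_fun :: "(real^'n \<Rightarrow> complex) \<Rightarrow> bool" where
  poly_fun_hom_poly: "hom_poly k P \<Longrightarrow> poly_fun P"
| poly_fun_add: "poly_fun P \<Longrightarrow> poly_fun Q \<Longrightarrow> poly_fun (\<lambda>x. P x + Q x)"

lemma poly_fun_mult:
  assumes "poly_fun P" "poly_fun Q" shows "poly_fun (\<lambda>x. P x * Q x)"
  using assms(1)
proof induction
  case (poly_fun_hom_poly k P)
  show ?case using assms(2)
  proof induction
    case (poly_fun_hom_poly l Q)
    show ?case by (rule poly_fun.poly_fun_hom_poly[OF hom_poly_mult[OF \<open>hom_poly k P\<close> \<open>hom_poly l Q\<close>]])
  next
    case (poly_fun_add Q R)
    from poly_fun.poly_fun_add[OF this(3,4)] show ?case by (simp add: distrib_left)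
  qed
next
  case (poly_fun_add P R)
  from poly_fun.poly_fun_add[OF this(3,4)] show ?case by (simp add: distrib_right)
qed

lemma poly_fun_harm_sum: "poly_fun P \<Longrightarrow> harm_sum P"
  by (induction rule: poly_fun.induct) (auto intro: hom_poly_harm_sum harm_sum_add)

lemma poly_fun_real_polynomial:
  fixes g :: "real^'n \<Rightarrow> real"
  assumes "real_polynomial_function g" shows "poly_fun (\<lambda>x. complex_of_real (g x))"
  using assms
proof induction
  case (linear f)
  interpret bounded_linear f by fact
  have "(\<lambda>x. complex_of_real (f x)) = (\<lambda>x. \<Sum>i\<in>UNIV. complex_of_real (f (axis i 1)) * complex_of_real (x $ i))"
  proof
    fix x
    have "f x = f (\<Sum>i\<in>UNIV. x $ i *\<^sub>R axis i 1)" by (simp add: basis_expansion flip: scalar_mult_eq_scaleR)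
    also have "\<dots> = (\<Sum>i\<in>UNIV. f (axis i 1) * x $ i)" by (simp add: sum scaleR mult.commute)
    finally show "complex_of_real (f x) = (\<Sum>i\<in>UNIV. complex_of_real (f (axis i 1)) * complex_of_real (x $ i))" by simp
  qed
  moreover have "poly_fun (\<lambda>x. \<Sum>i\<in>UNIV. complex_of_real (f (axis i 1)) * complex_of_real (x $ i))"
    by (rule poly_fun_hom_poly, rule hom_poly_sum, rule hom_poly_cmult, rule hom_poly_x)
  ultimately show ?case by (simp only:)
next
  case (mult f g)
  from poly_fun_mult[OF mult.IH] show ?case by simp
next
  case (add f g)
  from poly_fun_add[OF add.IH] show ?case by simp
qed (auto intro: poly_fun_hom_poly hom_poly_const)

lemma harm_sum_continuous: assumes "harm_sum p" shows "continuous_on (sphere 0 1) p"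
proof -
  obtain N Y where p: "\<And>k. harm k (Y k)" "\<And>w. w \<in> sphere 0 1 \<Longrightarrow> p w = (\<Sum>k<(N::nat). Y k w)"
    using assms unfolding harm_sum_def by metis
  have "continuous_on (sphere 0 1) (\<lambda>w. \<Sum>k<N. Y k w)"
    by (intro continuous_intros hom_poly_continuous[OF harm_hom_poly[OF p(1)]])
  then show ?thesis by (rule continuous_on_eq) (simp add: p(2))
qed

section \<open>Approximation, from continuous functions to all of L2\<close>

definition approximable :: "(real^'n \<Rightarrow> complex) \<Rightarrow> bool" where
  "approximable f \<longleftrightarrow> f \<in> L2_sphere \<and> (\<forall>e>0. \<exists>p. harm_sum p \<and> L2_norm_sq (\<lambda>w. f w - p w) < e)"

lemma harm_sum_L2: "harm_sum p \<Longrightarrow> p \<in> L2_sphere"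
  by (intro L2_continuous harm_sum_continuous)

lemma approximable_lim:
  fixes f :: "real^'n \<Rightarrow> complex"
  assumes f: "f \<in> L2_sphere" and "\<And>e. e > 0 \<Longrightarrow> \<exists>g. approximable g \<and> L2_norm_sq (\<lambda>w. f w - g w) < e"
  shows "approximable f"
  unfolding approximable_def
proof (intro conjI f allI impI)
  fix e :: real assume "e > 0"
  \<comment> \<open>A quarter, because the squared triangle inequality costs a factor 2 on each of
    the two errors.\<close>
  then obtain g where g: "approximable g" "L2_norm_sq (\<lambda>w. f w - g w) < e / 4" using assms(2)[of "e / 4"] by auto
  then obtain p where p: "harm_sum p" "L2_norm_sq (\<lambda>w. g w - p w) < e / 4"
    unfolding approximable_def using \<open>e > 0\<close> by (metis zero_less_divide_iff zero_less_numeral)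
  have "g \<in> L2_sphere" using g by (simp add: approximable_def)
  then have "L2_norm_sq (\<lambda>w. (f w - g w) + (g w - p w)) \<le> 2 * L2_norm_sq (\<lambda>w. f w - g w) + 2 * L2_norm_sq (\<lambda>w. g w - p w)"
    by (intro L2_norm_sq_add L2_diff f harm_sum_L2[OF p(1)])
  then have "L2_norm_sq (\<lambda>w. f w - p w) < e" using g(2) p(2) by simp
  then show "\<exists>p. harm_sum p \<and> L2_norm_sq (\<lambda>w. f w - p w) < e" using p(1) by blast
qed

lemma approximable_add:
  assumes "approximable f" "approximable g" shows "approximable (\<lambda>w. f w + g w)"
  unfolding approximable_def
proof (intro conjI allI impI)
  have fg: "f \<in> L2_sphere" "g \<in> L2_sphere" using assms by (simp_all add: approximable_def)
  then show "(\<lambda>w. f w + g w) \<in> L2_sphere" by (rule L2_add)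
  fix e :: real assume "e > 0"
  then have e: "e / 4 > 0" by simp
  obtain p where p: "harm_sum p" "L2_norm_sq (\<lambda>w. f w - p w) < e / 4" using assms(1) e unfolding approximable_def by metis
  obtain q where q: "harm_sum q" "L2_norm_sq (\<lambda>w. g w - q w) < e / 4" using assms(2) e unfolding approximable_def by metis
  have "L2_norm_sq (\<lambda>w. (f w - p w) + (g w - q w)) \<le> 2 * L2_norm_sq (\<lambda>w. f w - p w) + 2 * L2_norm_sq (\<lambda>w. g w - q w)"
    by (intro L2_norm_sq_add L2_diff fg harm_sum_L2[OF p(1)] harm_sum_L2[OF q(1)])
  moreover have "(\<lambda>w. (f w - p w) + (g w - q w)) = (\<lambda>w. (f w + g w) - (p w + q w))" by (simp add: fun_eq_iff)
  ultimately have "L2_norm_sq (\<lambda>w. (f w + g w) - (p w + q w)) < e" using p q by simp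
  then show "\<exists>p. harm_sum p \<and> L2_norm_sq (\<lambda>w. (f w + g w) - p w) < e"
    using harm_sum_add[OF p(1) q(1)] by blast
qed

lemma approximable_cmult:
  assumes "approximable f" shows "approximable (\<lambda>w. c * f w)"
  unfolding approximable_def
proof (intro conjI allI impI)
  show "(\<lambda>w. c * f w) \<in> L2_sphere" using assms by (intro L2_cmult) (simp add: approximable_def)
  fix e :: real assume "e > 0"
  define d where "d = e / ((cmod c)\<^sup>2 + 1)"
  have pos: "(cmod c)\<^sup>2 + 1 > 0" by (simp add: add_nonneg_pos)
  then have "d > 0" using \<open>e > 0\<close> by (simp add: d_def)
  then obtain p where p: "harm_sum p" "L2_norm_sq (\<lambda>w. f w - p w) < d" using assms unfolding approximable_def by metis
  have "L2_norm_sq (\<lambda>w. c * f w - c * p w) = (cmod c)\<^sup>2 * L2_norm_sq (\<lambda>w. f w - p w)"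
    unfolding L2_norm_sq_cmult[symmetric] by (simp add: right_diff_distrib)
  also have "\<dots> \<le> (cmod c)\<^sup>2 * d" using p(2) by (intro mult_left_mono) auto
  also have "\<dots> < ((cmod c)\<^sup>2 + 1) * d" using \<open>d > 0\<close> by simp
  also have "\<dots> = e" using pos by (simp add: d_def)
  finally show "\<exists>p. harm_sum p \<and> L2_norm_sq (\<lambda>w. c * f w - p w) < e" using harm_sum_cmult[OF p(1)] by blast
qed

lemma approximable_of_real_continuous:
  fixes f :: "real^'n \<Rightarrow> real"
  assumes f: "continuous_on (sphere 0 1) f" shows "approximable (\<lambda>w. complex_of_real (f w))"
  unfolding approximable_def
proof (intro conjI allI impI)
  show L: "(\<lambda>w. complex_of_real (f w)) \<in> L2_sphere" by (intro L2_continuous continuous_intros f)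
  fix e :: real assume "e > 0"
  \<comment> \<open>Chosen so that the area times d^2 is e / 2.\<close>
  define d where "d = sqrt (e / (2 * area TYPE('n)))"
  have d: "d > 0" using \<open>e > 0\<close> area_pos[where 'n = 'n] by (simp add: d_def)
  obtain g where g: "real_polynomial_function g" "\<And>x. x \<in> sphere 0 1 \<Longrightarrow> \<bar>f x - g x\<bar> < d"
    using Stone_Weierstrass_real_polynomial_function[OF compact_sphere f d] by metis
  let ?p = "\<lambda>w. complex_of_real (g w)"
  have p: "harm_sum ?p" by (intro poly_fun_harm_sum poly_fun_real_polynomial g)
  have "L2_norm_sq (\<lambda>w. complex_of_real (f w) - ?p w) \<le> (\<integral>w. d\<^sup>2 \<partial>(sphere_measure :: (real^'n) measure))"
    unfolding L2_norm_sq_def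
  proof (rule integral_mono)
    show "integrable sphere_measure (\<lambda>w. (cmod (complex_of_real (f w) - ?p w))\<^sup>2)"
      by (intro L2_int L2_diff L harm_sum_L2[OF p])
    fix w :: "real^'n" assume "w \<in> space sphere_measure"
    then have "\<bar>f w - g w\<bar> < d" using g(2) by simp
    then show "(cmod (complex_of_real (f w) - ?p w))\<^sup>2 \<le> d\<^sup>2"
      by (intro power_mono) (simp_all flip: of_real_diff)
  qed simp
  also have "\<dots> = area TYPE('n) * d\<^sup>2" by (simp add: area_def)
  also have "\<dots> < e" using \<open>e > 0\<close> area_pos[where 'n = 'n] by (simp add: d_def)
  finally show "\<exists>p. harm_sum p \<and> L2_norm_sq (\<lambda>w. complex_of_real (f w) - p w) < e" using p by blast
qed

text \<open>Dominated convergence for |f - s_i|^2 \<le> 4 b. This one limit argument serves closed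
  sets, countable disjoint unions and increasing sequences.\<close>

lemma approximable_pointwise_limit:
  fixes f :: "real^'n \<Rightarrow> complex"
  assumes s: "\<And>i. approximable (s i)" and lim: "\<And>w. w \<in> sphere 0 1 \<Longrightarrow> (\<lambda>i. s i w) \<longlonglongrightarrow> f w"
    and b: "integrable sphere_measure b" "\<And>i w. w \<in> sphere 0 1 \<Longrightarrow> (cmod (s i w))\<^sup>2 \<le> b w"
  shows "approximable f"
proof (rule approximable_lim)
  have sL: "s i \<in> L2_sphere" for i using s by (simp add: approximable_def)
  have fm: "f \<in> borel_measurable sphere_measure"
    by (rule borel_measurable_LIMSEQ_metric[OF L2_meas[OF sL] lim]) simp
  have fb: "(cmod (f w))\<^sup>2 \<le> b w" if "w \<in> sphere 0 1" for w
    by (rule LIMSEQ_le_const2[of "\<lambda>i. (cmod (s i w))\<^sup>2"]) (use that in \<open>auto intro!: tendsto_intros lim b(2)\<close>)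
  show fL: "f \<in> L2_sphere" by (rule L2_bound[OF fm b(1) fb])
  have "(\<lambda>i. \<integral>w. (cmod (f w - s i w))\<^sup>2 \<partial>sphere_measure) \<longlonglongrightarrow> (\<integral>w. 0 \<partial>(sphere_measure :: (real^'n) measure))"
  proof (rule integral_dominated_convergence[where w = "\<lambda>w. 4 * b w"])
    show "(\<lambda>w. (cmod (f w - s i w))\<^sup>2) \<in> borel_measurable sphere_measure" for i
      using fm L2_meas[OF sL[of i]] by measurable
    show "AE w in sphere_measure. (\<lambda>i. (cmod (f w - s i w))\<^sup>2) \<longlonglongrightarrow> 0"
    proof (rule AE_I2)
      fix w :: "real^'n" assume "w \<in> space sphere_measure"
      then have "(\<lambda>i. (cmod (f w - s i w))\<^sup>2) \<longlonglongrightarrow> (cmod (f w - f w))\<^sup>2" by (intro tendsto_intros lim) simp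
      then show "(\<lambda>i. (cmod (f w - s i w))\<^sup>2) \<longlonglongrightarrow> 0" by simp
    qed
    show "AE w in sphere_measure. norm ((cmod (f w - s i w))\<^sup>2) \<le> 4 * b w" for i
    proof (rule AE_I2)
      fix w :: "real^'n" assume "w \<in> space sphere_measure"
      then have w: "w \<in> sphere 0 1" by simp
      show "norm ((cmod (f w - s i w))\<^sup>2) \<le> 4 * b w"
        using cmod_add_sq[of "f w" "- s i w"] fb[OF w] b(2)[OF w, of i] by simp
    qed
  qed (use b(1) in auto)
  then have "(\<lambda>i. L2_norm_sq (\<lambda>w. f w - s i w)) \<longlonglongrightarrow> 0" by (simp add: L2_norm_sq_def)
  then have "\<forall>\<^sub>F i in sequentially. L2_norm_sq (\<lambda>w. f w - s i w) < e" if "e > 0" for e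
    using order_tendstoD(2) that by blast
  then show "\<exists>g. approximable g \<and> L2_norm_sq (\<lambda>w. f w - g w) < e" if "e > 0" for e
    using s that eventually_happens'[OF sequentially_bot] by blast
qed

lemma approximable_sum:
  "finite I \<Longrightarrow> (\<And>i. i \<in> I \<Longrightarrow> approximable (f i)) \<Longrightarrow> approximable (\<lambda>w. \<Sum>i\<in>I. f i w)"
proof (induction I rule: finite_induct)
  case empty
  then show ?case using approximable_of_real_continuous[of "\<lambda>_. 0"] by simp
next
  case (insert i I)
  have "approximable (\<lambda>w. f i w + (\<Sum>i\<in>I. f i w))" by (rule approximable_add) (use insert in auto)
  then show ?case using insert.hyps by simp
qed

text \<open>Closed sets are stable under intersection and generate the Borel sets, so complements
  and disjoint unions suffice. A nonempty closed set is reached through the continuous functions max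
  0 (1 - i dist).\<close>

lemma approximable_indicator:
  fixes A :: "(real^'n) set"
  assumes "A \<in> sets borel" shows "approximable (\<lambda>w. complex_of_real (indicator A w))"
proof -
  have A: "A \<in> sigma_sets UNIV (Collect closed)" using assms by (simp add: borel_eq_closed)
  have sub: "Collect closed \<subseteq> Pow (UNIV :: (real^'n) set)" by simp
  have stable: "Int_stable (Collect closed :: (real^'n) set set)" by (auto simp: Int_stable_def)
  show ?thesis
    using stable sub A
  proof (induction rule: sigma_sets_induct_disjoint)
    case (basic F)
    then have F: "closed F" by simp
    show ?case
    proof (cases "F = {}")
      \<comment> \<open>\<open>infdist\<close> to the empty set is 0, so the approximating functions
        used for nonempty F would all be 1 here.\<close>
      case True
      then show ?thesis using approximable_of_real_continuous[of "\<lambda>_. 0"] by simp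
    next
      case False
      define s where "s i w = max 0 (1 - real i * infdist w F)" for i w
      show ?thesis
      proof (rule approximable_pointwise_limit[where s = "\<lambda>i w. complex_of_real (s i w)" and b = "\<lambda>w. 1"])
        show "approximable (\<lambda>w. complex_of_real (s i w))" for i
          unfolding s_def by (intro approximable_of_real_continuous continuous_intros)
        show "(cmod (complex_of_real (s i w)))\<^sup>2 \<le> 1" for i w
          using infdist_nonneg[of w F] by (auto simp: s_def max_def abs_square_le_1)
        fix w
        have "(\<lambda>i. s i w) \<longlonglongrightarrow> indicator F w"
        proof (cases "w \<in> F")
          case True
          then show ?thesis by (simp add: s_def)
        next
          case False
          then have pos: "infdist w F > 0" using F \<open>F \<noteq> {}\<close> in_closed_iff_infdist_zero infdist_nonneg by (metis less_eq_real_def)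
          obtain N :: nat where N: "real N > 1 / infdist w F" using reals_Archimedean2 by blast
          have "s i w = 0" if "i \<ge> N" for i
          proof -
            have "1 < real N * infdist w F" using N pos by (simp add: field_simps)
            also have "\<dots> \<le> real i * infdist w F" using that pos by (intro mult_right_mono) auto
            finally show ?thesis by (simp add: s_def)
          qed
          then have "eventually (\<lambda>i. s i w = 0) sequentially" by (auto simp: eventually_sequentially)
          then show ?thesis using False by (simp add: tendsto_eventually)
        qed
        then show "(\<lambda>i. complex_of_real (s i w)) \<longlonglongrightarrow> complex_of_real (indicator F w)" by (rule tendsto_of_real)
      qed simp
    qed
  next
    case empty
    then show ?case using approximable_of_real_continuous[of "\<lambda>_. 0"] by simp
  next
    case (compl A)
    have "approximable (\<lambda>w. complex_of_real 1 + (-1) * complex_of_real (indicator A w))"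
      by (intro approximable_add approximable_cmult compl approximable_of_real_continuous continuous_intros)
    moreover have "(\<lambda>w. complex_of_real 1 + (-1) * complex_of_real (indicator A w)) = (\<lambda>w. complex_of_real (indicator (UNIV - A) w))"
      by (auto simp: indicator_def)
    ultimately show ?case by simp
  next
    case (union A)
    have dis: "disjoint_family_on A {..<n}" for n using union(1) by (auto simp: disjoint_family_on_def)
    have fin: "approximable (\<lambda>w. complex_of_real (indicator (\<Union>i<n. A i) w))" for n
    proof -
      have "(\<lambda>w. complex_of_real (indicator (\<Union>i<n. A i) w)) = (\<lambda>w. \<Sum>i<n. complex_of_real (indicator (A i) w))"
        unfolding indicator_UN_disjoint[OF finite_lessThan dis] of_real_sum ..
      moreover have "approximable (\<lambda>w. \<Sum>i<n. complex_of_real (indicator (A i) w))"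
        by (rule approximable_sum[OF finite_lessThan union(3)])
      ultimately show ?thesis by (simp only:)
    qed
    show ?case
    proof (rule approximable_pointwise_limit[where s = "\<lambda>n w. complex_of_real (indicator (\<Union>i<n. A i) w)" and b = "\<lambda>w. 1"])
      show "(\<lambda>n. complex_of_real (indicator (\<Union>i<n. A i) w)) \<longlonglongrightarrow> complex_of_real (indicator (\<Union>i. A i) w)" for w
        by (intro tendsto_of_real LIMSEQ_indicator_UN)
      show "approximable (\<lambda>w. complex_of_real (indicator (\<Union>i<n. A i) w))" for n by (rule fin)
    qed (auto simp: indicator_def)
  qed
qed

text \<open>Square integrability stands inside the conclusion because the induction runs over all
  nonnegative measurable functions; for sums and increasing limits it is inherited by the smaller
  functions from the larger one.\<close>

lemma approximable_nonneg:
  fixes u :: "real^'n \<Rightarrow> real"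
  assumes u: "u \<in> borel_measurable sphere_measure" "\<And>w. 0 \<le> u w"
  shows "integrable sphere_measure (\<lambda>w. (u w)\<^sup>2) \<longrightarrow> approximable (\<lambda>w. complex_of_real (u w))"
  using u
proof (induction rule: borel_measurable_induct_real)
  case (set A)
  then have "A \<in> sets borel" using sphere_sets_iff by blast
  then show ?case by (simp add: approximable_indicator)
next
  case (mult u c)
  show ?case
  proof (cases "c = 0")
    case True
    then show ?thesis using approximable_of_real_continuous[of "\<lambda>_. 0"] by simp
  next
    case False
    show ?thesis
    proof
      assume "integrable sphere_measure (\<lambda>w. (c * u w)\<^sup>2)"
      then have "integrable sphere_measure (\<lambda>w. (u w)\<^sup>2)" using False by (simp add: power_mult_distrib)
      then have "approximable (\<lambda>w. complex_of_real c * complex_of_real (u w))" using mult by (intro approximable_cmult) simp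
      then show "approximable (\<lambda>w. complex_of_real (c * u w))" by simp
    qed
  qed
next
  case (add u v)
  show ?case
  proof
    assume i: "integrable sphere_measure (\<lambda>w. (v w + u w)\<^sup>2)"
    have "integrable sphere_measure (\<lambda>w. (u w)\<^sup>2)" "integrable sphere_measure (\<lambda>w. (v w)\<^sup>2)"
      using add.hyps add.prems by (auto intro!: Bochner_Integration.integrable_bound[OF i] AE_I2 power_mono borel_measurable_power)
    then have "approximable (\<lambda>w. complex_of_real (v w) + complex_of_real (u w))" using add by (intro approximable_add) simp_all
    then show "approximable (\<lambda>w. complex_of_real (v w + u w))" by simp
  qed
next
  case (seq U)
  have Um: "U i \<in> borel_measurable sphere_measure" for i by fact
  have Un: "0 \<le> U i w" for i w by fact
  have UP: "integrable sphere_measure (\<lambda>w. (U i w)\<^sup>2) \<longrightarrow> approximable (\<lambda>w. complex_of_real (U i w))" for i by fact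
  have Ul: "(\<lambda>i. U i w) \<longlonglongrightarrow> u w" if "w \<in> space sphere_measure" for w using that by fact
  show ?case
  proof
    assume i: "integrable sphere_measure (\<lambda>w. (u w)\<^sup>2)"
    have le: "(U i w)\<^sup>2 \<le> (u w)\<^sup>2" if "w \<in> sphere 0 1" for i w
    proof -
      have "incseq (\<lambda>i. U i w)" using \<open>incseq U\<close> unfolding incseq_def le_fun_def by blast
      then have "U i w \<le> u w" using Ul[of w] that by (intro incseq_le) simp_all
      then show ?thesis using Un by (intro power_mono)
    qed
    have "integrable sphere_measure (\<lambda>w. (U i w)\<^sup>2)" for i
      using Um le by (intro Bochner_Integration.integrable_bound[OF i] AE_I2) auto
    then have "approximable (\<lambda>w. complex_of_real (U i w))" for i using UP by blast
    then show "approximable (\<lambda>w. complex_of_real (u w))"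
    proof (rule approximable_pointwise_limit[OF _ _ i])
      show "(cmod (complex_of_real (U i w)))\<^sup>2 \<le> (u w)\<^sup>2" if "w \<in> sphere 0 1" for i w using le[OF that] by simp
      show "(\<lambda>i. complex_of_real (U i w)) \<longlonglongrightarrow> complex_of_real (u w)" if "w \<in> sphere 0 1" for w
        using Ul that by (intro tendsto_of_real) simp
    qed
  qed
qed

lemma approximable_real:
  fixes u :: "real^'n \<Rightarrow> real"
  assumes u: "u \<in> borel_measurable sphere_measure" and i: "integrable sphere_measure (\<lambda>w. (u w)\<^sup>2)"
  shows "approximable (\<lambda>w. complex_of_real (u w))"
proof -
  have 1: "approximable (\<lambda>w. complex_of_real (max 0 (u w)))"
    by (rule approximable_nonneg[rule_format])
       (use u in \<open>auto intro!: Bochner_Integration.integrable_bound[OF i] AE_I2 simp: max_def\<close>)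
  have 2: "approximable (\<lambda>w. complex_of_real (max 0 (- u w)))"
    by (rule approximable_nonneg[rule_format])
       (use u in \<open>auto intro!: Bochner_Integration.integrable_bound[OF i] AE_I2 simp: max_def\<close>)
  have "approximable (\<lambda>w. complex_of_real (max 0 (u w)) + (-1) * complex_of_real (max 0 (- u w)))"
    by (intro approximable_add approximable_cmult 1 2)
  moreover have "(\<lambda>w. complex_of_real (max 0 (u w)) + (-1) * complex_of_real (max 0 (- u w))) = (\<lambda>w. complex_of_real (u w))"
    by (auto simp: max_def)
  ultimately show ?thesis by simp
qed

lemma harm_sum_dense:
  fixes f :: "real^'n \<Rightarrow> complex"
  assumes f: "f \<in> L2_sphere" shows "approximable f"
proof -
  have m: "f \<in> borel_measurable sphere_measure" by (rule L2_meas[OF f])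
  have "approximable (\<lambda>w. complex_of_real (Re (f w)) + \<i> * complex_of_real (Im (f w)))"
    using m
    by (intro approximable_add approximable_cmult approximable_real)
       (auto intro!: Bochner_Integration.integrable_bound[OF L2_int[OF f]] AE_I2 simp: cmod_power2)
  then show ?thesis by (simp flip: complex_eq)
qed

section \<open>Maximizers\<close>

lemma L2_integrable: assumes "f \<in> L2_sphere" shows "integrable sphere_measure f"
proof (rule Bochner_Integration.integrable_bound)
  show "integrable sphere_measure (\<lambda>w. 1 + (cmod (f w))\<^sup>2)" using L2_int[OF assms] by simp
  have "cmod z \<le> 1 + (cmod z)\<^sup>2" for z
    using zero_le_power2[of "cmod z - 1"] norm_ge_zero[of z] unfolding power2_diff by (simp, linarith)
  then show "AE w in sphere_measure. norm (f w) \<le> norm (1 + (cmod (f w))\<^sup>2)" by (intro AE_I2) (auto intro: order_trans)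
qed (rule L2_meas[OF assms])

text \<open>Pointwise |z| \<le> e + |z|^2 / e. This stands in for Cauchy-Schwarz; with e of the size
  of the L2 norm of h it loses only a constant.\<close>

lemma L1_le_L2:
  fixes h :: "real^'n \<Rightarrow> complex"
  assumes h: "h \<in> L2_sphere" and e: "e > 0"
  shows "(\<integral>w. cmod (h w) \<partial>sphere_measure) \<le> e * area TYPE('n) + L2_norm_sq h / e"
proof -
  have "cmod z \<le> e + (cmod z)\<^sup>2 / e" for z
  proof (cases "cmod z \<le> e")
    case False
    then have "cmod z * e \<le> cmod z * cmod z" by (intro mult_left_mono) auto
    then have "cmod z \<le> (cmod z)\<^sup>2 / e" using e by (simp add: field_simps power2_eq_square)
    then show ?thesis using e by simp
  qed (use e in \<open>simp add: add_increasing2\<close>)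
  then have "(\<integral>w. cmod (h w) \<partial>sphere_measure) \<le> (\<integral>w. e + (cmod (h w))\<^sup>2 / e \<partial>sphere_measure)"
    using L2_integrable[OF h] L2_int[OF h] by (intro integral_mono) auto
  also have "\<dots> = e * area TYPE('n) + L2_norm_sq h / e"
    using L2_int[OF h] by (simp add: L2_norm_sq_def area_def)
  finally show ?thesis .
qed

text \<open>With t = |a - b| the squares differ by at most t^2 + 2 t |a|, and the mixed term is at
  most t^2 / e + e |a|^2. The free parameter balances the two errors when f and p are close.\<close>

lemma L2_norm_sq_perturb:
  assumes f: "f \<in> L2_sphere" and p: "p \<in> L2_sphere" and e: "e > 0"
  shows "\<bar>L2_norm_sq p - L2_norm_sq f\<bar> \<le> (1 + 1 / e) * L2_norm_sq (\<lambda>w. f w - p w) + e * L2_norm_sq f"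
proof -
  have pw: "\<bar>(cmod b)\<^sup>2 - (cmod a)\<^sup>2\<bar> \<le> (1 + 1 / e) * (cmod (a - b))\<^sup>2 + e * (cmod a)\<^sup>2" for a b
  proof -
    define t where "t = cmod (a - b)"
    have "\<bar>cmod b - cmod a\<bar> \<le> t" unfolding t_def by (metis norm_minus_commute norm_triangle_ineq3)
    moreover have "cmod b + cmod a \<le> t + 2 * cmod a" using norm_triangle_sub[of b a] by (simp add: t_def norm_minus_commute)
    moreover have "\<bar>(cmod b)\<^sup>2 - (cmod a)\<^sup>2\<bar> = \<bar>cmod b - cmod a\<bar> * (cmod b + cmod a)"
      by (simp add: power2_eq_square square_diff_square_factored abs_mult)
    ultimately have "\<bar>(cmod b)\<^sup>2 - (cmod a)\<^sup>2\<bar> \<le> t * (t + 2 * cmod a)" by (simp add: mult_mono)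
    moreover have "2 * t * cmod a \<le> t\<^sup>2 / e + e * (cmod a)\<^sup>2"
    proof -
      have "0 \<le> (t - e * cmod a)\<^sup>2 / e" using e by simp
      also have "\<dots> = t\<^sup>2 / e - 2 * t * cmod a + e * (cmod a)\<^sup>2" using e by (simp add: power2_eq_square field_simps)
      finally show ?thesis by simp
    qed
    ultimately show ?thesis by (simp add: t_def power2_eq_square algebra_simps)
  qed
  have "\<bar>L2_norm_sq p - L2_norm_sq f\<bar> = \<bar>\<integral>w. (cmod (p w))\<^sup>2 - (cmod (f w))\<^sup>2 \<partial>sphere_measure\<bar>"
    using L2_int[OF f] L2_int[OF p] by (simp add: L2_norm_sq_def)
  also have "\<dots> \<le> (\<integral>w. \<bar>(cmod (p w))\<^sup>2 - (cmod (f w))\<^sup>2\<bar> \<partial>sphere_measure)" by (rule integral_abs_bound)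
  also have "\<dots> \<le> (\<integral>w. (1 + 1 / e) * (cmod (f w - p w))\<^sup>2 + e * (cmod (f w))\<^sup>2 \<partial>sphere_measure)"
    using L2_int[OF f] L2_int[OF p] L2_int[OF L2_diff[OF f p]]
    by (intro integral_mono pw) (auto intro!: Bochner_Integration.integrable_diff integrable_abs)
  also have "\<dots> = (1 + 1 / e) * L2_norm_sq (\<lambda>w. f w - p w) + e * L2_norm_sq f"
    using L2_int[OF f] L2_int[OF L2_diff[OF f p]] by (simp add: L2_norm_sq_def)
  finally show ?thesis .
qed

lemma extension_integrable:
  assumes f: "f \<in> L2_sphere" shows "integrable sphere_measure (\<lambda>w. f w * exp (- \<i> * complex_of_real (w \<bullet> x)))"
proof (rule Bochner_Integration.integrable_bound[OF L2_integrable[OF f]])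
  have "(\<lambda>w. exp (- \<i> * complex_of_real (w \<bullet> x))) \<in> borel_measurable sphere_measure"
    by (intro sphere_measurable continuous_intros)
  then show "(\<lambda>w. f w * exp (- \<i> * complex_of_real (w \<bullet> x))) \<in> borel_measurable sphere_measure"
    using L2_meas[OF f] by measurable
qed (simp add: norm_mult norm_exp_eq_Re)

lemma extension_op_bound:
  assumes f: "f \<in> L2_sphere" shows "cmod (extension_op f x) \<le> (\<integral>w. cmod (f w) \<partial>sphere_measure)"
proof -
  have "cmod (extension_op f x) \<le> (\<integral>w. norm (f w * exp (- \<i> * complex_of_real (w \<bullet> x))) \<partial>sphere_measure)"
    unfolding extension_op_def by (rule integral_norm_bound)
  then show ?thesis by (simp add: norm_mult norm_exp_eq_Re)
qed

lemma extension_op_diff: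
  assumes "f \<in> L2_sphere" "g \<in> L2_sphere"
  shows "extension_op (\<lambda>w. f w - g w) x = extension_op f x - extension_op g x"
  unfolding extension_op_def left_diff_distrib
  by (intro Bochner_Integration.integral_diff extension_integrable assms)

lemma extension_op_measurable:
  fixes f :: "real^'n \<Rightarrow> complex"
  assumes f: "f \<in> L2_sphere" shows "extension_op f \<in> borel_measurable borel"
proof -
  have id [measurable]: "(\<lambda>w::real^'n. w) \<in> sphere_measure \<rightarrow>\<^sub>M borel"
    by (rule sphere_measurable) (rule continuous_on_id)
  have [measurable]: "f \<in> borel_measurable sphere_measure" by (rule L2_meas[OF f])
  have [measurable]: "(\<lambda>p::(real^'n) \<times> (real^'n). snd p) \<in> borel \<Otimes>\<^sub>M sphere_measure \<rightarrow>\<^sub>M borel"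
    by (rule measurable_compose[OF measurable_snd id])
  have "(\<lambda>(x, w). f w * exp (- \<i> * complex_of_real (w \<bullet> x))) \<in> borel_measurable (borel \<Otimes>\<^sub>M sphere_measure)"
    unfolding case_prod_beta' by measurable
  from sphere.borel_measurable_lebesgue_integral[OF this] show ?thesis
    unfolding extension_op_def[abs_def] .
qed

section \<open>Continuity of the form and the norm in L2\<close>

lemma ball_form_cong:
  assumes "f \<in> borel_measurable sphere_measure" "g \<in> borel_measurable sphere_measure" "AE w in sphere_measure. f w = g w"
  shows "ball_form \<rho> f = ball_form \<rho> g" and "L2_norm_sq f = L2_norm_sq g"
proof -
  have "(\<lambda>w. exp (- \<i> * complex_of_real (w \<bullet> x))) \<in> borel_measurable sphere_measure" for x :: "real^'a"
    by (intro sphere_measurable continuous_intros)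
  then have "extension_op f x = extension_op g x" for x
    unfolding extension_op_def using assms by (intro integral_cong_AE) auto
  then show "ball_form \<rho> f = ball_form \<rho> g" by (simp add: ball_form_def)
  show "L2_norm_sq f = L2_norm_sq g" unfolding L2_norm_sq_def using assms by (intro integral_cong_AE) auto
qed

text \<open>The rate 1 / (n + 1)^2 is fixed so that the estimates with parameter e = 1 / (n + 1)
  leave an error of order 1 / (n + 1).\<close>

lemma approximating_sequence:
  fixes f :: "real^'n \<Rightarrow> complex"
  assumes f: "f \<in> L2_sphere"
  obtains p where "\<And>n. harm_sum (p n)" "\<And>n. L2_norm_sq (\<lambda>w. f w - p n w) < 1 / (real (Suc n))\<^sup>2"
proof -
  have "\<exists>p. harm_sum p \<and> L2_norm_sq (\<lambda>w. f w - p w) < 1 / (real (Suc n))\<^sup>2" for n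
    using harm_sum_dense[OF f] unfolding approximable_def by simp
  then show ?thesis using that by metis
qed

lemma inverse_Suc_tendsto: "(\<lambda>n. c / real (Suc n)) \<longlonglongrightarrow> 0"
  using tendsto_mult_right_zero[OF LIMSEQ_inverse_real_of_nat, of c] by (simp add: divide_inverse)

lemma L2_norm_sq_tendsto:
  fixes f :: "real^'n \<Rightarrow> complex"
  assumes f: "f \<in> L2_sphere" and p: "\<And>n. p n \<in> L2_sphere"
    and b: "\<And>n. L2_norm_sq (\<lambda>w. f w - p n w) < 1 / (real (Suc n))\<^sup>2"
  shows "(\<lambda>n. L2_norm_sq (p n)) \<longlonglongrightarrow> L2_norm_sq f"
proof -
  have "\<bar>L2_norm_sq (p n) - L2_norm_sq f\<bar> \<le> (2 + L2_norm_sq f) / real (Suc n)" for n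
  proof -
    define s where "s = real (Suc n)"
    have s: "s \<ge> 1" by (simp add: s_def)
    have "\<bar>L2_norm_sq (p n) - L2_norm_sq f\<bar> \<le> (1 + 1 / (1 / s)) * L2_norm_sq (\<lambda>w. f w - p n w) + 1 / s * L2_norm_sq f"
      by (rule L2_norm_sq_perturb[OF f p]) (use s in simp)
    also have "\<dots> \<le> (1 + s) * (1 / s\<^sup>2) + 1 / s * L2_norm_sq f"
      using b[of n] s by (intro add_right_mono mult_mono) (auto simp: s_def L2_norm_sq_nonneg)
    also have "(1 + s) * (1 / s\<^sup>2) \<le> 2 * s * (1 / s\<^sup>2)" using s by (intro mult_right_mono) auto
    also have "2 * s * (1 / s\<^sup>2) = 2 / s" using s by (simp add: power2_eq_square)
    finally show ?thesis by (simp add: s_def add_divide_distrib)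
  qed
  then have "(\<lambda>n. L2_norm_sq (p n) - L2_norm_sq f) \<longlonglongrightarrow> 0"
    by (intro Lim_null_comparison[OF _ inverse_Suc_tendsto[of "2 + L2_norm_sq f"]]) (simp add: always_eventually)
  then show ?thesis by (simp add: LIM_zero_iff)
qed

text \<open>The extension is bounded by the L1 norm, so L2 convergence makes the extensions converge
  uniformly on the whole space. On the ball, which has finite volume, dominated convergence does the
  rest.\<close>

lemma ball_form_tendsto:
  fixes f :: "real^'n \<Rightarrow> complex"
  assumes f: "f \<in> L2_sphere" and p: "\<And>n. p n \<in> L2_sphere"
    and b: "\<And>n. L2_norm_sq (\<lambda>w. f w - p n w) < 1 / (real (Suc n))\<^sup>2"
  shows "(\<lambda>n. ball_form \<rho> (p n)) \<longlonglongrightarrow> ball_form \<rho> f"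
proof -
  define I where "I = (\<integral>w. cmod (f w) \<partial>sphere_measure)"
  define a where "a = area TYPE('n) + 1"
  have a: "a \<ge> 0" using area_pos[where 'n = 'n] by (simp add: a_def)
  have db: "cmod (extension_op (p n) x - extension_op f x) \<le> a / real (Suc n)" for n x
  proof -
    define s where "s = real (Suc n)"
    have s: "s \<ge> 1" by (simp add: s_def)
    have "cmod (extension_op (p n) x - extension_op f x) = cmod (extension_op (\<lambda>w. f w - p n w) x)"
      by (simp add: extension_op_diff[OF f p] norm_minus_commute)
    also have "\<dots> \<le> 1 / s * area TYPE('n) + L2_norm_sq (\<lambda>w. f w - p n w) / (1 / s)"
      by (rule order_trans[OF extension_op_bound L1_le_L2]) (use s L2_diff[OF f p] in auto)
    also have "\<dots> \<le> 1 / s * area TYPE('n) + 1 / s\<^sup>2 / (1 / s)"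
      using b[of n] s by (intro add_left_mono divide_right_mono) (auto simp: s_def)
    also have "\<dots> = a / s" using s by (simp add: a_def power2_eq_square field_simps)
    finally show ?thesis by (simp add: s_def)
  qed
  have lim: "(\<lambda>n. extension_op (p n) x) \<longlonglongrightarrow> extension_op f x" for x
    by (rule LIM_zero_cancel, rule Lim_null_comparison[OF _ inverse_Suc_tendsto[of a]]) (simp add: db always_eventually del: of_nat_Suc)
  have bound: "cmod (extension_op (p n) x) \<le> I + a" for n x
  proof -
    have "cmod (extension_op (p n) x) \<le> cmod (extension_op f x) + cmod (extension_op (p n) x - extension_op f x)"
      by (rule norm_triangle_sub)
    also have "\<dots> \<le> I + a / real (Suc n)" unfolding I_def by (intro add_mono extension_op_bound f db)
    also have "a / real (Suc n) \<le> a" using a by (simp add: divide_le_eq mult_le_cancel_left1)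
    finally show ?thesis by simp
  qed
  have meas: "(\<lambda>x. indicat_real (ball 0 \<rho>) x *\<^sub>R ((cmod (g x))\<^sup>2 / (2 * pi) ^ CARD('n))) \<in> borel_measurable lborel"
    if [measurable]: "g \<in> borel_measurable borel" for g :: "real^'n \<Rightarrow> complex"
  proof (rule borel_measurable_scaleR)
    show "indicat_real (ball 0 \<rho>) \<in> borel_measurable lborel" by (rule borel_measurable_indicator) simp
    show "(\<lambda>x. (cmod (g x))\<^sup>2 / (2 * pi) ^ CARD('n)) \<in> borel_measurable lborel" by measurable
  qed
  have "(\<lambda>n. LINT x : ball 0 \<rho> | lborel. (cmod (extension_op (p n) x))\<^sup>2 / (2 * pi) ^ CARD('n))
     \<longlonglongrightarrow> (LINT x : ball 0 \<rho> | lborel. (cmod (extension_op f x))\<^sup>2 / (2 * pi) ^ CARD('n))"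
    unfolding set_lebesgue_integral_def
  proof (rule integral_dominated_convergence[where w = "\<lambda>x. indicator (ball 0 \<rho>) x * ((I + a)\<^sup>2 / (2 * pi) ^ CARD('n))"])
    show "integrable lborel (\<lambda>x::real^'n. indicator (ball 0 \<rho>) x * ((I + a)\<^sup>2 / (2 * pi) ^ CARD('n)))"
      by (intro integrable_mult_left integrable_real_indicator) (simp_all add: emeasure_lborel_ball_finite[unfolded infinity_ennreal_def])
    show "AE x in lborel. norm (indicat_real (ball 0 \<rho>) x *\<^sub>R ((cmod (extension_op (p n) x))\<^sup>2 / (2 * pi) ^ CARD('n)))
          \<le> indicator (ball 0 \<rho>) x * ((I + a)\<^sup>2 / (2 * pi) ^ CARD('n))" for n
      using bound by (intro AE_I2) (auto simp: indicator_def intro!: divide_right_mono power_mono)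
    show "AE x in lborel. (\<lambda>n. indicat_real (ball 0 \<rho>) x *\<^sub>R ((cmod (extension_op (p n) x))\<^sup>2 / (2 * pi) ^ CARD('n)))
       \<longlonglongrightarrow> indicat_real (ball 0 \<rho>) x *\<^sub>R ((cmod (extension_op f x))\<^sup>2 / (2 * pi) ^ CARD('n))"
      by (intro AE_I2 tendsto_intros lim) simp
  qed (rule meas, rule extension_op_measurable, rule f, rule meas, rule extension_op_measurable, rule p)
  then show ?thesis unfolding ball_form_def by (rule tendsto_mult_left)
qed

lemma L2_norm_sq_harm_sum:
  fixes Y :: "nat \<Rightarrow> real^'n \<Rightarrow> complex"
  assumes "finite A" "\<And>k. k \<in> A \<Longrightarrow> harm k (Y k)"
  shows "L2_norm_sq (\<lambda>w. \<Sum>k\<in>A. Y k w) = (\<Sum>k\<in>A. L2_norm_sq (Y k))"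
  using sphere_pythagoras[OF assms, of "\<lambda>_. 1"] by (simp add: L2_norm_sq_def)

lemma sphere_cong:
  fixes f g :: "real^'n \<Rightarrow> complex"
  assumes "\<And>w. w \<in> sphere 0 1 \<Longrightarrow> f w = g w"
  shows "ball_form \<rho> f = ball_form \<rho> g" and "L2_norm_sq f = L2_norm_sq g"
proof -
  have "extension_op f x = extension_op g x" for x
    unfolding extension_op_def using assms by (intro Bochner_Integration.integral_cong) auto
  then show "ball_form \<rho> f = ball_form \<rho> g" by (simp add: ball_form_def)
  show "L2_norm_sq f = L2_norm_sq g"
    unfolding L2_norm_sq_def using assms by (intro Bochner_Integration.integral_cong) auto
qed

text \<open>Norm and form are both diagonal in the degree, so the deficit is the sum of (C -
  \<open>Lambda k\<close>) times the squared norm of the k-th component: zero for k in K, at least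
  \<delta> times that norm otherwise. The witnesses are the components of p with degree in
  K.\<close>

lemma coercive_harm_sum:
  fixes p :: "real^'n \<Rightarrow> complex"
  assumes p: "harm_sum p" and \<rho>: "\<rho> > 0" and \<nu>: "\<nu> = real CARD('n) / 2 - 1"
    and K: "finite K" "\<And>k. k \<in> K \<Longrightarrow> Lambda k \<nu> \<rho> = C" "\<And>k. k \<notin> K \<Longrightarrow> Lambda k \<nu> \<rho> \<le> C - \<delta>"
  shows "\<exists>Y. (\<forall>k. harm k (Y k)) \<and> \<delta> * L2_norm_sq (\<lambda>w. p w - (\<Sum>k\<in>K. Y k w)) \<le> C * L2_norm_sq p - ball_form \<rho> p"
proof -
  obtain N Y where Y: "\<And>k. harm k (Y k)" "\<And>w. w \<in> sphere 0 1 \<Longrightarrow> p w = (\<Sum>k<(N::nat). Y k w)"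
    using p unfolding harm_sum_def by metis
  \<comment> \<open>K may contain degrees beyond the length N of the sum, hence the padding by
    zero.\<close>
  define Z where "Z k = (if k < N then Y k else (\<lambda>x. 0))" for k
  have Z: "harm k (Z k)" for k using Y by (simp add: Z_def)
  let ?E = "\<lambda>k. L2_norm_sq (Y k)"
  have pN: "L2_norm_sq p = (\<Sum>k<N. ?E k)"
  proof -
    have "L2_norm_sq p = L2_norm_sq (\<lambda>w. \<Sum>k<N. Y k w)" by (rule sphere_cong(2)) (rule Y(2))
    also have "\<dots> = (\<Sum>k<N. ?E k)" by (rule L2_norm_sq_harm_sum) (simp_all add: Y)
    finally show ?thesis .
  qed
  have pQ: "ball_form \<rho> p = (\<Sum>k<N. Lambda k \<nu> \<rho> * ?E k)"
  proof -
    have "ball_form \<rho> p = ball_form \<rho> (\<lambda>w. \<Sum>k<N. Y k w)" by (rule sphere_cong(1)) (rule Y(2))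
    also have "\<dots> = (\<Sum>k<N. Lambda k \<nu> \<rho> * ?E k)"
      unfolding L2_norm_sq_def by (rule ball_form_harm_sum) (simp_all add: Y \<rho> \<nu>)
    finally show ?thesis .
  qed
  have diff: "p w - (\<Sum>k\<in>K. Z k w) = (\<Sum>k\<in>{..<N} - K. Y k w)" if "w \<in> sphere 0 1" for w
  proof -
    have "(\<Sum>k\<in>K. Z k w) = (\<Sum>k\<in>{..<N} \<inter> K. Y k w)"
      using K(1) by (intro sum.mono_neutral_cong_right) (auto simp: Z_def)
    moreover have "(\<Sum>k<N. Y k w) = (\<Sum>k\<in>{..<N} \<inter> K. Y k w) + (\<Sum>k\<in>{..<N} - K. Y k w)"
      by (rule sum.Int_Diff) simp
    ultimately show ?thesis by (simp add: Y(2)[OF that])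
  qed
  have "L2_norm_sq (\<lambda>w. p w - (\<Sum>k\<in>K. Z k w)) = L2_norm_sq (\<lambda>w. \<Sum>k\<in>{..<N} - K. Y k w)"
    by (rule sphere_cong(2)) (rule diff)
  also have "\<dots> = (\<Sum>k\<in>{..<N} - K. ?E k)" by (rule L2_norm_sq_harm_sum) (simp_all add: Y)
  finally have "L2_norm_sq (\<lambda>w. p w - (\<Sum>k\<in>K. Z k w)) = (\<Sum>k\<in>{..<N} - K. ?E k)" .
  then have "\<delta> * L2_norm_sq (\<lambda>w. p w - (\<Sum>k\<in>K. Z k w)) = (\<Sum>k\<in>{..<N} - K. \<delta> * ?E k)" by (simp add: sum_distrib_left)
  also have "\<dots> \<le> (\<Sum>k\<in>{..<N} - K. (C - Lambda k \<nu> \<rho>) * ?E k)"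
  proof (rule sum_mono)
    fix k assume "k \<in> {..<N} - K"
    then have "\<delta> \<le> C - Lambda k \<nu> \<rho>" using K(3)[of k] by simp
    then show "\<delta> * ?E k \<le> (C - Lambda k \<nu> \<rho>) * ?E k" by (intro mult_right_mono L2_norm_sq_nonneg)
  qed
  also have "\<dots> = (\<Sum>k<N. (C - Lambda k \<nu> \<rho>) * ?E k)"
    by (rule sum.mono_neutral_left) (auto simp: K(2))
  also have "\<dots> = C * L2_norm_sq p - ball_form \<rho> p"
    by (simp add: pN pQ left_diff_distrib sum_subtractf sum_distrib_left)
  finally show ?thesis using Z by blast
qed

text \<open>
  An \<open>L\<^sup>1\<close> to sup-norm bounded projection onto the harmonics of degree \<open>k\<close>. Its boundedness makes
  them closed in \<open>L\<^sup>2\<close> without any appeal to dimension.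
\<close>

definition harm_reproducing :: "nat \<Rightarrow> ((real^'n \<Rightarrow> complex) \<Rightarrow> real^'n \<Rightarrow> complex) \<Rightarrow> bool" where
  "harm_reproducing k R \<longleftrightarrow> (\<forall>h. harm k (R h))
     \<and> (\<exists>B\<ge>0. \<forall>h. integrable sphere_measure h \<longrightarrow> (\<forall>\<xi>\<in>sphere 0 1. cmod (R h \<xi>) \<le> B * (\<integral>w. cmod (h w) \<partial>sphere_measure)))
     \<and> (\<forall>h g. integrable sphere_measure h \<longrightarrow> integrable sphere_measure g \<longrightarrow> R (\<lambda>w. h w + g w) = (\<lambda>\<xi>. R h \<xi> + R g \<xi>))
     \<and> (\<forall>j Y. harm j Y \<longrightarrow> R Y = (if j = k then Y else (\<lambda>\<xi>. 0)))"

text \<open>A kernel of finite rank suffices. The factors \<open>\<phi> a\<close> are harmonic on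
  the whole space, so the image consists of harmonic polynomials for every h, integrable or not; of
  the factors \<open>\<psi> a\<close> only boundedness and measurability on the sphere are used. The
  bound B adds up products of sup-norm bounds.\<close>

lemma harm_reproducingI:
  fixes \<phi> \<psi> :: "'a \<Rightarrow> real^'n \<Rightarrow> complex"
  assumes I: "finite I" and \<phi>: "\<And>a. a \<in> I \<Longrightarrow> harm k (\<phi> a)" and \<psi>: "\<And>a. a \<in> I \<Longrightarrow> continuous_on (sphere 0 1) (\<psi> a)"
    and rep: "\<And>j Y \<xi>. harm j Y \<Longrightarrow> sphere_int (\<lambda>w. Y w * (\<Sum>a\<in>I. \<phi> a \<xi> * \<psi> a w)) = (if j = k then Y \<xi> else 0)"
  shows "harm_reproducing k (\<lambda>h \<xi>. \<Sum>a\<in>I. sphere_int (\<lambda>w. h w * \<psi> a w) * \<phi> a \<xi>)"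
proof -
  obtain b where b: "\<And>a. a \<in> I \<Longrightarrow> b a \<ge> 0" "\<And>a w. a \<in> I \<Longrightarrow> w \<in> sphere 0 1 \<Longrightarrow> cmod (\<psi> a w) \<le> b a"
  proof -
    have "\<forall>a\<in>I. \<exists>B\<ge>0. \<forall>w\<in>sphere 0 1. cmod (\<psi> a w) \<le> B" using sphere_bounded[OF \<psi>] by (metis less_imp_le)
    then show ?thesis using that by metis
  qed
  obtain c where c: "\<And>a. a \<in> I \<Longrightarrow> c a \<ge> 0" "\<And>a w. a \<in> I \<Longrightarrow> w \<in> sphere 0 1 \<Longrightarrow> cmod (\<phi> a w) \<le> c a"
  proof -
    have "\<forall>a\<in>I. \<exists>B\<ge>0. \<forall>w\<in>sphere 0 1. cmod (\<phi> a w) \<le> B" using sphere_bounded[OF hom_poly_continuous[OF harm_hom_poly[OF \<phi>]]] by (metis less_imp_le)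
    then show ?thesis using that by metis
  qed
  have hb: "cmod (h w * \<psi> a w) \<le> b a * cmod (h w)" if "a \<in> I" "w \<in> sphere 0 1" for h a w
    using mult_right_mono[OF b(2)[OF that] norm_ge_zero[of "h w"]] by (simp add: norm_mult mult.commute)
  have int: "integrable sphere_measure (\<lambda>w. h w * \<psi> a w)" if h: "integrable sphere_measure h" and a: "a \<in> I" for h a
  proof (rule Bochner_Integration.integrable_bound[OF integrable_mult_right[OF h, of "complex_of_real (b a)"]])
    show "(\<lambda>w. h w * \<psi> a w) \<in> borel_measurable sphere_measure"
      using h sphere_measurable[OF \<psi>[OF a]] by (intro borel_measurable_times) auto
    show "AE w in sphere_measure. norm (h w * \<psi> a w) \<le> norm (complex_of_real (b a) * h w)"
    proof (rule AE_I2)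
      fix w :: "real^'n" assume "w \<in> space sphere_measure"
      then have "w \<in> sphere 0 1" by simp
      from hb[OF a this, of h] show "norm (h w * \<psi> a w) \<le> norm (complex_of_real (b a) * h w)"
        using b(1)[OF a] by (simp add: norm_mult)
    qed
  qed
  let ?R = "\<lambda>h \<xi>. \<Sum>a\<in>I. sphere_int (\<lambda>w. h w * \<psi> a w) * \<phi> a \<xi>"
  have "harm k (?R h)" for h
    using I \<phi>
  proof (induction I rule: finite_induct)
    case (insert a I)
    have "harm k (\<lambda>\<xi>. sphere_int (\<lambda>w. h w * \<psi> a w) * \<phi> a \<xi> + (\<Sum>a\<in>I. sphere_int (\<lambda>w. h w * \<psi> a w) * \<phi> a \<xi>))"
      by (rule harm_add, rule harm_cmult) (use insert in auto)
    then show ?case using insert.hyps by simp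
  qed simp
  moreover have "\<exists>B\<ge>0. \<forall>h. integrable sphere_measure h \<longrightarrow> (\<forall>\<xi>\<in>sphere 0 1. cmod (?R h \<xi>) \<le> B * (\<integral>w. cmod (h w) \<partial>sphere_measure))"
  proof (intro exI[of _ "\<Sum>a\<in>I. b a * c a"] conjI allI impI ballI)
    show "0 \<le> (\<Sum>a\<in>I. b a * c a)" by (intro sum_nonneg mult_nonneg_nonneg b c)
    fix h :: "real^'n \<Rightarrow> complex" and \<xi> :: "real^'n" assume h: "integrable sphere_measure h" and \<xi>: "\<xi> \<in> sphere 0 1"
    have "cmod (?R h \<xi>) \<le> (\<Sum>a\<in>I. cmod (sphere_int (\<lambda>w. h w * \<psi> a w)) * cmod (\<phi> a \<xi>))"
      by (rule order_trans[OF norm_sum]) (simp add: norm_mult)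
    also have "\<dots> \<le> (\<Sum>a\<in>I. (b a * (\<integral>w. cmod (h w) \<partial>sphere_measure)) * c a)"
    proof (intro sum_mono mult_mono c \<xi>)
      fix a assume a: "a \<in> I"
      have "cmod (sphere_int (\<lambda>w. h w * \<psi> a w)) \<le> (\<integral>w. cmod (h w * \<psi> a w) \<partial>sphere_measure)" by (rule integral_norm_bound)
      also have "\<dots> \<le> (\<integral>w. b a * cmod (h w) \<partial>sphere_measure)"
        using int[OF h a] h
        by (intro integral_mono integrable_norm integrable_mult_right) (simp_all only: hb[OF a] space_sphere_measure)
      finally show "cmod (sphere_int (\<lambda>w. h w * \<psi> a w)) \<le> b a * (\<integral>w. cmod (h w) \<partial>sphere_measure)" by simp
      show "0 \<le> b a * (\<integral>w. cmod (h w) \<partial>sphere_measure)" using b(1)[OF a] by simp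
    qed simp_all
    also have "\<dots> = (\<Sum>a\<in>I. b a * c a) * (\<integral>w. cmod (h w) \<partial>sphere_measure)"
      unfolding sum_distrib_right by (intro sum.cong refl) simp
    finally show "cmod (?R h \<xi>) \<le> (\<Sum>a\<in>I. b a * c a) * (\<integral>w. cmod (h w) \<partial>sphere_measure)" .
  qed
  moreover have "?R (\<lambda>w. h w + g w) = (\<lambda>\<xi>. ?R h \<xi> + ?R g \<xi>)" if "integrable sphere_measure h" "integrable sphere_measure g" for h g
  proof -
    have "sphere_int (\<lambda>w. (h w + g w) * \<psi> a w) = sphere_int (\<lambda>w. h w * \<psi> a w) + sphere_int (\<lambda>w. g w * \<psi> a w)" if "a \<in> I" for a
      unfolding distrib_right using int \<open>integrable sphere_measure h\<close> \<open>integrable sphere_measure g\<close> that by (intro Bochner_Integration.integral_add)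
    then show ?thesis by (intro ext) (simp add: distrib_right sum.distrib)
  qed
  moreover have "?R Y = (if j = k then Y else (\<lambda>\<xi>. 0))" if Y: "harm j Y" for j Y
  proof
    fix \<xi>
    have "?R Y \<xi> = (\<Sum>a\<in>I. sphere_int (\<lambda>w. Y w * \<psi> a w * \<phi> a \<xi>))" by simp
    also have "\<dots> = sphere_int (\<lambda>w. \<Sum>a\<in>I. Y w * \<psi> a w * \<phi> a \<xi>)"
      by (rule Bochner_Integration.integral_sum[symmetric], rule integrable_mult_left, rule int[OF hom_poly_sphere_integrable[OF harm_hom_poly[OF Y]]])
    also have "\<dots> = sphere_int (\<lambda>w. Y w * (\<Sum>a\<in>I. \<phi> a \<xi> * \<psi> a w))" by (simp add: sum_distrib_left mult_ac)
    finally show "?R Y \<xi> = (if j = k then Y else (\<lambda>\<xi>. 0)) \<xi>" unfolding rep[OF Y] by simp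
  qed
  ultimately show ?thesis unfolding harm_reproducing_def by (intro conjI allI impI)
qed

section \<open>Kernels in degrees zero, one and two\<close>

lemma harm_const: "harm 0 (\<lambda>x. c)" by (simp add: harm_def hom_poly_const lap_hp1[OF hom_poly_const])

text \<open>The moment formula at j = 0. As c is independent of Y and \<xi>, the k-th power of
  \<open>lin \<xi>\<close> reproduces degree k up to a factor; for a kernel it remains to annihilate
  the other degrees.\<close>

lemma sphere_int_harm_lin_power_diag:
  obtains c :: complex where "c \<noteq> 0" "\<And>Y \<xi>. harm k (Y :: real^'n \<Rightarrow> complex) \<Longrightarrow> sphere_int (\<lambda>w. Y w * lin \<xi> w ^ k) = c * Y \<xi>"
proof -
  let ?r = "2 * pi powr (real CARD('n) / 2) * rGamma (real CARD('n) / 2 + real (k + 0)) / 2 ^ (k + 0) * (fact (k + 2 * 0) / (2 ^ 0 * fact 0))"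
  have "real CARD('n) / 2 + real k > 0" by (simp add: add_pos_nonneg)
  then have "rGamma (real CARD('n) / 2 + real k) > 0" by (simp add: rGamma_inverse_Gamma Gamma_real_pos)
  then have "?r \<noteq> 0" by simp
  moreover have "sphere_int (\<lambda>w. Y w * lin \<xi> w ^ k) = complex_of_real ?r * Y \<xi>" if "harm k (Y :: real^'n \<Rightarrow> complex)" for Y \<xi>
    using sphere_int_harm_lin_power[OF that, of \<xi> 0] by simp
  ultimately show ?thesis by (intro that[of "complex_of_real ?r"]) (simp_all only: of_real_eq_0_iff not_False_eq_True)
qed

lemma harm_reproducing_0: "\<exists>R :: (real^'n \<Rightarrow> complex) \<Rightarrow> _. harm_reproducing 0 R"
proof -
  obtain c :: complex where c: "c \<noteq> 0" "\<And>Y \<xi>. harm 0 (Y :: real^'n \<Rightarrow> complex) \<Longrightarrow> sphere_int (\<lambda>w. Y w * lin \<xi> w ^ 0) = c * Y \<xi>"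
    using sphere_int_harm_lin_power_diag[of 0] by blast
  \<comment> \<open>The kernel is the constant 1 / c, of rank one; hence the one-point index
    set.\<close>
  have "harm_reproducing 0 (\<lambda>h \<xi>. \<Sum>a\<in>{()}. sphere_int (\<lambda>w::real^'n. h w * (1 / c)) * 1)"
  proof (rule harm_reproducingI)
    fix j and Y :: "real^'n \<Rightarrow> complex" and \<xi> :: "real^'n" assume Y: "harm j Y"
    show "sphere_int (\<lambda>w. Y w * (\<Sum>a\<in>{()}. 1 * (1 / c))) = (if j = 0 then Y \<xi> else 0)"
    proof (cases "j = 0")
      case True
      then show ?thesis using c(2)[of Y \<xi>] Y c(1) by simp
    next
      case False
      then show ?thesis using sphere_int_orthogonal[OF Y harm_const[of 1]] by simp
    qed
  qed (auto intro: harm_const)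
  then show ?thesis by blast
qed

lemma harm_x: "harm 1 (\<lambda>x. complex_of_real (x $ i))"
  unfolding harm_def using hom_poly_x[of i] lap_hp1[OF hom_poly_x[of i]] by simp

lemma harm_sum_of: "finite A \<Longrightarrow> (\<And>a. a \<in> A \<Longrightarrow> harm k (P a)) \<Longrightarrow> harm k (\<lambda>x. \<Sum>a\<in>A. P a x)"
  by (induction A rule: finite_induct) (auto intro: harm_add)

lemma harm_lin: "harm 1 (lin \<xi>)"
  unfolding lin_def[abs_def] by (rule harm_sum_of) (auto intro: harm_cmult harm_x[unfolded One_nat_def])

text \<open>\<open>lin \<xi>\<close> is itself harmonic of degree 1, so orthogonality kills the
  other degrees without any correction of the kernel.\<close>

lemma harm_reproducing_1: "\<exists>R :: (real^'n \<Rightarrow> complex) \<Rightarrow> _. harm_reproducing 1 R"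
proof -
  obtain c :: complex where c: "c \<noteq> 0" "\<And>Y \<xi>. harm 1 (Y :: real^'n \<Rightarrow> complex) \<Longrightarrow> sphere_int (\<lambda>w. Y w * lin \<xi> w ^ 1) = c * Y \<xi>"
    using sphere_int_harm_lin_power_diag[of 1] by blast
  have "harm_reproducing 1 (\<lambda>h \<xi>. \<Sum>i\<in>(UNIV::'n set). sphere_int (\<lambda>w. h w * (complex_of_real (w $ i) / c)) * complex_of_real (\<xi> $ i))"
  proof (rule harm_reproducingI)
    fix j and Y :: "real^'n \<Rightarrow> complex" and \<xi> :: "real^'n" assume Y: "harm j Y"
    have "(\<Sum>i\<in>UNIV. complex_of_real (\<xi> $ i) * (complex_of_real (w $ i) / c)) = lin \<xi> w / c" for w
      by (simp add: lin_def sum_divide_distrib)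
    then have "sphere_int (\<lambda>w. Y w * (\<Sum>i\<in>UNIV. complex_of_real (\<xi> $ i) * (complex_of_real (w $ i) / c))) = sphere_int (\<lambda>w. Y w * lin \<xi> w) / c"
      by simp
    also have "\<dots> = (if j = 1 then Y \<xi> else 0)"
      using c(2)[of Y \<xi>] Y c(1) sphere_int_orthogonal[OF Y harm_lin[of \<xi>]] by auto
    finally show "sphere_int (\<lambda>w. Y w * (\<Sum>i\<in>UNIV. complex_of_real (\<xi> $ i) * (complex_of_real (w $ i) / c))) = (if j = 1 then Y \<xi> else 0)" .
  qed (auto intro!: continuous_intros c harm_x[unfolded One_nat_def])
  then show ?thesis by blast
qed

text \<open>The trace-free part of a product of two coordinates: the multiple of |x|^2 subtracted on
  the diagonal makes it harmonic.\<close>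

definition quad :: "'n \<Rightarrow> 'n \<Rightarrow> real^'n \<Rightarrow> complex" where
  "quad i j x = complex_of_real (x $ i) * complex_of_real (x $ j) - (if i = j then sqnorm x / of_nat CARD('n) else 0)"

lemma lap_xx: "lap (\<lambda>x::real^'n. complex_of_real (x $ i) * complex_of_real (x $ j)) = (\<lambda>x. if i = j then 2 else 0)"
proof -
  have "partial l (partial l (\<lambda>x::real^'n. complex_of_real (x $ i) * complex_of_real (x $ j))) = (\<lambda>x. if l = i \<and> l = j then 2 else 0)" for l
    unfolding partial_mult[OF hom_poly_x hom_poly_x] partial_x by (cases "l = i"; cases "l = j") (simp_all add: partial_x partial_add[OF hom_poly_x hom_poly_x] partial_cmult[OF hom_poly_x])
  then show ?thesis unfolding lap_def by (intro ext, cases "i = j") (auto intro!: sum.neutral)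
qed

lemma harm_quad: "harm 2 (quad i j :: real^'n \<Rightarrow> complex)"
proof (cases "i = j")
  case True
  let ?c = "- 1 / of_nat CARD('n) :: complex"
  have q: "quad i j = (\<lambda>x. complex_of_real (x $ i) * complex_of_real (x $ j) + ?c * sqnorm x)" using True by (simp add: quad_def fun_eq_iff)
  have "lap (sqnorm :: real^'n \<Rightarrow> complex) = (\<lambda>x. of_nat (2 * CARD('n)))"
  proof -
    have h: "hom_poly 0 (\<lambda>x::real^'n. 1)" by (rule hom_poly_const)
    show ?thesis using lap_sqnorm_mult[OF h] lap_hp1[OF h] by simp
  qed
  then have "lap (quad i j :: real^'n \<Rightarrow> complex) = (\<lambda>x. 0)"
    unfolding q lap_add[OF hom_poly_xx hom_poly_cmult[OF hom_poly_sqnorm]] lap_cmult[OF hom_poly_sqnorm] lap_xx using True by simp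
  moreover have "hom_poly 2 (quad i j)" unfolding q by (rule hom_poly_add[OF hom_poly_xx hom_poly_cmult[OF hom_poly_sqnorm]])
  ultimately show ?thesis by (simp add: harm_def)
next
  case False
  then have q: "quad i j = (\<lambda>x. complex_of_real (x $ i) * complex_of_real (x $ j))" by (simp add: quad_def fun_eq_iff)
  show ?thesis unfolding q harm_def using hom_poly_xx lap_xx[of i j] False by simp
qed

text \<open>The trace is removed in x only, yet the result is symmetric in x and y, so the kernel is
  harmonic in either variable.\<close>

lemma quad_kernel:
  fixes x y :: "real^'n"
  shows "(\<Sum>(i, j)\<in>UNIV. quad i j x * (complex_of_real (y $ i) * complex_of_real (y $ j))) = (lin x y)\<^sup>2 - sqnorm x * sqnorm y / of_nat CARD('n)"
proof -
  have "(\<Sum>(i, j)\<in>UNIV. quad i j x * (complex_of_real (y $ i) * complex_of_real (y $ j))) =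
     (\<Sum>i\<in>UNIV. \<Sum>j\<in>UNIV. quad i j x * (complex_of_real (y $ i) * complex_of_real (y $ j)))"
    by (simp add: sum.cartesian_product UNIV_Times_UNIV[symmetric] del: UNIV_Times_UNIV)
  also have "\<dots> = (\<Sum>i\<in>UNIV. \<Sum>j\<in>UNIV. (complex_of_real (x $ i) * complex_of_real (y $ i)) * (complex_of_real (x $ j) * complex_of_real (y $ j)))
     - (\<Sum>i\<in>UNIV. \<Sum>j\<in>UNIV. if i = j then sqnorm x / of_nat CARD('n) * (complex_of_real (y $ i) * complex_of_real (y $ i)) else 0)"
    unfolding sum_subtractf[symmetric] by (intro sum.cong refl) (auto simp: quad_def algebra_simps)
  also have "\<dots> = (lin x y)\<^sup>2 - sqnorm x / of_nat CARD('n) * sqnorm y"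
  proof (rule arg_cong2[of _ _ _ _ "(-)"])
    show "(\<Sum>i\<in>UNIV. \<Sum>j\<in>UNIV. (complex_of_real (x $ i) * complex_of_real (y $ i)) * (complex_of_real (x $ j) * complex_of_real (y $ j))) = (lin x y)\<^sup>2"
      unfolding lin_def power2_eq_square sum_product ..
    show "(\<Sum>i\<in>UNIV. \<Sum>j\<in>UNIV. if i = j then sqnorm x / of_nat CARD('n) * (complex_of_real (y $ i) * complex_of_real (y $ i)) else 0) = sqnorm x / of_nat CARD('n) * sqnorm y"
      by (simp add: sqnorm_def[of y] sum_distrib_left)
  qed
  finally show ?thesis by simp
qed

lemma harm_reproducing_2: "\<exists>R :: (real^'n \<Rightarrow> complex) \<Rightarrow> _. harm_reproducing 2 R"
proof -
  obtain c :: complex where c: "c \<noteq> 0" "\<And>Y \<xi>. harm 2 (Y :: real^'n \<Rightarrow> complex) \<Longrightarrow> sphere_int (\<lambda>w. Y w * lin \<xi> w ^ 2) = c * Y \<xi>"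
    using sphere_int_harm_lin_power_diag[of 2] by blast
  let ?\<phi> = "\<lambda>a. quad (fst a) (snd a) :: real^'n \<Rightarrow> complex"
  let ?\<psi> = "\<lambda>a (w::real^'n). complex_of_real (w $ fst a) * complex_of_real (w $ snd a) / c"
  have "harm_reproducing 2 (\<lambda>h \<xi>. \<Sum>a\<in>(UNIV::('n \<times> 'n) set). sphere_int (\<lambda>w. h w * ?\<psi> a w) * ?\<phi> a \<xi>)"
  proof (rule harm_reproducingI)
    fix j and Y :: "real^'n \<Rightarrow> complex" and \<xi> :: "real^'n" assume Y: "harm j Y"
    have k: "(\<Sum>a\<in>UNIV. ?\<phi> a \<xi> * ?\<psi> a w) = ((lin \<xi> w)\<^sup>2 - sqnorm \<xi> * sqnorm w / of_nat CARD('n)) / c" for w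
      unfolding quad_kernel[symmetric] by (simp add: sum_divide_distrib case_prod_beta')
    have s: "sphere_int (\<lambda>w. Y w * (\<Sum>a\<in>UNIV. ?\<phi> a \<xi> * ?\<psi> a w)) = sphere_int (\<lambda>w. Y w * ((lin \<xi> w)\<^sup>2 - sqnorm \<xi> * sqnorm w / of_nat CARD('n))) / c"
      unfolding k by simp
    show "sphere_int (\<lambda>w. Y w * (\<Sum>a\<in>UNIV. ?\<phi> a \<xi> * ?\<psi> a w)) = (if j = 2 then Y \<xi> else 0)"
    proof (cases "j = 2")
      case True
      have cY: "continuous_on (sphere 0 1) Y" by (rule hom_poly_continuous[OF harm_hom_poly[OF Y]])
      have cl: "continuous_on (sphere 0 1) (lin \<xi>)" by (rule hom_poly_continuous[OF hom_poly_lin])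
      have "sphere_int (\<lambda>w. Y w * ((lin \<xi> w)\<^sup>2 - sqnorm \<xi> * sqnorm w / of_nat CARD('n))) = sphere_int (\<lambda>w. Y w * (lin \<xi> w)\<^sup>2 - Y w * (sqnorm \<xi> / of_nat CARD('n)))"
        by (rule Bochner_Integration.integral_cong) (auto simp: sqnorm_norm algebra_simps)
      also have "\<dots> = sphere_int (\<lambda>w. Y w * (lin \<xi> w)\<^sup>2) - sphere_int (\<lambda>w. Y w * (sqnorm \<xi> / of_nat CARD('n)))"
        by (intro Bochner_Integration.integral_diff sphere_integrable continuous_intros cY cl)
      \<comment> \<open>The trace correction pairs Y with a constant and drops out, so the squared
        linear form alone gives the factor c.\<close>
      also have "sphere_int (\<lambda>w. Y w * (sqnorm \<xi> / of_nat CARD('n))) = 0" using sphere_int_orthogonal[OF Y harm_const] True by simp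
      finally show ?thesis unfolding s using c(2)[of Y \<xi>] Y True c(1) by simp
    next
      case False
      \<comment> \<open>Here the roles of the variables are exchanged: as a function of w the kernel
        is a combination of the harmonics \<open>quad\<close>, by its symmetry.\<close>
      have "harm 2 (\<lambda>w. \<Sum>(i, j)\<in>UNIV. quad i j w * (complex_of_real (\<xi> $ i) * complex_of_real (\<xi> $ j)))"
        unfolding case_prod_beta' mult.commute[of "quad _ _ _"] by (intro harm_sum_of harm_cmult harm_quad) simp
      then have "harm 2 (\<lambda>w. (lin \<xi> w)\<^sup>2 - sqnorm \<xi> * sqnorm w / of_nat CARD('n))"
        unfolding quad_kernel by (simp add: lin_inner inner_commute mult.commute)
      from sphere_int_orthogonal[OF Y this False] show ?thesis unfolding s using False by simp
    qed
  qed (auto intro!: continuous_intros c harm_quad)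
  then show ?thesis by blast
qed

text \<open>Write f = h + S with S a sum of harmonics and h small. The projections recover the
  components of S, so f minus the sum of its projections equals h minus the sum of the projections
  of h, which is small in L1. The limit is thus known in advance, and the approximating harmonics
  need not be shown to converge.\<close>

lemma harm_closed:
  fixes f :: "real^'n \<Rightarrow> complex"
  assumes f: "f \<in> L2_sphere" and K: "K \<subseteq> {0, 1, 2}"
    and approx: "\<And>e. e > 0 \<Longrightarrow> \<exists>Y. (\<forall>k. harm k (Y k)) \<and> L2_norm_sq (\<lambda>w. f w - (\<Sum>k\<in>K. Y k w)) < e"
  shows "\<exists>P. (\<forall>k. harm k (P k)) \<and> (AE w in sphere_measure. f w = (\<Sum>k\<in>K. P k w))"
proof -
  have fK: "finite K" using K by (rule finite_subset) simp
  have "\<exists>R :: (real^'n \<Rightarrow> complex) \<Rightarrow> _. harm_reproducing k R" if "k \<in> K" for k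
    using K that harm_reproducing_0[where 'n = 'n] harm_reproducing_1[where 'n = 'n] harm_reproducing_2[where 'n = 'n] by auto
  then obtain R :: "nat \<Rightarrow> (real^'n \<Rightarrow> complex) \<Rightarrow> real^'n \<Rightarrow> complex" where R: "\<And>k. k \<in> K \<Longrightarrow> harm_reproducing k (R k)"
    by metis
  obtain B where B: "\<And>k. k \<in> K \<Longrightarrow> B k \<ge> 0" "\<And>k h \<xi>. k \<in> K \<Longrightarrow> integrable sphere_measure h \<Longrightarrow> \<xi> \<in> sphere 0 1 \<Longrightarrow>
      cmod (R k h \<xi>) \<le> B k * (\<integral>w. cmod (h w) \<partial>sphere_measure)"
  proof -
    have "\<forall>k\<in>K. \<exists>B\<ge>0. \<forall>h. integrable sphere_measure h \<longrightarrow> (\<forall>\<xi>\<in>sphere 0 1. cmod (R k h \<xi>) \<le> B * (\<integral>w. cmod (h w) \<partial>sphere_measure))"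
      using R unfolding harm_reproducing_def by blast
    then show ?thesis using that by metis
  qed
  have Radd: "R k (\<lambda>w. h w + g w) \<xi> = R k h \<xi> + R k g \<xi>" if "k \<in> K" "integrable sphere_measure h" "integrable sphere_measure g" for k h g \<xi>
  proof -
    have "R k (\<lambda>w. h w + g w) = (\<lambda>\<xi>. R k h \<xi> + R k g \<xi>)" using R[OF that(1)] that(2,3) unfolding harm_reproducing_def by blast
    then show ?thesis by (rule fun_cong)
  qed
  have Rrep: "R k Y = (if j = k then Y else (\<lambda>\<xi>. 0))" if "k \<in> K" "harm j Y" for k j Y
    using R[OF that(1)] that(2) unfolding harm_reproducing_def by blast
  define P where "P k = (if k \<in> K then R k f else (\<lambda>x. 0))" for k
  have P: "harm k (P k)" for k using R[of k] by (simp add: P_def harm_reproducing_def)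
  define g where "g w = (\<Sum>k\<in>K. P k w)" for w
  have fi: "integrable sphere_measure f" by (rule L2_integrable[OF f])
  have gi: "integrable sphere_measure g" unfolding g_def
    by (intro sphere_integrable continuous_intros hom_poly_continuous[OF harm_hom_poly[OF P]])
  define b where "b = (\<Sum>k\<in>K. B k)"
  have b: "b \<ge> 0" unfolding b_def by (intro sum_nonneg B)
  let ?m = "area TYPE('n)"
  have est: "(\<integral>w. cmod (f w - g w) \<partial>sphere_measure) \<le> (1 + b * ?m) * ((?m + 1) * e)" if e: "e > 0" for e
  proof -
    \<comment> \<open>Accuracy e^2 in the squared norm, so that \<open>L1_le_L2\<close> with
      parameter e gives a bound linear in e.\<close>
    have "e\<^sup>2 > 0" using e by simp
    from approx[OF this] obtain Y where Y: "\<And>k. harm k (Y k)" "L2_norm_sq (\<lambda>w. f w - (\<Sum>k\<in>K. Y k w)) < e\<^sup>2" by blast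
    define S where "S w = (\<Sum>k\<in>K. Y k w)" for w
    define h where "h w = f w - S w" for w
    have cS: "continuous_on (sphere 0 1) S" unfolding S_def by (intro continuous_intros hom_poly_continuous[OF harm_hom_poly[OF Y(1)]])
    have hL: "h \<in> L2_sphere" unfolding h_def[abs_def] by (intro L2_diff f L2_continuous cS)
    have hi: "integrable sphere_measure h" by (rule L2_integrable[OF hL])
    have Yi: "integrable sphere_measure (Y j)" for j by (rule hom_poly_sphere_integrable[OF harm_hom_poly[OF Y(1)]])
    define I where "I = (\<integral>w. cmod (h w) \<partial>sphere_measure)"
    have RS: "R k (\<lambda>w. \<Sum>j\<in>A. Y j w) \<xi> = (if k \<in> A then Y k \<xi> else 0)" if "k \<in> K" "finite A" for k A \<xi>
      using that(2)
    proof (induction A rule: finite_induct)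
      case empty
      show ?case using Rrep[OF \<open>k \<in> K\<close> harm_zero[of "Suc k"]] by simp
    next
      case (insert j A)
      have "integrable sphere_measure (\<lambda>w. \<Sum>j\<in>A. Y j w)" by (intro Bochner_Integration.integrable_sum Yi)
      from Radd[OF \<open>k \<in> K\<close> Yi[of j] this] show ?case using insert Rrep[OF \<open>k \<in> K\<close> Y(1)[of j]] by auto
    qed
    have Rf: "R k f \<xi> = R k h \<xi> + Y k \<xi>" if "k \<in> K" for k \<xi>
    proof -
      have "f = (\<lambda>w. h w + S w)" by (simp add: h_def fun_eq_iff)
      then have "R k f \<xi> = R k h \<xi> + R k S \<xi>" using Radd[OF that hi sphere_integrable[OF cS]] by metis
      also have "R k S \<xi> = Y k \<xi>" unfolding S_def[abs_def] using RS[OF that fK] that by simp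
      finally show ?thesis .
    qed
    have pt: "cmod (f w - g w) \<le> cmod (h w) + b * I" if w: "w \<in> sphere 0 1" for w
    proof -
      have "g w = (\<Sum>k\<in>K. R k h w) + S w"
        unfolding g_def S_def sum.distrib[symmetric] by (intro sum.cong refl) (simp add: P_def Rf)
      then have "f w - g w = h w - (\<Sum>k\<in>K. R k h w)" by (simp add: h_def)
      then have "cmod (f w - g w) \<le> cmod (h w) + cmod (\<Sum>k\<in>K. R k h w)" by (simp add: norm_triangle_ineq4)
      also have "cmod (\<Sum>k\<in>K. R k h w) \<le> (\<Sum>k\<in>K. B k * I)"
        unfolding I_def by (intro sum_norm_le B hi w)
      also have "\<dots> = b * I" by (simp add: b_def sum_distrib_right)
      finally show ?thesis by simp
    qed
    have "(\<integral>w. cmod (f w - g w) \<partial>sphere_measure) \<le> (\<integral>w. cmod (h w) + b * I \<partial>sphere_measure)"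
      using fi gi hi pt by (intro integral_mono) auto
    also have "\<dots> = (1 + b * ?m) * I" using hi by (simp add: I_def area_def algebra_simps)
    also have "\<dots> \<le> (1 + b * ?m) * ((?m + 1) * e)"
    proof (rule mult_left_mono)
      have "I \<le> e * ?m + L2_norm_sq h / e" unfolding I_def by (rule L1_le_L2[OF hL e])
      also have "L2_norm_sq h / e \<le> e\<^sup>2 / e"
        using Y(2) e unfolding h_def[abs_def] S_def by (intro divide_right_mono) auto
      also have "e * ?m + e\<^sup>2 / e = (?m + 1) * e" using e by (simp add: power2_eq_square algebra_simps)
      finally show "I \<le> (?m + 1) * e" by simp
      show "0 \<le> 1 + b * ?m" using b area_pos[where 'n = 'n] by (simp add: add_nonneg_nonneg)
    qed
    finally show ?thesis .
  qed
  have "(\<integral>w. cmod (f w - g w) \<partial>sphere_measure) \<le> 0"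
  proof (rule field_le_epsilon)
    fix t :: real assume t: "t > 0"
    define c where "c = (1 + b * ?m) * (?m + 1)"
    have c: "c > 0" using b area_pos[where 'n = 'n] unfolding c_def by (intro mult_pos_pos add_pos_nonneg add_nonneg_pos mult_nonneg_nonneg) auto
    show "(\<integral>w. cmod (f w - g w) \<partial>sphere_measure) \<le> 0 + t"
      using est[of "t / c"] t c by (simp add: c_def[symmetric] mult.assoc[symmetric])
  qed
  moreover have "(\<integral>w. cmod (f w - g w) \<partial>sphere_measure) \<ge> 0" by simp
  ultimately have "(\<integral>w. cmod (f w - g w) \<partial>sphere_measure) = 0" by linarith
  then have "AE w in sphere_measure. cmod (f w - g w) = 0"
    using fi gi by (subst (asm) integral_nonneg_eq_0_iff_AE) auto
  then have "AE w in sphere_measure. f w = (\<Sum>k\<in>K. P k w)" by eventually_elim (simp add: g_def)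
  then show ?thesis using P by blast
qed

text \<open>The coercive inequality for the approximants is used twice in the limit: its
  nonnegativity gives the bound, and if the limiting deficit is zero, the components of the
  approximants with degree in K come arbitrarily close to f.\<close>

lemma ball_form_le:
  fixes f :: "real^'n \<Rightarrow> complex"
  assumes f: "f \<in> L2_sphere" and \<rho>: "\<rho> > 0" and \<nu>: "\<nu> = real CARD('n) / 2 - 1"
    and K: "K \<subseteq> {0, 1, 2}" "\<And>k. k \<in> K \<Longrightarrow> Lambda k \<nu> \<rho> = C" "\<And>k. k \<notin> K \<Longrightarrow> Lambda k \<nu> \<rho> \<le> C - \<delta>" and \<delta>: "\<delta> > 0"
  shows "ball_form \<rho> f \<le> C * L2_norm_sq f"
    and "ball_form \<rho> f = C * L2_norm_sq f \<Longrightarrow> \<exists>P. (\<forall>k. harm k (P k)) \<and> (AE w in sphere_measure. f w = (\<Sum>k\<in>K. P k w))"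
proof -
  have fK: "finite K" using K(1) by (rule finite_subset) simp
  obtain p where p: "\<And>n. harm_sum (p n)" and b: "\<And>n. L2_norm_sq (\<lambda>w. f w - p n w) < 1 / (real (Suc n))\<^sup>2"
    using approximating_sequence[OF f] by metis
  have pL: "p n \<in> L2_sphere" for n by (rule harm_sum_L2[OF p])
  have "\<forall>n. \<exists>Y. (\<forall>k. harm k (Y k)) \<and> \<delta> * L2_norm_sq (\<lambda>w. p n w - (\<Sum>k\<in>K. Y k w)) \<le> C * L2_norm_sq (p n) - ball_form \<rho> (p n)"
    using coercive_harm_sum[OF p \<rho> \<nu> fK K(2,3)] by blast
  then obtain Y where Y: "\<And>n k. harm k (Y n k)"
    "\<And>n. \<delta> * L2_norm_sq (\<lambda>w. p n w - (\<Sum>k\<in>K. Y n k w)) \<le> C * L2_norm_sq (p n) - ball_form \<rho> (p n)" by metis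
  have lim: "(\<lambda>n. C * L2_norm_sq (p n) - ball_form \<rho> (p n)) \<longlonglongrightarrow> C * L2_norm_sq f - ball_form \<rho> f"
    by (intro tendsto_intros L2_norm_sq_tendsto[OF f pL b] ball_form_tendsto[OF f pL b])
  have nn: "0 \<le> \<delta> * L2_norm_sq (\<lambda>w. p n w - (\<Sum>k\<in>K. Y n k w))" for n
    using \<delta> by (simp add: L2_norm_sq_nonneg)
  have "0 \<le> C * L2_norm_sq f - ball_form \<rho> f"
    by (rule LIMSEQ_le_const[OF lim]) (use nn Y(2) order_trans in blast)
  then show "ball_form \<rho> f \<le> C * L2_norm_sq f" by simp
  assume eq: "ball_form \<rho> f = C * L2_norm_sq f"
  have "\<exists>Y. (\<forall>k. harm k (Y k)) \<and> L2_norm_sq (\<lambda>w. f w - (\<Sum>k\<in>K. Y k w)) < e" if e: "e > 0" for e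
  proof -
    have "(\<lambda>n. C * L2_norm_sq (p n) - ball_form \<rho> (p n)) \<longlonglongrightarrow> 0" using lim eq by simp
    moreover have "\<delta> * (e / 4) > 0" using \<delta> e by simp
    ultimately have ev1: "eventually (\<lambda>n. C * L2_norm_sq (p n) - ball_form \<rho> (p n) < \<delta> * (e / 4)) sequentially" by (rule order_tendstoD(2))
    have "e / 4 > 0" using e by simp
    then have "eventually (\<lambda>n. 1 / real (Suc n) < e / 4) sequentially" by (rule order_tendstoD(2)[OF inverse_Suc_tendsto])
    with ev1 have "eventually (\<lambda>n. C * L2_norm_sq (p n) - ball_form \<rho> (p n) < \<delta> * (e / 4) \<and> 1 / real (Suc n) < e / 4) sequentially"
      by (rule eventually_conj)
    then obtain n where n1: "C * L2_norm_sq (p n) - ball_form \<rho> (p n) < \<delta> * (e / 4)" and n2: "1 / real (Suc n) < e / 4"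
      using eventually_happens'[OF sequentially_bot] by blast
    have cS: "continuous_on (sphere 0 1) (\<lambda>w. \<Sum>k\<in>K. Y n k w)" by (intro continuous_intros hom_poly_continuous[OF harm_hom_poly[OF Y(1)]])
    have "\<delta> * L2_norm_sq (\<lambda>w. p n w - (\<Sum>k\<in>K. Y n k w)) < \<delta> * (e / 4)" using Y(2)[of n] n1 by linarith
    then have a: "L2_norm_sq (\<lambda>w. p n w - (\<Sum>k\<in>K. Y n k w)) < e / 4" using \<delta> by simp
    have "1 / (real (Suc n))\<^sup>2 \<le> 1 / real (Suc n)" by (intro divide_left_mono) (auto simp: power2_eq_square)
    then have c: "L2_norm_sq (\<lambda>w. f w - p n w) < e / 4" using b[of n] n2 by linarith
    have "L2_norm_sq (\<lambda>w. (f w - p n w) + (p n w - (\<Sum>k\<in>K. Y n k w)))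
      \<le> 2 * L2_norm_sq (\<lambda>w. f w - p n w) + 2 * L2_norm_sq (\<lambda>w. p n w - (\<Sum>k\<in>K. Y n k w))"
      by (intro L2_norm_sq_add L2_diff f pL L2_continuous cS)
    then have "L2_norm_sq (\<lambda>w. f w - (\<Sum>k\<in>K. Y n k w)) < e" using a c by simp
    then show ?thesis using Y(1) by blast
  qed
  then show "\<exists>P. (\<forall>k. harm k (P k)) \<and> (AE w in sphere_measure. f w = (\<Sum>k\<in>K. P k w))"
    by (rule harm_closed[OF f K(1)])
qed

lemma ball_form_eq:
  fixes f :: "real^'n \<Rightarrow> complex"
  assumes f: "f \<in> borel_measurable sphere_measure" and \<rho>: "\<rho> > 0" and \<nu>: "\<nu> = real CARD('n) / 2 - 1"
    and K: "finite K" "\<And>k. k \<in> K \<Longrightarrow> Lambda k \<nu> \<rho> = C"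
    and P: "\<And>k. k \<in> K \<Longrightarrow> harm k (P k)" and ae: "AE w in sphere_measure. f w = (\<Sum>k\<in>K. P k w)"
  shows "ball_form \<rho> f = C * L2_norm_sq f"
proof -
  have m: "(\<lambda>w. \<Sum>k\<in>K. P k w) \<in> borel_measurable sphere_measure"
    by (intro sphere_measurable continuous_intros hom_poly_continuous[OF harm_hom_poly[OF P]])
  have "ball_form \<rho> f = (\<Sum>k\<in>K. Lambda k \<nu> \<rho> * L2_norm_sq (P k))"
    unfolding ball_form_cong(1)[OF f m ae] L2_norm_sq_def by (rule ball_form_harm_sum[OF K(1) P \<rho> \<nu>])
  also have "\<dots> = C * (\<Sum>k\<in>K. L2_norm_sq (P k))" by (simp add: sum_distrib_left K(2))
  also have "(\<Sum>k\<in>K. L2_norm_sq (P k)) = L2_norm_sq f"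
    unfolding ball_form_cong(2)[OF f m ae] by (rule L2_norm_sq_harm_sum[OF K(1) P, symmetric])
  finally show ?thesis .
qed

section \<open>Nonvanishing, and translation to the spaces of the statement\<close>

lemma L2_norm_sq_pos:
  fixes f :: "real^'n \<Rightarrow> complex"
  assumes "f \<in> L2_sphere" "\<not> (AE w in sphere_measure. f w = 0)"
  shows "L2_norm_sq f > 0"
proof -
  have "L2_norm_sq f \<noteq> 0"
  proof
    assume "L2_norm_sq f = 0"
    then have "AE w in sphere_measure. (cmod (f w))\<^sup>2 = 0"
      unfolding L2_norm_sq_def using L2_int[OF assms(1)] by (subst (asm) integral_nonneg_eq_0_iff_AE) auto
    then have "AE w in sphere_measure. f w = 0" by eventually_elim simp
    then show False using assms(2) by simp
  qed
  then show ?thesis using L2_norm_sq_nonneg[of f] by linarith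
qed

text \<open>Pairing with the k-th power of \<open>lin \<xi>\<close> returns a nonzero multiple of
  P(\<xi>), so values almost everywhere on the sphere determine P(\<xi>), even at points \<xi> off
  the sphere.\<close>

lemma harm_not_AE_0:
  fixes P :: "real^'n \<Rightarrow> complex"
  assumes P: "harm k P" and nz: "P \<xi> \<noteq> 0"
  shows "\<not> (AE w in sphere_measure. P w = 0)"
proof
  assume ae: "AE w in sphere_measure. P w = 0"
  obtain c :: complex where c: "c \<noteq> 0" "\<And>Y \<xi>. harm k (Y :: real^'n \<Rightarrow> complex) \<Longrightarrow> sphere_int (\<lambda>w. Y w * lin \<xi> w ^ k) = c * Y \<xi>"
    using sphere_int_harm_lin_power_diag[of k] by blast
  have "sphere_int (\<lambda>w. P w * lin \<xi> w ^ k) = 0"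
    by (rule integral_eq_zero_AE) (use ae in eventually_elim, simp)
  then show False using c(2)[OF P, of \<xi>] c(1) nz by simp
qed

lemma sph_harm_iff: "g \<in> sph_harm k \<longleftrightarrow> (\<exists>P. harm k P \<and> (\<forall>w\<in>sphere 0 1. g w = P w))"
proof -
  have "harmonic P \<longleftrightarrow> lap P = (\<lambda>x. 0)" for P :: "real^'a \<Rightarrow> complex"
    unfolding harmonic_def laplacian_eq_lap by (auto simp: fun_eq_iff)
  then show ?thesis unfolding sph_harm_def harm_def homogeneous_poly_iff_hom_poly by auto
qed

lemma in_sph_harm_sum_iff:
  fixes f :: "real^'n \<Rightarrow> complex"
  shows "in_L2_class f (sph_harm_sum K) \<longleftrightarrow> (\<exists>P. (\<forall>k\<in>K. harm k (P k)) \<and> (AE w in sphere_measure. f w = (\<Sum>k\<in>K. P k w)))"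
proof
  assume "in_L2_class f (sph_harm_sum K)"
  then obtain g where g: "\<And>k. k \<in> K \<Longrightarrow> g k \<in> sph_harm k" "AE w in sphere_measure. f w = (\<Sum>k\<in>K. g k w)"
    unfolding in_L2_class_def sph_harm_sum_def by auto
  have "\<forall>k\<in>K. \<exists>P. harm k P \<and> (\<forall>w\<in>sphere 0 1. g k w = P w)" using g(1) by (simp add: sph_harm_iff)
  then obtain P where P: "\<And>k. k \<in> K \<Longrightarrow> harm k (P k)" "\<And>k w. k \<in> K \<Longrightarrow> w \<in> sphere 0 1 \<Longrightarrow> g k w = P k w" by metis
  have "AE w in sphere_measure. f w = (\<Sum>k\<in>K. P k w)"
    using g(2) AE_space by eventually_elim (simp add: P(2) cong: sum.cong)
  then show "\<exists>P. (\<forall>k\<in>K. harm k (P k)) \<and> (AE w in sphere_measure. f w = (\<Sum>k\<in>K. P k w))" using P(1) by blast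
next
  assume "\<exists>P. (\<forall>k\<in>K. harm k (P k)) \<and> (AE w in sphere_measure. f w = (\<Sum>k\<in>K. P k w))"
  then obtain P where P: "\<forall>k\<in>K. harm k (P k)" "AE w in sphere_measure. f w = (\<Sum>k\<in>K. P k w)" by blast
  have "(\<lambda>w. \<Sum>k\<in>K. P k w) \<in> sph_harm_sum K"
    unfolding sph_harm_sum_def
  proof (intro CollectI exI[of _ P] conjI refl ballI)
    fix k assume "k \<in> K"
    then have "harm k (P k)" using P(1) by simp
    then show "P k \<in> sph_harm k" unfolding sph_harm_iff by (intro exI[of _ "P k"]) simp
  qed
  with P(2) show "in_L2_class f (sph_harm_sum K)" unfolding in_L2_class_def by (rule bexI)
qed

lemma ball_ratio_ball_form: "ball_ratio \<rho> f = ball_form \<rho> f / L2_norm_sq f"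
  by (simp add: ball_ratio_def ball_form_def)

theorem theorem1:
  fixes \<rho> :: real
  assumes d2: "CARD('n::finite) \<ge> 2"
    and rho: "\<rho> > 0"
  defines "\<nu> \<equiv> real CARD('n) / 2 - 1"
  defines "C \<equiv> C_opt TYPE('n) \<rho>"
  defines "maxim \<equiv> (\<lambda>f :: real ^ 'n \<Rightarrow> complex.
              f \<in> L2_sphere \<and> \<not> (AE \<omega> in sphere_measure. f \<omega> = 0) \<and> ball_ratio \<rho> f = C)"
  shows "(\<exists>f. maxim f)
    \<and> (bessel_J \<nu> \<rho> * bessel_J (\<nu> + 1) \<rho> \<ge> 0 \<longrightarrow> C = Lambda 0 \<nu> \<rho>)
    \<and> (bessel_J \<nu> \<rho> * bessel_J (\<nu> + 1) \<rho> \<le> 0 \<longrightarrow> C = Lambda 1 \<nu> \<rho>)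
    \<and> (\<forall>M. ((bessel_J \<nu> \<rho> * bessel_J (\<nu> + 1) \<rho> > 0 \<and> M = sph_harm_sum {0})
            \<or> (bessel_J \<nu> \<rho> * bessel_J (\<nu> + 1) \<rho> < 0 \<and> M = sph_harm_sum {1})
            \<or> (bessel_J \<nu> \<rho> = 0 \<and> M = sph_harm_sum {0, 1})
            \<or> (bessel_J (\<nu> + 1) \<rho> = 0 \<and> M = sph_harm_sum {0, 1, 2}))
        \<longrightarrow> (\<forall>f. f \<in> L2_sphere \<and> \<not> (AE \<omega> in sphere_measure. f \<omega> = 0)
                \<longrightarrow> (maxim f \<longleftrightarrow> in_L2_class f M)))"
proof -
  define J0 where "J0 = bessel_J \<nu> \<rho>"
  define J1 where "J1 = bessel_J (\<nu> + 1) \<rho>"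
  define C0 where "C0 = max (Lambda 0 \<nu> \<rho>) (Lambda 1 \<nu> \<rho>)"
  have \<nu>: "\<nu> = real CARD('n) / 2 - 1" by (simp add: \<nu>_def)
  note cases = Lambda_cases[OF rho \<nu> d2, folded J0_def J1_def C0_def]
  \<comment> \<open>The alternatives of the statement are recast as conditions on the set of
    degrees, so that one argument treats them all.\<close>
  define ok where "ok K \<longleftrightarrow> J0 * J1 > 0 \<and> K = {0} \<or> J0 * J1 < 0 \<and> K = {1} \<or> J0 = 0 \<and> K = {0, 1} \<or> J1 = 0 \<and> K = {0, 1, 2}" for K :: "nat set"
  have okD: "K \<subseteq> {0, 1, 2}" "finite K" if "ok K" for K using that unfolding ok_def by auto
  have okL: "\<And>k. k \<in> K \<Longrightarrow> Lambda k \<nu> \<rho> = C0" "\<exists>\<delta>>0. \<forall>k. k \<notin> K \<longrightarrow> Lambda k \<nu> \<rho> \<le> C0 - \<delta>" if "ok K" for K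
  proof -
    have "(\<forall>k\<in>K. Lambda k \<nu> \<rho> = C0) \<and> (\<exists>\<delta>>0. \<forall>k. k \<notin> K \<longrightarrow> Lambda k \<nu> \<rho> \<le> C0 - \<delta>)"
      by (rule cases(3)) (use that in \<open>simp only: ok_def\<close>)
    then show "\<And>k. k \<in> K \<Longrightarrow> Lambda k \<nu> \<rho> = C0" "\<exists>\<delta>>0. \<forall>k. k \<notin> K \<longrightarrow> Lambda k \<nu> \<rho> \<le> C0 - \<delta>"
      by simp_all
  qed
  have nonzero: "ball_ratio \<rho> f = C0 \<longleftrightarrow> ball_form \<rho> f = C0 * L2_norm_sq f"
    if "f \<in> L2_sphere" "\<not> (AE \<omega> in sphere_measure. f \<omega> = 0)" for f :: "real^'n \<Rightarrow> complex"
    using L2_norm_sq_pos[OF that] by (simp add: ball_ratio_ball_form divide_eq_eq)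
  have main: "ball_ratio \<rho> f \<le> C0" "ball_ratio \<rho> f = C0 \<longleftrightarrow> in_L2_class f (sph_harm_sum K)"
    if K: "ok K" and f: "f \<in> L2_sphere" "\<not> (AE \<omega> in sphere_measure. f \<omega> = 0)" for K and f :: "real^'n \<Rightarrow> complex"
  proof -
    obtain \<delta> where \<delta>: "\<delta> > 0" "\<And>k. k \<notin> K \<Longrightarrow> Lambda k \<nu> \<rho> \<le> C0 - \<delta>" using okL(2)[OF K] by blast
    have le: "ball_form \<rho> f \<le> C0 * L2_norm_sq f"
      by (rule ball_form_le(1)[OF f(1) rho \<nu> okD(1)[OF K] _ _ \<delta>(1)], rule okL(1)[OF K], assumption, rule \<delta>(2))
    have eqD: "\<exists>P. (\<forall>k. harm k (P k)) \<and> (AE w in sphere_measure. f w = (\<Sum>k\<in>K. P k w))"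
      if "ball_form \<rho> f = C0 * L2_norm_sq f"
      by (rule ball_form_le(2)[OF f(1) rho \<nu> okD(1)[OF K] _ _ \<delta>(1) that], rule okL(1)[OF K], assumption, rule \<delta>(2))
    show "ball_ratio \<rho> f \<le> C0" using le L2_norm_sq_pos[OF f] by (simp add: ball_ratio_ball_form divide_le_eq)
    show "ball_ratio \<rho> f = C0 \<longleftrightarrow> in_L2_class f (sph_harm_sum K)"
      unfolding nonzero[OF f] in_sph_harm_sum_iff
    proof
      assume "ball_form \<rho> f = C0 * L2_norm_sq f"
      from eqD[OF this] obtain P where P: "(\<forall>k. harm k (P k)) \<and> (AE w in sphere_measure. f w = (\<Sum>k\<in>K. P k w))" ..
      then show "\<exists>P. (\<forall>k\<in>K. harm k (P k)) \<and> (AE w in sphere_measure. f w = (\<Sum>k\<in>K. P k w))"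
        by (intro exI[of _ P]) simp
    next
      assume "\<exists>P. (\<forall>k\<in>K. harm k (P k)) \<and> (AE w in sphere_measure. f w = (\<Sum>k\<in>K. P k w))"
      then obtain P where P: "\<And>k. k \<in> K \<Longrightarrow> harm k (P k)" "AE w in sphere_measure. f w = (\<Sum>k\<in>K. P k w)" by blast
      show "ball_form \<rho> f = C0 * L2_norm_sq f"
        by (rule ball_form_eq[OF L2_meas[OF f(1)] rho \<nu> okD(2)[OF K] _ _ P(2)], rule okL(1)[OF K], assumption, rule P(1))
    qed
  qed
  \<comment> \<open>Some alternative always applies: a zero product means J0 = 0 or J1 = 0.\<close>
  obtain K0 where K0: "ok K0" unfolding ok_def by (cases "J0 * J1" "0::real" rule: linorder_cases) auto
  have exists: "\<exists>f :: real^'n \<Rightarrow> complex. f \<in> L2_sphere \<and> \<not> (AE \<omega> in sphere_measure. f \<omega> = 0) \<and> ball_ratio \<rho> f = C0"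
  proof -
    \<comment> \<open>Every admissible K0 contains 0 or 1, so a constant or a coordinate function
      serves as a maximizer.\<close>
    obtain k and P :: "real^'n \<Rightarrow> complex" and \<xi> where P: "k \<in> K0" "harm k P" "P \<xi> \<noteq> 0"
    proof (cases "0 \<in> K0")
      case True
      show ?thesis by (rule that[OF True harm_const[of 1]]) simp
    next
      case False
      then have "1 \<in> K0" using K0 unfolding ok_def by auto
      then show ?thesis by (rule that[OF _ harm_x[of undefined], of "axis undefined 1"]) simp
    qed
    have L: "P \<in> L2_sphere" by (intro L2_continuous hom_poly_continuous[OF harm_hom_poly[OF P(2)]])
    have nz: "\<not> (AE \<omega> in sphere_measure. P \<omega> = 0)" by (rule harm_not_AE_0[OF P(2,3)])
    have "P w = (\<Sum>j\<in>K0. (if j = k then P else (\<lambda>x. 0)) w)" for w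
      using P(1) okD(2)[OF K0] by (simp add: if_distrib[of "\<lambda>f. f w"] cong: if_cong)
    then have "in_L2_class P (sph_harm_sum K0)"
      unfolding in_sph_harm_sum_iff using P(2) by (intro exI[of _ "\<lambda>j. if j = k then P else (\<lambda>x. 0)"]) auto
    then show ?thesis using main(2)[OF K0 L nz] L nz by blast
  qed
  have C: "C = C0"
    unfolding C_def C_opt_def
  \<comment> \<open>\<open>Sup\<close> on the reals carries information only for a nonempty bounded
    set, so the value \<open>C\<close> is identified only now, from the bound and its attainment
    together.\<close>
  proof (rule cSup_eq_maximum)
    show "C0 \<in> {ball_ratio \<rho> f | f :: real^'n \<Rightarrow> complex. f \<in> L2_sphere \<and> \<not> (AE \<omega> in sphere_measure. f \<omega> = 0)}"
      using exists by blast
    show "\<And>x. x \<in> {ball_ratio \<rho> f | f :: real^'n \<Rightarrow> complex. f \<in> L2_sphere \<and> \<not> (AE \<omega> in sphere_measure. f \<omega> = 0)} \<Longrightarrow> x \<le> C0"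
      using main(1)[OF K0] by blast
  qed
  show ?thesis
    unfolding J0_def[symmetric] J1_def[symmetric]
  proof (intro conjI impI allI)
    show "\<exists>f. maxim f" using exists unfolding maxim_def C .
    show "C = Lambda 0 \<nu> \<rho>" if "J0 * J1 \<ge> 0" using cases(1)[OF that] C by simp
    show "C = Lambda 1 \<nu> \<rho>" if "J0 * J1 \<le> 0" using cases(2)[OF that] C by simp
    fix M :: "(real^'n \<Rightarrow> complex) set" and f :: "real^'n \<Rightarrow> complex"
    assume M: "J0 * J1 > 0 \<and> M = sph_harm_sum {0} \<or> J0 * J1 < 0 \<and> M = sph_harm_sum {1} \<or> J0 = 0 \<and> M = sph_harm_sum {0, 1} \<or> J1 = 0 \<and> M = sph_harm_sum {0, 1, 2}"
      and f: "f \<in> L2_sphere \<and> \<not> (AE \<omega> in sphere_measure. f \<omega> = 0)"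
    then obtain K where K: "ok K" "M = sph_harm_sum K" unfolding ok_def by blast
    show "maxim f \<longleftrightarrow> in_L2_class f M"
      unfolding maxim_def C K(2) using main(2)[OF K(1)] f by blast
  qed
qed

end
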